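(* The following groups (all subgroups of $Sp(2,\mathbb{R})$ in the class $\mathcal{E}_2$) are not reproducing: - $\Sigma_1\rtimes\{R_t:t\in\mathbb{R}\}$; - $\Sigma_2\rtimes\{A_t:t\in\mathbb{R}\}$; - $\Sigma_3\rtimes\left\{\begin{bmatrix}1&0\\ t&1\end{bmatrix}:t\in\mathbb{R}\right\}$; - $\Sigma_3\rtimes\left\{\begin{bmatrix}1&0\\ 0&e^t\end{bmatrix}:t\in\mathbb{R}\right\}$; - $\Sigma_3\rtimes\left\{\begin{bmatrix}e^t&0\\ s&e^{3t}\end{bmatrix}:s,t\in\mathbb{R}\right\}$; - $\Sigma_1^\perp\rtimes\{R_t:t\in\mathbb{R}\}$; - $\Sigma_2^\perp\rtimes\{A_t:t\in\mathbb{R}\}$; - $\Sigma_3^\perp\rtimes\left\{\begin{bmatrix}1&t\\ 0&1\end{bmatrix}:t\in\mathbb{R}\right\}$; - $\Sigma_3^\perp\rtimes\left\{\begin{bmatrix}t&s\\ 0&1\end{bmatrix}:s\in\mathbb{R},\ t>0\right\}$; - $\Sigma_3^\perp\rtimes\left\{\begin{bmatrix}c&b\\ 0&a\end{bmatrix}:a,b,c\in\mathbb{R},\ a>0,\ c>0\right\}$.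
   Context: $Sp(2,\mathbb{R})$ is the symplectic group acting on $\mathbb{R}^4$. Class $\mathcal{E}_2$: a Lie subgroup $G$ of $Sp(2,\mathbb{R})$ belongs to $\mathcal{E}_2$ if it has the form $$G=\left\{\begin{bmatrix}h&0\\ \sigma h&{}^th^{-1}\end{bmatrix}:h\in H,\ \sigma\in\Sigma\right\},$$ where $H$ is a connected Lie subgroup of $GL(2,\mathbb{R})$, $\Sigma$ is a linear subspace of the space $\mathrm{Sym}(2,\mathbb{R})$ of symmetric $2\times 2$ real matrices, and both $\Sigma$ and $H$ are non-trivial. Such a $G$ is denoted $\Sigma\rtimes H$. Reproducing groups: let $\mu$ be the metaplectic representation of $Sp(2,\mathbb{R})$ on $L^2(\mathbb{R}^2,dx)$ (a projective unitary representation). For a Lie subgroup $G$ of $Sp(2,\mathbb{R})$ let $U$ be the restriction of $\mu$ to $G$ and $dg$ a left Haar measure of $G$. $G$ is called reproducing if there exists $\eta\in L^2(\mathbb{R}^2)$ such that $\|f\|^2=\int_G|\langle f,U_g\eta\rangle|^2\,dg$ for every $f\in L^2(\mathbb{R}^2)$. For $G=\Sigma\rtimes H\in\mathcal{E}_2$ the representation $U$ is explicitly $U_{(\sigma,h)}f(x)=|\det h|^{-1/2}e^{\pi i\langle\sigma x,x\rangle}f(h^{-1}x)$, where $(\sigma,h)$ denotes the matrix $\begin{bmatrix}h&0\\ \sigma h&{}^th^{-1}\end{bmatrix}$. Notation: for $t\in\mathbb{R}$, $$R_t=\begin{bmatrix}\cos t&\sin t\\ -\sin t&\cos t\end{bmatrix},\qquad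 A_t=\begin{bmatrix}\cosh t&\sinh t\\ \sinh t&\cosh t\end{bmatrix},$$ and $$\Sigma_1=\left\{\begin{bmatrix}u&0\\ 0&u\end{bmatrix}:u\in\mathbb{R}\right\},\quad \Sigma_2=\left\{\begin{bmatrix}u&0\\ 0&-u\end{bmatrix}:u\in\mathbb{R}\right\},\quad \Sigma_3=\left\{\begin{bmatrix}u&0\\ 0&0\end{bmatrix}:u\in\mathbb{R}\right\},$$ $$\Sigma_1^\perp=\left\{\begin{bmatrix}u&v\\ v&-u\end{bmatrix}:u,v\in\mathbb{R}\right\},\quad \Sigma_2^\perp=\left\{\begin{bmatrix}u&v\\ v&u\end{bmatrix}:u,v\in\mathbb{R}\right\},\quad \Sigma_3^\perp=\left\{\begin{bmatrix}0&v\\ v&u\end{bmatrix}:u,v\in\mathbb{R}\right\}.$$ *)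

theory Defs
  imports "HOL-Analysis.Analysis" "HOL-Algebra.Group"
begin

definition GL :: "(real^'n^'n) monoid" where
  "GL = \<lparr>carrier = {A. invertible A}, mult = (**), one = mat 1\<rparr>"

definition block ::
    "real^'n^'n \<Rightarrow> real^'n^'n \<Rightarrow> real^'n^'n \<Rightarrow> real^'n^'n \<Rightarrow> real^('n + 'n)^('n + 'n)" where
  "block A B C D = (\<chi> i j. case (i, j) of
      (Inl k, Inl l) \<Rightarrow> A $ k $ l
    | (Inl k, Inr l) \<Rightarrow> B $ k $ l
    | (Inr k, Inl l) \<Rightarrow> C $ k $ l
    | (Inr k, Inr l) \<Rightarrow> D $ k $ l)"

definition upper_left :: "real^('n + 'n)^('n + 'n) \<Rightarrow> real^'n^'n" where
  "upper_left g = (\<chi> i j. g $ Inl i $ Inl j)"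

definition lower_left :: "real^('n + 'n)^('n + 'n) \<Rightarrow> real^'n^'n" where
  "lower_left g = (\<chi> i j. g $ Inr i $ Inl j)"

definition Sp :: "(real^('n::finite + 'n)^('n + 'n)) monoid" where
  "Sp = \<lparr>carrier = {g. transpose g ** block 0 (mat 1) (- mat 1) 0 ** g
                          = block 0 (mat 1) (- mat 1) 0},
         mult = (**), one = mat 1\<rparr>"

text \<open>
  Lie subgroups are taken to be closed subgroups with the subspace topology (Cartan). For the
  class below nothing is lost: every connected Lie subgroup of GL(2,R) is closed, because a
  one-parameter subgroup of GL(2,R) with compact closure is conjugate into O(2) and hence
  closed (Malcev's criterion); the groups built from it are then closed in Sp(2,R).
\<close>

definition lie_subgroup :: "(real^'n^'n) set \<Rightarrow> (real^'n^'n) monoid \<Rightarrow> bool" where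
  "lie_subgroup H G \<longleftrightarrow> subgroup H G \<and> closedin (top_of_set (carrier G)) H"

definition semidirect :: "(real^2^2) set \<Rightarrow> (real^2^2) set \<Rightarrow> (real^(2 + 2)^(2 + 2)) set" where
  "semidirect S H = {block h 0 (\<sigma> ** h) (transpose (matrix_inv h)) | \<sigma> h. \<sigma> \<in> S \<and> h \<in> H}"

definition class_E2 :: "(real^(2 + 2)^(2 + 2)) set set" where
  "class_E2 = {G. lie_subgroup G Sp \<and>
     (\<exists>S H. G = semidirect S H \<and>
        lie_subgroup H GL \<and> connected H \<and> H \<noteq> {mat 1} \<and>
        subspace S \<and> S \<subseteq> {\<sigma>. transpose \<sigma> = \<sigma>} \<and> S \<noteq> {0})}"

text \<open>
  Regularity need not be required of a Haar measure here: the groups are closed in Sp(2,R),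
  hence second countable and locally compact, so every Borel measure on them that is finite
  on compact sets is regular.
\<close>

definition left_haar_measure ::
    "(real^'n^'n) set \<Rightarrow> (real^'n^'n) measure \<Rightarrow> bool" where
  "left_haar_measure G M \<longleftrightarrow>
     sets M = sets (restrict_space borel G) \<and>
     (\<forall>g\<in>G. \<forall>A\<in>sets M. emeasure M ((**) g ` A) = emeasure M A) \<and>
     (\<forall>K. compact K \<and> K \<subseteq> G \<longrightarrow> emeasure M K < \<infinity>) \<and>
     emeasure M G \<noteq> 0"

text \<open>
  Elements of L2(R^2) are represented by Borel functions; every class has such a representative,
  and all quantities below depend only on the class.
\<close>

definition L2 :: "(real^2 \<Rightarrow> complex) set" where
  "L2 = {f. f \<in> borel_measurable lborel \<and> integrable lborel (\<lambda>x. (norm (f x))\<^sup>2)}"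

definition L2_inner :: "(real^2 \<Rightarrow> complex) \<Rightarrow> (real^2 \<Rightarrow> complex) \<Rightarrow> complex" where
  "L2_inner f g = (LINT x|lborel. f x * cnj (g x))"

definition L2_norm :: "(real^2 \<Rightarrow> complex) \<Rightarrow> real" where
  "L2_norm f = sqrt (LINT x|lborel. (norm (f x))\<^sup>2)"

text \<open>
  The metaplectic representation restricted to a group in the class, as a function of the
  4 by 4 matrix: the components h and \<open>\<sigma>\<close> are read off from the left block column.
\<close>

definition metaplectic ::
    "real^(2 + 2)^(2 + 2) \<Rightarrow> (real^2 \<Rightarrow> complex) \<Rightarrow> real^2 \<Rightarrow> complex" where
  "metaplectic g f x =
     (let h = upper_left g; \<sigma> = lower_left g ** matrix_inv h in
        of_real (\<bar>det h\<bar> powr (- 1/2)) * exp (of_real pi * \<i> * of_real ((\<sigma> *v x) \<bullet> x))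
          * f (matrix_inv h *v x))"

lemma metaplectic_block:
  assumes "invertible h"
  shows "metaplectic (block h 0 (\<sigma> ** h) (transpose (matrix_inv h))) f x =
     of_real (\<bar>det h\<bar> powr (- 1/2)) * exp (of_real pi * \<i> * of_real ((\<sigma> *v x) \<bullet> x))
       * f (matrix_inv h *v x)"
proof -
  have "h ** matrix_inv h = mat 1"
    using someI_ex [OF assms [unfolded invertible_def]] by (simp add: matrix_inv_def)
  moreover have "upper_left (block h 0 (\<sigma> ** h) (transpose (matrix_inv h))) = h"
    and "lower_left (block h 0 (\<sigma> ** h) (transpose (matrix_inv h))) = \<sigma> ** h"
    by (simp_all add: upper_left_def lower_left_def block_def vec_eq_iff)
  ultimately show ?thesis
    by (simp add: metaplectic_def matrix_mul_assoc [symmetric])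
qed

text \<open>
  Haar measure is unique up to a positive factor, which can be absorbed into \<open>\<eta>\<close>, so the
  choice of Haar measure is immaterial. The integral over the group may be infinite, whence
  the extended nonnegative integral.
\<close>

definition reproducing :: "(real^(2 + 2)^(2 + 2)) set \<Rightarrow> bool" where
  "reproducing G \<longleftrightarrow>
     (\<exists>M. left_haar_measure G M \<and>
        (\<exists>\<eta>\<in>L2. \<forall>f\<in>L2.
           ennreal ((L2_norm f)\<^sup>2)
             = (\<integral>\<^sup>+ g. ennreal ((norm (L2_inner f (metaplectic g \<eta>)))\<^sup>2) \<partial>M)))"

definition mat2 :: "real \<Rightarrow> real \<Rightarrow> real \<Rightarrow> real \<Rightarrow> real^2^2" where
  "mat2 a b c d = vector [vector [a, b], vector [c, d]]"

definition rot :: "real \<Rightarrow> real^2^2" where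
  "rot t = mat2 (cos t) (sin t) (- sin t) (cos t)"

definition hyp :: "real \<Rightarrow> real^2^2" where
  "hyp t = mat2 (cosh t) (sinh t) (sinh t) (cosh t)"

definition Sigma1 :: "(real^2^2) set" where
  "Sigma1 = {mat2 u 0 0 u | u. True}"

definition Sigma2 :: "(real^2^2) set" where
  "Sigma2 = {mat2 u 0 0 (- u) | u. True}"

definition Sigma3 :: "(real^2^2) set" where
  "Sigma3 = {mat2 u 0 0 0 | u. True}"

definition Sigma1_perp :: "(real^2^2) set" where
  "Sigma1_perp = {mat2 u v v (- u) | u v. True}"

definition Sigma2_perp :: "(real^2^2) set" where
  "Sigma2_perp = {mat2 u v v u | u v. True}"

definition Sigma3_perp :: "(real^2^2) set" where
  "Sigma3_perp = {mat2 0 v v u | u v. True}"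

end

theory Submission
  imports Defs
begin

text \<open>
  All groups but the last two contain a lattice \<open>\<Gamma>\<close>; let \<open>D\<close> be a fundamental domain. If \<open>b\<close>
  normalises \<open>G\<close>, the function \<open>\<bar>\<langle>U (b x) \<eta>, U g \<eta>\<rangle>\<bar>\<^sup>2\<close> is invariant under a diagonal action of
  \<open>\<Gamma>\<close>; integrating it first over \<open>g \<in> G\<close> or first over \<open>x \<in> G\<close> and applying the reproducing
  formula in both cases shows that \<open>b\<^sup>-\<^sup>1 D b\<close> and \<open>D\<close> have the same Haar measure. A dilation \<open>b\<close>
  for which \<open>b\<^sup>-\<^sup>1 D b\<close> contains two disjoint translates of \<open>D\<close> gives a contradiction.

  In the last two groups the stabiliser of a generic point of the plane is not compact: the
  dilations of the first coordinate permute infinitely many disjoint slices of \<open>G\<close> over which the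
  reproducing integral takes the same value, so the integral is \<open>0\<close> or \<open>\<infinity>\<close>.
\<close>

subsection \<open>Block triangular matrices\<close>

lemma matrix_matrix_add_rdistrib:
  fixes A B :: "'a::semiring_1^'n^'m"
  shows "(A + B) ** C = A ** C + B ** C"
  by (simp add: matrix_matrix_mult_def vec_eq_iff sum.distrib distrib_right)

lemma matrix_inv_left:
  fixes A :: "'a::field^'n^'n"
  assumes "invertible A" shows "matrix_inv A ** A = mat 1"
  using someI_ex [OF assms [unfolded invertible_def]] by (simp add: matrix_inv_def)

lemma matrix_inv_right:
  fixes A :: "'a::field^'n^'n"
  assumes "invertible A" shows "A ** matrix_inv A = mat 1"
  using someI_ex [OF assms [unfolded invertible_def]] by (simp add: matrix_inv_def)

lemma matrix_inv_unique:
  fixes A :: "'a::field^'n^'n"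
  assumes "A ** B = mat 1"
  shows "matrix_inv A = B" "invertible A"
proof -
  show inv: "invertible A"
    using assms by (auto simp: invertible_right_inverse)
  have "matrix_inv A = matrix_inv A ** (A ** B)"
    by (simp add: assms)
  also have "\<dots> = B"
    by (simp add: matrix_mul_assoc matrix_inv_left inv)
  finally show "matrix_inv A = B" .
qed

lemma matrix_inv_mult:
  fixes A B :: "'a::field^'n^'n"
  assumes "invertible A" "invertible B"
  shows "matrix_inv (A ** B) = matrix_inv B ** matrix_inv A"
proof (rule matrix_inv_unique)
  have "(A ** B) ** (matrix_inv B ** matrix_inv A) = A ** (B ** matrix_inv B) ** matrix_inv A"
    by (simp only: matrix_mul_assoc)
  then show "(A ** B) ** (matrix_inv B ** matrix_inv A) = mat 1"
    by (simp add: matrix_inv_right assms)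
qed

lemma invertible_matrix_inv:
  fixes A :: "'a::field^'n^'n"
  assumes "invertible A" shows "invertible (matrix_inv A)" "matrix_inv (matrix_inv A) = A"
  using matrix_inv_unique [OF matrix_inv_left [OF assms]] by auto

lemma matrix_inv_mat_1 [simp]: "matrix_inv (mat 1 :: 'a::field^'n^'n) = mat 1"
  by (simp add: matrix_inv_unique)

lemma transpose_matrix_inv_left:
  fixes A :: "'a::field^'n^'n"
  assumes "invertible A" shows "transpose (matrix_inv A) ** transpose A = mat 1"
  by (metis assms matrix_inv_right matrix_transpose_mul transpose_mat)

lemma transpose_matrix_inv_right:
  fixes A :: "'a::field^'n^'n"
  assumes "invertible A" shows "transpose A ** transpose (matrix_inv A) = mat 1"
  by (metis assms matrix_inv_left matrix_transpose_mul transpose_mat)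

lemma sum_UNIV_Plus:
  "(\<Sum>x\<in>UNIV. f x) = (\<Sum>x\<in>UNIV. f (Inl x)) + (\<Sum>x\<in>UNIV. f (Inr x))"
  for f :: "'a::finite + 'b::finite \<Rightarrow> 'c::comm_monoid_add"
  using sum.Plus [of UNIV UNIV f] by (simp add: UNIV_Plus_UNIV)

lemma block_nth [simp]:
  "block A B C D $ Inl k $ Inl l = A $ k $ l"
  "block A B C D $ Inl k $ Inr l = B $ k $ l"
  "block A B C D $ Inr k $ Inl l = C $ k $ l"
  "block A B C D $ Inr k $ Inr l = D $ k $ l"
  by (simp_all add: block_def)

lemma block_eqI:
  fixes g h :: "real^('n::finite + 'n)^('n + 'n)"
  assumes "\<And>k l. g $ Inl k $ Inl l = h $ Inl k $ Inl l" "\<And>k l. g $ Inl k $ Inr l = h $ Inl k $ Inr l"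
    "\<And>k l. g $ Inr k $ Inl l = h $ Inr k $ Inl l" "\<And>k l. g $ Inr k $ Inr l = h $ Inr k $ Inr l"
  shows "g = h"
proof -
  have "g $ i $ j = h $ i $ j" for i j
    by (cases i; cases j) (simp_all add: assms)
  then show ?thesis
    by (simp add: vec_eq_iff)
qed

lemma block_mult:
  fixes A B C D :: "real^'n::finite^'n"
  shows "block A B C D ** block A' B' C' D' =
    block (A ** A' + B ** C') (A ** B' + B ** D') (C ** A' + D ** C') (C ** B' + D ** D')"
  by (rule block_eqI) (simp_all add: matrix_matrix_mult_def sum_UNIV_Plus)

lemma transpose_block:
  "transpose (block A B C D) = block (transpose A) (transpose C) (transpose B) (transpose D)"
  by (rule block_eqI) (simp_all add: transpose_def)

lemma mat_1_block: "mat 1 = block (mat 1) 0 0 (mat 1)"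
  by (rule block_eqI) (simp_all add: mat_def)

definition upper_right :: "real^('n + 'n)^('n + 'n) \<Rightarrow> real^'n^'n" where
  "upper_right g = (\<chi> i j. g $ Inl i $ Inr j)"

definition lower_right :: "real^('n + 'n)^('n + 'n) \<Rightarrow> real^'n^'n" where
  "lower_right g = (\<chi> i j. g $ Inr i $ Inr j)"

lemma block_parts [simp]:
  "upper_left (block A B C D) = A" "upper_right (block A B C D) = B"
  "lower_left (block A B C D) = C" "lower_right (block A B C D) = D"
  by (simp_all add: upper_left_def upper_right_def lower_left_def lower_right_def vec_eq_iff)

lemma block_collapse: "block (upper_left g) (upper_right g) (lower_left g) (lower_right g) = g"
  by (rule block_eqI) (simp_all add: upper_left_def upper_right_def lower_left_def lower_right_def)

lemma block_eq_iff: "block A B C D = block A' B' C' D' \<longleftrightarrow> A = A' \<and> B = B' \<and> C = C' \<and> D = D'"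
  by (metis block_parts)

definition tri :: "real^'n^'n \<Rightarrow> real^'n^'n \<Rightarrow> real^('n + 'n)^('n::finite + 'n)" where
  "tri \<sigma> h = block h 0 (\<sigma> ** h) (transpose (matrix_inv h))"

lemma semidirect_tri: "semidirect S H = {tri \<sigma> h | \<sigma> h. \<sigma> \<in> S \<and> h \<in> H}"
  by (simp add: semidirect_def tri_def)

lemma tri_eq_iff:
  assumes "invertible h"
  shows "tri \<sigma> h = tri \<sigma>' h' \<longleftrightarrow> \<sigma> = \<sigma>' \<and> h = h'"
proof
  assume "tri \<sigma> h = tri \<sigma>' h'"
  then have "h = h'" "\<sigma> ** h = \<sigma>' ** h"
    by (auto simp: tri_def block_eq_iff)
  then have "\<sigma> ** (h ** matrix_inv h) = \<sigma>' ** (h ** matrix_inv h)"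
    by (simp add: matrix_mul_assoc)
  with \<open>h = h'\<close> assms show "\<sigma> = \<sigma>' \<and> h = h'"
    by (simp add: matrix_inv_right)
qed auto

lemma tri_mult:
  assumes "invertible h" "invertible h'"
  shows "tri \<sigma> h ** tri \<sigma>' h' =
    tri (\<sigma> + transpose (matrix_inv h) ** \<sigma>' ** matrix_inv h) (h ** h')"
proof -
  have "(transpose (matrix_inv h) ** \<sigma>' ** matrix_inv h) ** (h ** h') =
      transpose (matrix_inv h) ** \<sigma>' ** (matrix_inv h ** h) ** h'"
    by (simp only: matrix_mul_assoc)
  then show ?thesis
    by (simp add: tri_def block_mult matrix_inv_mult assms matrix_inv_left matrix_transpose_mul
        matrix_matrix_add_rdistrib matrix_mul_assoc)
qed

lemma tri_one: "tri 0 (mat 1) = mat 1"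
  by (simp add: tri_def mat_1_block)

lemma tri_inverse:
  assumes "invertible h"
  shows "tri (- (transpose h ** \<sigma> ** h)) (matrix_inv h) ** tri \<sigma> h = mat 1"
    and "tri \<sigma> h ** tri (- (transpose h ** \<sigma> ** h)) (matrix_inv h) = mat 1"
proof -
  show "tri (- (transpose h ** \<sigma> ** h)) (matrix_inv h) ** tri \<sigma> h = mat 1"
    by (simp add: tri_mult invertible_matrix_inv assms matrix_inv_left tri_one)
  then show "tri \<sigma> h ** tri (- (transpose h ** \<sigma> ** h)) (matrix_inv h) = mat 1"
    by (simp add: matrix_left_right_inverse)
qed

lemma matrix_inv_tri:
  assumes "invertible h"
  shows "matrix_inv (tri \<sigma> h) = tri (- (transpose h ** \<sigma> ** h)) (matrix_inv h)"
    and "invertible (tri \<sigma> h)"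
  by (rule matrix_inv_unique [OF tri_inverse(2) [OF assms]])+

lemma tri_conj:
  assumes "invertible h" "invertible \<beta>"
  shows "matrix_inv (tri 0 \<beta>) ** tri \<sigma> h ** tri 0 \<beta> =
    tri (transpose \<beta> ** \<sigma> ** \<beta>) (matrix_inv \<beta> ** h ** \<beta>)"
  by (simp add: matrix_inv_tri tri_mult assms invertible_matrix_inv invertible_mult matrix_mul_assoc)

lemma tri_in_Sp:
  fixes h \<sigma> :: "real^'n::finite^'n"
  assumes "invertible h" "transpose \<sigma> = \<sigma>"
  shows "tri \<sigma> h \<in> carrier Sp"
proof -
  have "transpose h ** transpose (matrix_inv h) = mat 1" "matrix_inv h ** h = mat 1"
    by (simp_all add: assms transpose_matrix_inv_right matrix_inv_left)
  moreover have "transpose h ** (\<sigma> ** h) = transpose h ** \<sigma> ** h"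
    by (simp add: matrix_mul_assoc)
  moreover have *: "transpose h ** \<sigma> ** (- mat 1) = - (transpose h ** \<sigma>)" 
     "matrix_inv h ** (- mat 1) = - matrix_inv h" "(- matrix_inv h) ** h = - (matrix_inv h ** h)"
     "(- (transpose h ** \<sigma>)) ** h = - (transpose h ** \<sigma> ** h)"
    by (simp_all add: matrix_matrix_mult_def vec_eq_iff mat_def sum_negf if_distrib [of "\<lambda>x. a * x" for a] cong: if_cong)
  moreover have "transpose (0 :: real^'n^'n) = 0"
    by (simp add: transpose_def vec_eq_iff)
  ultimately show ?thesis
    by (simp add: Sp_def tri_def transpose_block block_mult matrix_transpose_mul assms transpose_transpose)
qed

lemma monoid_Sp: "monoid (Sp :: (real^('n::finite + 'n)^('n + 'n)) monoid)"
proof (rule monoidI)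
  fix x y :: "real^('n + 'n)^('n + 'n)"
  assume *: "x \<in> carrier Sp" "y \<in> carrier Sp"
  let ?J = "block 0 (mat 1) (- mat 1) 0 :: real^('n + 'n)^('n + 'n)"
  have "transpose (x ** y) ** ?J ** (x ** y) = transpose y ** (transpose x ** ?J ** x) ** y"
    by (simp only: matrix_transpose_mul matrix_mul_assoc)
  also have "\<dots> = ?J"
    using * by (simp add: Sp_def)
  finally show "x \<otimes>\<^bsub>Sp\<^esub> y \<in> carrier Sp"
    by (simp add: Sp_def)
qed (simp_all add: Sp_def matrix_mul_assoc transpose_mat)

lemma monoid_GL: "monoid (GL :: (real^'n::finite^'n) monoid)"
  by (rule monoidI) (simp_all add: GL_def matrix_mul_assoc invertible_mult matrix_inv_unique(2) [of "mat 1" "mat 1"])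

lemma subgroup_GL:
  assumes "H \<subseteq> {A. invertible A}" "mat 1 \<in> H"
    and "\<And>g h. g \<in> H \<Longrightarrow> h \<in> H \<Longrightarrow> g ** h \<in> H" "\<And>h. h \<in> H \<Longrightarrow> matrix_inv h \<in> H"
  shows "subgroup H (GL :: (real^'n::finite^'n) monoid)"
proof
  fix h assume "h \<in> H"
  with assms have "invertible h" by auto
  then have "inv\<^bsub>GL\<^esub> h = matrix_inv h"
    by (intro monoid.inv_unique' [OF monoid_GL, symmetric])
      (auto simp: GL_def invertible_matrix_inv matrix_inv_left matrix_inv_right)
  then show "inv\<^bsub>GL\<^esub> h \<in> H"
    using assms \<open>h \<in> H\<close> by simp
qed (use assms in \<open>auto simp: GL_def\<close>)

lemma subgroup_GL_D:
  assumes "subgroup H (GL :: (real^'n::finite^'n) monoid)"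
  shows "h \<in> H \<Longrightarrow> invertible h" "h \<in> H \<Longrightarrow> matrix_inv h \<in> H" "mat 1 \<in> H"
    "g \<in> H \<Longrightarrow> h \<in> H \<Longrightarrow> g ** h \<in> H"
proof -
  show inv: "invertible h" if "h \<in> H" for h
    using subgroup.subset [OF assms] that by (auto simp: GL_def)
  show "matrix_inv h \<in> H" if "h \<in> H"
  proof -
    have "inv\<^bsub>GL\<^esub> h = matrix_inv h"
      using inv [OF that] by (intro monoid.inv_unique' [OF monoid_GL, symmetric])
        (auto simp: GL_def invertible_matrix_inv matrix_inv_left matrix_inv_right)
    then show ?thesis
      using subgroup.m_inv_closed [OF assms that] by simp
  qed
  show "mat 1 \<in> H"
    using subgroup.one_closed [OF assms] by (simp add: GL_def)
  show "g ** h \<in> H" if "g \<in> H" "h \<in> H"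
    using subgroup.m_closed [OF assms that] by (simp add: GL_def)
qed

lemma lie_subgroup_GL:
  assumes "subgroup H (GL :: (real^'n::finite^'n) monoid)" "closed C" "H = {A. invertible A} \<inter> C"
  shows "lie_subgroup H GL"
  using assms by (auto simp: lie_subgroup_def closedin_closed GL_def)

lemma continuous_on_matrix_mult [continuous_intros]:
  fixes f :: "'a::topological_space \<Rightarrow> real^'n::finite^'m::finite" and g :: "'a \<Rightarrow> real^'k::finite^'n"
  assumes "continuous_on X f" "continuous_on X g"
  shows "continuous_on X (\<lambda>x. f x ** g x)"
  unfolding matrix_matrix_mult_def by (intro continuous_intros assms)

lemma continuous_on_transpose [continuous_intros]:
  fixes f :: "'a::topological_space \<Rightarrow> real^'n::finite^'m::finite"
  assumes "continuous_on X f"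
  shows "continuous_on X (\<lambda>x. transpose (f x))"
  unfolding transpose_def by (intro continuous_intros assms)

lemma continuous_on_block_parts [continuous_intros]:
  fixes f :: "'a::topological_space \<Rightarrow> real^('n::finite + 'n)^('n + 'n)"
  assumes "continuous_on X f"
  shows "continuous_on X (\<lambda>x. upper_left (f x))" "continuous_on X (\<lambda>x. upper_right (f x))"
    "continuous_on X (\<lambda>x. lower_left (f x))" "continuous_on X (\<lambda>x. lower_right (f x))"
  unfolding upper_left_def upper_right_def lower_left_def lower_right_def
  by (intro continuous_intros assms)+

text \<open>
  Closedness is seen on \<open>transpose h ** (\<sigma> ** h)\<close>, which depends continuously on the matrix
  (no inverse is taken) and which the invariance hypothesis places in \<open>S\<close>.
\<close>

lemma lie_subgroup_semidirect:
  fixes S :: "(real^2^2) set"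
  assumes H: "lie_subgroup H GL" and S: "subspace S" "S \<subseteq> {\<sigma>. transpose \<sigma> = \<sigma>}"
    and inv: "\<And>h \<sigma>. h \<in> H \<Longrightarrow> \<sigma> \<in> S \<Longrightarrow> transpose h ** \<sigma> ** h \<in> S"
  shows "lie_subgroup (semidirect S H) Sp"
proof -
  have sub: "subgroup H GL"
    using H by (simp add: lie_subgroup_def)
  note HD = subgroup_GL_D [OF sub]
  have inv': "transpose (matrix_inv h) ** \<sigma> ** matrix_inv h \<in> S" if "h \<in> H" "\<sigma> \<in> S" for h \<sigma>
    using inv [OF HD(2) [OF that(1)] that(2)] .
  have Sp: "semidirect S H \<subseteq> carrier Sp"
    using S HD by (auto simp: semidirect_tri intro!: tri_in_Sp)
  have "subgroup (semidirect S H) Sp"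
  proof
    fix x y assume "x \<in> semidirect S H" "y \<in> semidirect S H"
    then show "x \<otimes>\<^bsub>Sp\<^esub> y \<in> semidirect S H"
      by (auto simp: semidirect_tri Sp_def tri_mult HD) (metis HD(4) inv' S(1) subspace_add)
  next
    show "\<one>\<^bsub>Sp\<^esub> \<in> semidirect S H"
      using HD(3) subspace_0 [OF S(1)] by (auto simp: semidirect_tri Sp_def simp flip: tri_one)
  next
    fix x assume x: "x \<in> semidirect S H"
    then obtain \<sigma> h where x_eq: "x = tri \<sigma> h" and "\<sigma> \<in> S" "h \<in> H"
      by (auto simp: semidirect_tri)
    then have "- (transpose h ** \<sigma> ** h) \<in> S" "matrix_inv h \<in> H"
      using inv HD(2) subspace_neg [OF S(1)] by simp_all
    then have y: "tri (- (transpose h ** \<sigma> ** h)) (matrix_inv h) \<in> semidirect S H"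
      unfolding semidirect_tri by blast
    have "inv\<^bsub>Sp\<^esub> x = tri (- (transpose h ** \<sigma> ** h)) (matrix_inv h)"
      using x y Sp \<open>h \<in> H\<close>
      by (intro monoid.inv_unique' [OF monoid_Sp, symmetric])
        (auto simp: x_eq Sp_def tri_inverse HD)
    with y show "inv\<^bsub>Sp\<^esub> x \<in> semidirect S H"
      by simp
  qed (use Sp in blast)
  moreover have "closedin (top_of_set (carrier Sp)) (semidirect S H)"
  proof -
    obtain C where C: "closed C" "H = carrier GL \<inter> C"
      using H by (auto simp: lie_subgroup_def closedin_closed)
    let ?E = "{g :: real^(2+2)^(2+2). upper_right g = 0} \<inter> upper_left -` C \<inter>
        (\<lambda>g. transpose (upper_left g) ** lower_left g) -` S"
    have "closed ?E"
      by (intro closed_Int closed_vimage closed_Collect_eq continuous_intros C closed_subspace S)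
    moreover have "semidirect S H = carrier Sp \<inter> ?E"
    proof (intro equalityI subsetI)
      fix x assume "x \<in> semidirect S H"
      then show "x \<in> carrier Sp \<inter> ?E"
        using Sp C(2) inv by (auto simp: semidirect_tri tri_def matrix_mul_assoc)
    next
      fix g :: "real^(2+2)^(2+2)" assume g: "g \<in> carrier Sp \<inter> ?E"
      define h c d where "h = upper_left g" and "c = lower_left g" and "d = lower_right g"
      have g_eq: "g = block h 0 c d"
        using g block_collapse [of g] by (simp add: h_def c_def d_def)
      have T0: "transpose (0 :: real^2^2) = 0"
        by (simp add: transpose_def vec_eq_iff)
      have "transpose g ** block 0 (mat 1) (- mat 1) 0 ** g = block 0 (mat 1) (- mat 1) 0"
        using g by (simp add: Sp_def)
      then have "transpose h ** d = mat 1"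
        by (simp add: g_eq transpose_block block_mult block_eq_iff T0)
      then have d: "transpose d ** h = mat 1"
        by (metis matrix_transpose_mul transpose_mat transpose_transpose)
      then have inv_h: "invertible h" "transpose d = matrix_inv h"
        using matrix_inv_unique [of h "transpose d"] by (auto simp: matrix_left_right_inverse)
      then have h: "h \<in> H" and d: "d = transpose (matrix_inv h)"
        using g C by (auto simp: GL_def h_def) (metis transpose_transpose)
      let ?\<sigma> = "transpose (matrix_inv h) ** (transpose h ** c) ** matrix_inv h"
      have "?\<sigma> \<in> S"
        using g inv' [OF h] by (auto simp: h_def c_def)
      moreover have "?\<sigma> ** h = (transpose (matrix_inv h) ** transpose h) ** c ** (matrix_inv h ** h)"
        by (simp only: matrix_mul_assoc)
      then have "?\<sigma> ** h = c"
        by (simp add: matrix_inv_left transpose_matrix_inv_left inv_h)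
      then have "g = tri ?\<sigma> h"
        by (simp add: g_eq tri_def d)
      ultimately show "g \<in> semidirect S H"
        using h by (auto simp: semidirect_tri)
    qed
    ultimately show ?thesis
      by (auto simp: closedin_closed)
  qed
  ultimately show ?thesis
    by (simp add: lie_subgroup_def)
qed

lemma lborel_matrix_vector_mult:
  fixes A :: "real^'n::{finite,wellorder}^'n::_"
  assumes "invertible A"
  shows "density (distr lborel borel ((*v) A)) (\<lambda>_. ennreal \<bar>det A\<bar>) = lborel"
proof (rule lborel_eqI [symmetric])
  fix l u :: "real^'n::{finite,wellorder}" assume lu: "\<And>b. b \<in> Basis \<Longrightarrow> l \<bullet> b \<le> u \<bullet> b"
  have lin: "linear ((*v) (matrix_inv A))"
    by simp
  have "x \<in> (*v) (matrix_inv A) ` box l u" if "A *v x \<in> box l u" for x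
    by (rule image_eqI [OF _ that]) (simp add: matrix_vector_mul_assoc matrix_inv_left assms)
  then have vimage: "(*v) A -` box l u = (*v) (matrix_inv A) ` box l u"
    by (auto simp: matrix_vector_mul_assoc matrix_inv_right assms)
  have meas: "(*v) (matrix_inv A) ` box l u \<in> lmeasurable"
    by (rule measurable_linear_image [OF lin lmeasurable_box])
  have borel: "(*v) A -` box l u \<in> sets borel"
    by (rule borel_open, rule open_vimage) (auto intro: continuous_intros)
  have "det (matrix_inv A) * det A = 1"
    by (metis assms det_I det_mul matrix_inv_left)
  then have det: "\<bar>det A\<bar> * \<bar>det (matrix_inv A)\<bar> = 1"
    by (metis abs_mult abs_one mult.commute)
  have "emeasure lborel ((*v) A -` box l u) = emeasure lebesgue ((*v) (matrix_inv A) ` box l u)"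
    using borel by (simp flip: vimage)
  also have "\<dots> = ennreal (measure lebesgue ((*v) (matrix_inv A) ` box l u))"
    using meas by (simp add: emeasure_eq_measure2)
  also have "\<dots> = ennreal (\<bar>det (matrix_inv A)\<bar> * measure lebesgue (box l u))"
    using measure_linear_image [OF lin lmeasurable_box, of l u] by simp
  finally have "emeasure lborel ((*v) A -` box l u) = ennreal (\<bar>det (matrix_inv A)\<bar> * measure lborel (box l u))"
    by simp
  then have "emeasure (density (distr lborel borel ((*v) A)) (\<lambda>_. ennreal \<bar>det A\<bar>)) (box l u)
      = ennreal (\<bar>det A\<bar> * (\<bar>det (matrix_inv A)\<bar> * measure lborel (box l u)))"
    by (simp add: emeasure_density nn_integral_cmult emeasure_distr ennreal_mult' borel_measurable_continuous_onI
        continuous_intros)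
  also have "\<bar>det A\<bar> * (\<bar>det (matrix_inv A)\<bar> * measure lborel (box l u)) = measure lborel (box l u)"
    using det by (simp add: mult.assoc [symmetric])
  finally show "emeasure (density (distr lborel borel ((*v) A)) (\<lambda>_. ennreal \<bar>det A\<bar>)) (box l u) =
      ennreal (\<Prod>b\<in>Basis. (u - l) \<bullet> b)"
    using lu by (simp add: measure_lborel_box_eq)
qed simp

lemma measurable_matrix_vector_mult [measurable]:
  "(*v) A \<in> borel_measurable borel" for A :: "real^'n::finite^'m::finite"
  by (simp add: borel_measurable_continuous_onI continuous_intros)

lemma borel_measurable_cnj [measurable]: "cnj \<in> borel_measurable borel"
  by (simp add: borel_measurable_continuous_onI continuous_intros)

lemma lborel_integral_matrix_vector_mult:
  fixes A :: "real^'n::{finite,wellorder}^'n::_" and f :: "real^'n::{finite,wellorder} \<Rightarrow> 'b::{banach, second_countable_topology}"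
  assumes "invertible A" "f \<in> borel_measurable borel"
  shows "(LINT x|lborel. \<bar>det A\<bar> *\<^sub>R f (A *v x)) = (LINT x|lborel. f x)"
    and "integrable lborel (\<lambda>x. \<bar>det A\<bar> *\<^sub>R f (A *v x)) \<longleftrightarrow> integrable lborel f"
proof -
  have [measurable]: "f \<in> borel_measurable borel" by fact
  show "(LINT x|lborel. \<bar>det A\<bar> *\<^sub>R f (A *v x)) = (LINT x|lborel. f x)"
    by (subst (2) lborel_matrix_vector_mult [OF assms(1), symmetric])
       (simp add: integral_density integral_distr)
  show "integrable lborel (\<lambda>x. \<bar>det A\<bar> *\<^sub>R f (A *v x)) \<longleftrightarrow> integrable lborel f"
    by (subst (2) lborel_matrix_vector_mult [OF assms(1), symmetric])
       (simp add: integrable_density integrable_distr_eq)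
qed

subsection \<open>Square integrable functions\<close>

lemma L2_D:
  assumes "f \<in> L2"
  shows "f \<in> borel_measurable borel" "integrable lborel (\<lambda>x. (norm (f x))\<^sup>2)"
  using assms by (auto simp: L2_def)

lemma L2_mult_integrable:
  assumes "f \<in> L2" "g \<in> L2"
  shows "integrable lborel (\<lambda>x. f x * cnj (g x))"
proof (rule Bochner_Integration.integrable_bound)
  show "integrable lborel (\<lambda>x. (norm (f x))\<^sup>2 + (norm (g x))\<^sup>2)"
    using assms by (simp add: L2_D)
  have [measurable]: "f \<in> borel_measurable borel" "g \<in> borel_measurable borel"
    using assms by (auto simp: L2_D)
  show "(\<lambda>x. f x * cnj (g x)) \<in> borel_measurable lborel"
    by simp
  show "AE x in lborel. norm (f x * cnj (g x)) \<le> norm ((norm (f x))\<^sup>2 + (norm (g x))\<^sup>2)"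
  proof (rule AE_I2)
    fix x
    have "2 * (norm (f x) * norm (g x)) \<le> (norm (f x))\<^sup>2 + (norm (g x))\<^sup>2"
      using sum_squares_bound [of "norm (f x)" "norm (g x)"] by simp
    moreover have "0 \<le> norm (f x) * norm (g x)"
      by simp
    ultimately have "norm (f x) * norm (g x) \<le> (norm (f x))\<^sup>2 + (norm (g x))\<^sup>2"
      by linarith
    then show "norm (f x * cnj (g x)) \<le> norm ((norm (f x))\<^sup>2 + (norm (g x))\<^sup>2)"
      by (simp add: norm_mult)
  qed
qed

lemma L2_add:
  assumes "f \<in> L2" "g \<in> L2"
  shows "(\<lambda>x. f x + g x) \<in> L2"
proof -
  have [measurable]: "f \<in> borel_measurable borel" "g \<in> borel_measurable borel"
    using assms by (auto simp: L2_D)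
  have "integrable lborel (\<lambda>x. (norm (f x + g x))\<^sup>2)"
  proof (rule Bochner_Integration.integrable_bound)
    show "integrable lborel (\<lambda>x. 2 * (norm (f x))\<^sup>2 + 2 * (norm (g x))\<^sup>2)"
      using assms by (simp add: L2_D)
    show "AE x in lborel. norm ((norm (f x + g x))\<^sup>2) \<le> norm (2 * (norm (f x))\<^sup>2 + 2 * (norm (g x))\<^sup>2)"
    proof (rule AE_I2)
      fix x
      have "(norm (f x + g x))\<^sup>2 \<le> (norm (f x) + norm (g x))\<^sup>2"
        by (intro power_mono norm_triangle_ineq) simp
      also have "\<dots> \<le> 2 * (norm (f x))\<^sup>2 + 2 * (norm (g x))\<^sup>2"
        using sum_squares_bound [of "norm (f x)" "norm (g x)"] by (simp add: power2_sum)
      finally show "norm ((norm (f x + g x))\<^sup>2) \<le> norm (2 * (norm (f x))\<^sup>2 + 2 * (norm (g x))\<^sup>2)"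
        by simp
    qed
  qed simp
  then show ?thesis
    by (simp add: L2_def)
qed

lemma L2_bounded_mult:
  assumes "f \<in> L2" and [measurable]: "m \<in> borel_measurable borel" and "\<And>x. norm (m x) \<le> C"
  shows "(\<lambda>x. m x * f x) \<in> L2"
proof -
  have [measurable]: "f \<in> borel_measurable borel"
    using assms by (auto simp: L2_D)
  have "integrable lborel (\<lambda>x. (norm (m x * f x))\<^sup>2)"
  proof (rule Bochner_Integration.integrable_bound)
    show "integrable lborel (\<lambda>x. C\<^sup>2 * (norm (f x))\<^sup>2)"
      using assms by (simp add: L2_D)
    show "AE x in lborel. norm ((norm (m x * f x))\<^sup>2) \<le> norm (C\<^sup>2 * (norm (f x))\<^sup>2)"
      by (rule AE_I2) (auto simp: norm_mult power_mult_distrib intro!: mult_right_mono power_mono assms(3))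
  qed simp
  then show ?thesis
    by (simp add: L2_def)
qed

lemma L2_cmult: "f \<in> L2 \<Longrightarrow> (\<lambda>x. c * f x) \<in> L2"
  using L2_bounded_mult [of f "\<lambda>_. c" "norm c"] by simp

lemma L2_inner_add:
  assumes "f \<in> L2" "g \<in> L2" "h \<in> L2"
  shows "L2_inner (\<lambda>x. f x + g x) h = L2_inner f h + L2_inner g h"
  using assms by (simp add: L2_inner_def distrib_right L2_mult_integrable)

lemma L2_inner_cmult: "L2_inner (\<lambda>x. c * f x) h = c * L2_inner f h"
  by (simp add: L2_inner_def mult.assoc)

lemma norm_L2_inner_commute: "norm (L2_inner f g) = norm (L2_inner g f)"
proof -
  have "L2_inner f g = cnj (L2_inner g f)"
    unfolding L2_inner_def by (subst Bochner_Integration.integral_cnj [symmetric]) (simp add: mult.commute)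
  then show ?thesis
    by simp
qed

lemma L2_norm_nonneg: "0 \<le> L2_norm f"
  by (simp add: L2_norm_def)

lemma L2_norm_square: "(L2_norm f)\<^sup>2 = (LINT x|lborel. (norm (f x))\<^sup>2)"
  by (simp add: L2_norm_def)

lemma L2_norm_square_inner: "of_real ((L2_norm f)\<^sup>2) = L2_inner f f"
  by (simp add: L2_norm_square L2_inner_def complex_norm_square [symmetric] flip: integral_complex_of_real)

subsection \<open>The representation on triangular matrices\<close>

lemma metaplectic_tri:
  assumes "invertible h"
  shows "metaplectic (tri \<sigma> h) f x =
     of_real (\<bar>det h\<bar> powr (- 1/2)) * exp (of_real pi * \<i> * of_real ((\<sigma> *v x) \<bullet> x))
       * f (matrix_inv h *v x)"
  unfolding tri_def by (rule metaplectic_block [OF assms])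

lemma metaplectic_one [simp]: "metaplectic (mat 1) f = f"
proof
  have "invertible (mat 1 :: real^2^2)"
    by (rule matrix_inv_unique [of _ "mat 1"]) simp
  then show "metaplectic (mat 1) f x = f x" for x
    by (simp add: metaplectic_tri flip: tri_one)
qed

lemma quadratic_form_compose:
  fixes A B :: "real^'n::finite^'n"
  shows "((transpose A ** B ** A) *v x) \<bullet> x = (B *v (A *v x)) \<bullet> (A *v x)"
  by (simp add: dot_lmul_matrix flip: matrix_vector_mul_assoc)

lemma metaplectic_mult:
  assumes "invertible h" "invertible h'"
  shows "metaplectic (tri \<sigma> h ** tri \<sigma>' h') f = metaplectic (tri \<sigma> h) (metaplectic (tri \<sigma>' h') f)"
proof
  fix x
  show "metaplectic (tri \<sigma> h ** tri \<sigma>' h') f x = metaplectic (tri \<sigma> h) (metaplectic (tri \<sigma>' h') f) x"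
    by (simp add: tri_mult metaplectic_tri assms invertible_mult matrix_inv_mult det_mul abs_mult powr_mult
        matrix_vector_mult_add_rdistrib inner_add_left quadratic_form_compose exp_add distrib_left
        matrix_vector_mul_assoc)
qed

lemma metaplectic_measurable:
  assumes "invertible h" and [measurable]: "f \<in> borel_measurable borel"
  shows "metaplectic (tri \<sigma> h) f \<in> borel_measurable borel"
  by (subst metaplectic_tri [OF assms(1), abs_def]) measurable

lemma L2_inner_metaplectic:
  assumes "invertible h" and "f \<in> borel_measurable borel" "f' \<in> borel_measurable borel"
  shows "L2_inner (metaplectic (tri \<sigma> h) f) (metaplectic (tri \<sigma> h) f') = L2_inner f f'"
    and "integrable lborel (\<lambda>x. metaplectic (tri \<sigma> h) f x * cnj (metaplectic (tri \<sigma> h) f' x)) \<longleftrightarrow>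
         integrable lborel (\<lambda>x. f x * cnj (f' x))"
proof -
  have [measurable]: "f \<in> borel_measurable borel" "f' \<in> borel_measurable borel" by fact+
  have det: "\<bar>det h\<bar> > 0"
    using assms by (simp add: invertible_det_nz)
  have "det (matrix_inv h) * det h = 1"
    by (metis assms(1) det_I det_mul matrix_inv_left)
  then have det': "\<bar>det (matrix_inv h)\<bar> = 1 / \<bar>det h\<bar>"
    using det by (simp add: field_simps flip: abs_mult)
  have "\<bar>det h\<bar> powr (- 1/2) * \<bar>det h\<bar> powr (- 1/2) = 1 / \<bar>det h\<bar>"
    using det by (simp add: powr_minus_divide flip: powr_add)
  then have *: "complex_of_real (\<bar>det h\<bar> powr (- 1/2)) * complex_of_real (\<bar>det h\<bar> powr (- 1/2)) = 1 / \<bar>det h\<bar>"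
    by (simp flip: of_real_mult)
  have e: "exp (of_real pi * \<i> * of_real r) * cnj (exp (of_real pi * \<i> * of_real r)) = 1" for r
    by (simp add: exp_cnj flip: exp_add)
  have eq: "metaplectic (tri \<sigma> h) f x * cnj (metaplectic (tri \<sigma> h) f' x) =
      \<bar>det (matrix_inv h)\<bar> *\<^sub>R (f (matrix_inv h *v x) * cnj (f' (matrix_inv h *v x)))" (is "?l = ?r") for x
  proof -
    let ?p = "complex_of_real (\<bar>det h\<bar> powr (- 1/2))" and ?e = "exp (of_real pi * \<i> * of_real ((\<sigma> *v x) \<bullet> x))"
    have "?l = (?p * ?p) * (?e * cnj ?e) * (f (matrix_inv h *v x) * cnj (f' (matrix_inv h *v x)))"
      by (simp only: metaplectic_tri assms complex_cnj_mult complex_cnj_complex_of_real mult_ac)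
    then show ?thesis
      by (simp only: * e det') (simp add: scaleR_conv_of_real)
  qed
  show "L2_inner (metaplectic (tri \<sigma> h) f) (metaplectic (tri \<sigma> h) f') = L2_inner f f'"
    unfolding L2_inner_def eq
    by (rule lborel_integral_matrix_vector_mult) (simp_all add: invertible_matrix_inv assms)
  show "integrable lborel (\<lambda>x. metaplectic (tri \<sigma> h) f x * cnj (metaplectic (tri \<sigma> h) f' x)) \<longleftrightarrow>
         integrable lborel (\<lambda>x. f x * cnj (f' x))"
    unfolding eq
    by (rule lborel_integral_matrix_vector_mult) (simp_all add: invertible_matrix_inv assms)
qed

lemma L2_iff_inner:
  "f \<in> L2 \<longleftrightarrow> f \<in> borel_measurable borel \<and> integrable lborel (\<lambda>x. f x * cnj (f x))"
proof -
  have "integrable lborel (\<lambda>x. f x * cnj (f x)) \<longleftrightarrow> integrable lborel (\<lambda>x. (norm (f x))\<^sup>2)"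
    by (simp only: complex_norm_square [symmetric] complex_of_real_integrable_eq)
  then show ?thesis
    by (simp add: L2_def)
qed

lemma metaplectic_L2:
  assumes "invertible h" "f \<in> L2"
  shows "metaplectic (tri \<sigma> h) f \<in> L2"
  using assms L2_inner_metaplectic(2) [OF assms(1), of f f]
  by (simp add: L2_iff_inner metaplectic_measurable)

lemma L2_norm_metaplectic:
  assumes "invertible h" "f \<in> L2"
  shows "L2_norm (metaplectic (tri \<sigma> h) f) = L2_norm f"
proof -
  have "complex_of_real ((L2_norm (metaplectic (tri \<sigma> h) f))\<^sup>2) = of_real ((L2_norm f)\<^sup>2)"
    using assms by (simp only: L2_norm_square_inner L2_inner_metaplectic L2_D)
  then show ?thesis
    by (simp only: of_real_eq_iff power2_eq_iff_nonneg L2_norm_nonneg)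
qed

lemma indicator_L2:
  assumes "A \<in> sets borel" "emeasure lborel A < \<infinity>"
  shows "(\<lambda>x. of_real (indicator A x)) \<in> L2"
    and "(L2_norm (\<lambda>x. of_real (indicator A x)))\<^sup>2 = measure lborel A"
proof -
  have *: "(norm (complex_of_real (indicator A x)))\<^sup>2 = indicator A x" for x :: "real^2"
    by (simp add: indicator_def)
  show "(\<lambda>x. of_real (indicator A x)) \<in> L2"
    using assms by (simp add: L2_def power2_eq_square integrable_indicator_iff flip: indicator_inter_arith)
  show "(L2_norm (\<lambda>x. of_real (indicator A x)))\<^sup>2 = measure lborel A"
    unfolding L2_norm_square * by simp
qed

definition triangular :: "(real^(2 + 2)^(2 + 2)) set" where
  "triangular = {tri \<sigma> h | \<sigma> h. invertible h}"

lemma tri_in_triangular: "invertible h \<Longrightarrow> tri \<sigma> h \<in> triangular"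
  by (auto simp: triangular_def)

lemma triangular_mult: "a \<in> triangular \<Longrightarrow> b \<in> triangular \<Longrightarrow> a ** b \<in> triangular"
  unfolding triangular_def using tri_mult invertible_mult by blast

lemma triangular_inv:
  assumes "a \<in> triangular"
  shows "invertible a" "matrix_inv a \<in> triangular" "matrix_inv a ** a = mat 1" "a ** matrix_inv a = mat 1"
    "matrix_inv (matrix_inv a) = a"
proof -
  show "invertible a" "matrix_inv a \<in> triangular"
    using assms matrix_inv_tri invertible_matrix_inv unfolding triangular_def by fastforce+
  then show "matrix_inv a ** a = mat 1" "a ** matrix_inv a = mat 1" "matrix_inv (matrix_inv a) = a"
    by (simp_all add: matrix_inv_left matrix_inv_right invertible_matrix_inv)
qed

lemma triangular_cancel [simp]:
  assumes "a \<in> triangular"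
  shows "matrix_inv a ** (a ** b) = b" "a ** (matrix_inv a ** b) = b"
    "b ** matrix_inv a ** a = b" "b ** a ** matrix_inv a = b"
proof -
  show "matrix_inv a ** (a ** b) = b" "a ** (matrix_inv a ** b) = b"
    using triangular_inv(3,4) [OF assms] by (simp_all add: matrix_mul_assoc)
  show "b ** matrix_inv a ** a = b" "b ** a ** matrix_inv a = b"
    using triangular_inv(3,4) [OF assms] by (simp_all flip: matrix_mul_assoc)
qed

lemma metaplectic_triangular_mult:
  "a \<in> triangular \<Longrightarrow> b \<in> triangular \<Longrightarrow> metaplectic (a ** b) f = metaplectic a (metaplectic b f)"
  by (auto simp: triangular_def metaplectic_mult)

lemma metaplectic_triangular_L2:
  assumes "a \<in> triangular" "f \<in> L2"
  shows "metaplectic a f \<in> L2" "L2_norm (metaplectic a f) = L2_norm f"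
  using assms by (auto simp: triangular_def metaplectic_L2 L2_norm_metaplectic)

lemma L2_inner_metaplectic_triangular:
  assumes "a \<in> triangular" "f \<in> L2" "f' \<in> L2"
  shows "L2_inner (metaplectic a f) (metaplectic a f') = L2_inner f f'"
  using assms by (auto simp: triangular_def L2_inner_metaplectic L2_D)

text \<open>
  On triangular matrices the inverse of the upper left block is the transpose of the lower right
  one, which makes the representation visibly Borel in the group element.
\<close>

definition tri_action :: "real^(2 + 2)^(2 + 2) \<Rightarrow> (real^2 \<Rightarrow> complex) \<Rightarrow> real^2 \<Rightarrow> complex" where
  "tri_action g f x = of_real (\<bar>det (upper_left g)\<bar> powr (- 1/2)) *
     exp (of_real pi * \<i> * of_real (((lower_left g ** transpose (lower_right g)) *v x) \<bullet> x)) *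
     f (transpose (lower_right g) *v x)"

lemma metaplectic_eq_tri_action:
  assumes "g \<in> triangular"
  shows "metaplectic g f = tri_action g f"
proof
  fix x
  obtain \<sigma> h where g: "g = tri \<sigma> h" and h: "invertible h"
    using assms by (auto simp: triangular_def)
  have "\<sigma> ** h ** matrix_inv h = \<sigma>"
    by (simp add: matrix_inv_right h flip: matrix_mul_assoc)
  moreover have "upper_left g = h" "lower_left g = \<sigma> ** h" "transpose (lower_right g) = matrix_inv h"
    by (simp_all add: g tri_def)
  ultimately show "metaplectic g f x = tri_action g f x"
    unfolding tri_action_def by (simp only: g metaplectic_tri [OF h])
qed

lemma continuous_on_matrix_vector_mult' [continuous_intros]:
  fixes f :: "'a::topological_space \<Rightarrow> real^'n::finite^'m::finite"
  assumes "continuous_on X f" "continuous_on X g"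
  shows "continuous_on X (\<lambda>x. f x *v g x)"
  unfolding matrix_vector_mult_def by (intro continuous_intros assms)

lemma tri_action_measurable [measurable]:
  assumes [measurable]: "f \<in> borel_measurable borel"
  shows "(\<lambda>(g, x). tri_action g f x) \<in> borel_measurable (borel \<Otimes>\<^sub>M borel)"
proof -
  let ?B = "borel :: ((real^(2+2)^(2+2)) \<times> (real^2)) measure"
  have [measurable]: "(\<lambda>p. det (upper_left (fst p))) \<in> borel_measurable ?B"
    unfolding det_2 by (rule borel_measurable_continuous_onI) (intro continuous_intros)
  have [measurable]: "(\<lambda>p. ((lower_left (fst p) ** transpose (lower_right (fst p))) *v snd p) \<bullet> snd p)
      \<in> borel_measurable ?B"
    by (rule borel_measurable_continuous_onI) (intro continuous_intros)
  have [measurable]: "(\<lambda>p. transpose (lower_right (fst p)) *v snd p) \<in> borel_measurable ?B"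
    by (rule borel_measurable_continuous_onI) (intro continuous_intros)
  have "(\<lambda>p. tri_action (fst p) f (snd p)) \<in> borel_measurable ?B"
    unfolding tri_action_def by measurable
  then show ?thesis
    by (simp add: borel_prod case_prod_beta)
qed

lemma tri_action_L2_inner_measurable:
  assumes [measurable]: "f \<in> borel_measurable borel" "f' \<in> borel_measurable borel"
  shows "(\<lambda>(x, g). L2_inner (tri_action x f) (tri_action g f')) \<in> borel_measurable (borel \<Otimes>\<^sub>M borel)"
  unfolding L2_inner_def by measurable

subsection \<open>Groups of triangular matrices and their Haar measure\<close>

locale triangular_group =
  fixes G :: "(real^(2 + 2)^(2 + 2)) set"
  assumes triangular: "G \<subseteq> triangular"
    and one_closed: "mat 1 \<in> G"
    and mult_closed: "a \<in> G \<Longrightarrow> b \<in> G \<Longrightarrow> a ** b \<in> G"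
    and inv_closed: "a \<in> G \<Longrightarrow> matrix_inv a \<in> G"
begin

lemma in_triangular [simp]: "a \<in> G \<Longrightarrow> a \<in> triangular"
  using triangular by blast

end

locale haar_group = triangular_group +
  fixes M :: "(real^(2 + 2)^(2 + 2)) measure"
  assumes haar: "left_haar_measure G M"
begin

lemma sets_M: "sets M = sets (restrict_space borel G)"
  using haar by (simp add: left_haar_measure_def)

lemma space_M [simp]: "space M = G"
  using sets_eq_imp_space_eq [OF sets_M] by (simp add: space_restrict_space)

lemma measurable_from_borel: "f \<in> measurable borel N \<Longrightarrow> f \<in> measurable M N"
  by (subst measurable_cong_sets [OF sets_M refl]) (rule measurable_restrict_space1)

lemma measurable_into_M:
  assumes "f \<in> measurable N borel" "f \<in> space N \<rightarrow> G"
  shows "f \<in> measurable N M"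
  using assms by (subst measurable_cong_sets [OF refl sets_M]) (rule measurable_restrict_space2)

lemma continuous_measurable_from_M:
  "continuous_on UNIV f \<Longrightarrow> f \<in> measurable M borel"
  by (intro measurable_from_borel borel_measurable_continuous_onI)

lemma measurable_translate:
  assumes "a \<in> G" shows "(**) a \<in> measurable M M"
  by (intro measurable_into_M continuous_measurable_from_M continuous_intros)
    (use assms mult_closed in auto)

lemma measurable_conj:
  assumes "\<And>g. g \<in> G \<Longrightarrow> a ** g ** b \<in> G" shows "(\<lambda>g. a ** g ** b) \<in> measurable M M"
  by (intro measurable_into_M continuous_measurable_from_M continuous_intros)
    (use assms in auto)

lemma translate_vimage:
  assumes "a \<in> G" "A \<subseteq> G"
  shows "(**) a -` A \<inter> G = (**) (matrix_inv a) ` A"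
proof (intro equalityI subsetI)
  fix x assume "x \<in> (**) a -` A \<inter> G"
  then show "x \<in> (**) (matrix_inv a) ` A"
    by (intro image_eqI [of _ _ "a ** x"]) (auto simp: assms)
next
  fix x assume "x \<in> (**) (matrix_inv a) ` A"
  then show "x \<in> (**) a -` A \<inter> G"
    using assms by (auto simp: inv_closed mult_closed subset_iff)
qed

lemma translate_sets: "a \<in> G \<Longrightarrow> A \<in> sets M \<Longrightarrow> (**) a ` A \<in> sets M"
  using translate_vimage [of "matrix_inv a" A] measurable_sets [OF measurable_translate [of "matrix_inv a"], of A]
    sets.sets_into_space [of A M]
  by (simp add: inv_closed triangular_inv)

lemma emeasure_translate: "a \<in> G \<Longrightarrow> A \<in> sets M \<Longrightarrow> emeasure M ((**) a ` A) = emeasure M A"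
  using haar by (auto simp: left_haar_measure_def)

lemma distr_translate:
  assumes "a \<in> G" shows "distr M M ((**) a) = M"
proof (rule measure_eqI)
  fix A assume "A \<in> sets (distr M M ((**) a))"
  then have A: "A \<in> sets M" by simp
  then have "A \<subseteq> G"
    using sets.sets_into_space [of A M] by simp
  then have "emeasure (distr M M ((**) a)) A = emeasure M ((**) (matrix_inv a) ` A)"
    using A by (simp add: emeasure_distr measurable_translate assms translate_vimage)
  then show "emeasure (distr M M ((**) a)) A = emeasure M A"
    using A assms by (simp add: emeasure_translate inv_closed)
qed simp

lemma nn_integral_translate:
  assumes "a \<in> G" "F \<in> borel_measurable M"
  shows "(\<integral>\<^sup>+ g. F (a ** g) \<partial>M) = (\<integral>\<^sup>+ g. F g \<partial>M)"
  using nn_integral_distr [OF measurable_translate [OF assms(1)], of F] assms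
  by (simp add: distr_translate)

lemma integral_translate:
  fixes F :: "_ \<Rightarrow> complex"
  assumes "a \<in> G" "F \<in> borel_measurable M"
  shows "(LINT g|M. F (a ** g)) = (LINT g|M. F g)"
  using integral_distr [OF measurable_translate [OF assms(1)], of F] assms
  by (simp add: distr_translate)

lemma coefficient_measurable:
  assumes "f \<in> L2" "f' \<in> L2"
  shows "(\<lambda>g. L2_inner f (metaplectic g f')) \<in> borel_measurable M"
proof -
  have [measurable]: "f \<in> borel_measurable borel" "f' \<in> borel_measurable borel"
    using assms by (auto simp: L2_D)
  have "(\<lambda>g. L2_inner f (tri_action g f')) \<in> borel_measurable borel"
    unfolding L2_inner_def by measurable
  then have "(\<lambda>g. L2_inner f (tri_action g f')) \<in> borel_measurable M"
    by (rule measurable_from_borel)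
  then show ?thesis
    by (rule measurable_cong [THEN iffD2, rotated]) (simp add: metaplectic_eq_tri_action)
qed

lemma coefficient_measurable_pair:
  assumes "f \<in> L2" "f' \<in> L2" "b \<in> triangular"
  shows "(\<lambda>(x, g). L2_inner (metaplectic (b ** x) f) (metaplectic g f')) \<in> borel_measurable (M \<Otimes>\<^sub>M M)"
proof -
  have [measurable]: "f \<in> borel_measurable borel" "f' \<in> borel_measurable borel"
    using assms by (auto simp: L2_D)
  have [measurable]: "(**) b \<in> measurable M borel" "(\<lambda>g. g) \<in> measurable M borel"
    by (intro continuous_measurable_from_M continuous_intros)+
  have "(\<lambda>(x, g). (b ** x, g)) \<in> M \<Otimes>\<^sub>M M \<rightarrow>\<^sub>M borel \<Otimes>\<^sub>M borel"
    by measurable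
  from measurable_compose [OF this tri_action_L2_inner_measurable [of f f']]
  have "(\<lambda>(x, g). L2_inner (tri_action (b ** x) f) (tri_action g f')) \<in> borel_measurable (M \<Otimes>\<^sub>M M)"
    by (simp add: case_prod_beta)
  then show ?thesis
    by (rule measurable_cong [THEN iffD2, rotated])
      (auto simp: space_pair_measure metaplectic_eq_tri_action triangular_mult assms)
qed

end

subsection \<open>Mass transport over a lattice\<close>

lemma ennreal_norm_square_measurable:
  fixes f :: "'a \<Rightarrow> complex"
  assumes [measurable]: "f \<in> borel_measurable N"
  shows "(\<lambda>x. ennreal ((norm (f x))\<^sup>2)) \<in> borel_measurable N"
  by measurable

lemma ennreal_mult_right_cancel:
  fixes a b c :: ennreal
  assumes "a * c = b * c" "c \<noteq> 0" "c \<noteq> top_class.top"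
  shows "a = b"
  by (metis assms mult_divide_eq_ennreal)

lemma nn_integral_count_space_one:
  assumes "\<exists>!a. a \<in> A \<and> P a" "countable A"
  shows "(\<integral>\<^sup>+ a. (if P a then c else 0) \<partial>count_space A) = c"
proof -
  obtain a where a: "a \<in> A" "P a" "\<And>b. b \<in> A \<Longrightarrow> P b \<Longrightarrow> b = a"
    using assms by blast
  have "(\<integral>\<^sup>+ a. (if P a then c else 0) \<partial>count_space A) = (\<integral>\<^sup>+ b. c * indicator {a} b \<partial>count_space A)"
    using a(1,2) by (intro nn_integral_cong) (auto simp: indicator_def dest: a(3))
  also have "\<dots> = c"
    using a(1) by (simp add: nn_integral_cmult_indicator)
  finally show ?thesis .
qed

context haar_group
begin

lemma sigma_finite_tiling:
  assumes "countable \<Gamma>" "\<Gamma> \<subseteq> G" "D \<in> sets M" "emeasure M D < \<infinity>"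
    and "\<And>g. g \<in> G \<Longrightarrow> \<exists>a\<in>\<Gamma>. a ** g \<in> D"
  shows "sigma_finite_measure M"
proof
  let ?f = "\<lambda>a. (**) (matrix_inv a) ` D"
  have 1: "\<forall>B\<in>?f ` \<Gamma>. B \<in> sets M \<and> emeasure M B \<noteq> \<infinity>"
  proof
    fix B assume "B \<in> ?f ` \<Gamma>"
    then obtain a where a: "a \<in> \<Gamma>" and B: "B = ?f a"
      by (rule imageE)
    then have "matrix_inv a \<in> G"
      using assms(2) inv_closed by blast
    then show "B \<in> sets M \<and> emeasure M B \<noteq> \<infinity>"
      using assms(3,4) by (simp add: B translate_sets emeasure_translate)
  qed
  have 2: "\<Union> (?f ` \<Gamma>) = space M"
  proof (rule equalityI)
    show "\<Union> (?f ` \<Gamma>) \<subseteq> space M"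
      using 1 sets.sets_into_space by (intro Union_least) blast
    show "space M \<subseteq> \<Union> (?f ` \<Gamma>)"
    proof
      fix g assume "g \<in> space M"
      then obtain a where a: "a \<in> \<Gamma>" "a ** g \<in> D"
        using assms(5) by auto
      then have "g = matrix_inv a ** (a ** g)"
        using assms(2) by (simp add: subset_iff)
      with a(2) have "g \<in> ?f a"
        by (rule image_eqI [rotated])
      with a(1) show "g \<in> \<Union> (?f ` \<Gamma>)"
        by (rule UN_I)
    qed
  qed
  have "?f ` \<Gamma> \<subseteq> sets M" "\<forall>B\<in>?f ` \<Gamma>. emeasure M B \<noteq> \<infinity>"
    using 1 by blast+
  with 2 countable_image [OF assms(1), of ?f]
  show "\<exists>A. countable A \<and> A \<subseteq> sets M \<and> \<Union> A = space M \<and> (\<forall>a\<in>A. emeasure M a \<noteq> \<infinity>)"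
    by (intro exI [of _ "?f ` \<Gamma>"] conjI)
qed

text \<open>
  Mass transport: the double integral of \<open>\<bar>\<langle>U (b x) \<eta>, U g \<eta>\<rangle>\<bar>\<^sup>2\<close> over \<open>x \<in> b\<^sup>-\<^sup>1 D b\<close>, \<open>g \<in> G\<close>
  equals the one over \<open>x \<in> G\<close>, \<open>g \<in> D\<close>, because the integrand is invariant under
  \<open>(x, g) \<mapsto> (b\<^sup>-\<^sup>1 \<gamma> b x, \<gamma> g)\<close> and the group is tiled by the translates of \<open>D\<close>.
\<close>

lemma emeasure_conj_fundamental_domain:
  assumes \<Gamma>: "countable \<Gamma>" "\<Gamma> \<subseteq> G" "\<And>a. a \<in> \<Gamma> \<Longrightarrow> matrix_inv a \<in> \<Gamma>"
    and D: "D \<in> sets M" "emeasure M D < \<infinity>" "\<And>g. g \<in> G \<Longrightarrow> \<exists>!a. a \<in> \<Gamma> \<and> a ** g \<in> D"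
    and b: "b \<in> triangular" "\<And>g. g \<in> G \<Longrightarrow> matrix_inv b ** g ** b \<in> G"
      "\<And>g. g \<in> G \<Longrightarrow> b ** g ** matrix_inv b \<in> G"
    and \<eta>: "\<eta> \<in> L2"
    and rep: "\<And>f. f \<in> L2 \<Longrightarrow> ennreal ((L2_norm f)\<^sup>2) =
        (\<integral>\<^sup>+ g. ennreal ((norm (L2_inner f (metaplectic g \<eta>)))\<^sup>2) \<partial>M)"
  shows "emeasure M {x\<in>G. b ** x ** matrix_inv b \<in> D} * ennreal ((L2_norm \<eta>)\<^sup>2) =
         emeasure M D * ennreal ((L2_norm \<eta>)\<^sup>2)"
proof -
  interpret sigma_finite_measure M
    using sigma_finite_tiling [OF \<Gamma>(1,2) D(1,2)] D(3) by blast
  interpret pair_sigma_finite M M ..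
  define a where "a x g = ennreal ((norm (L2_inner (metaplectic (b ** x) \<eta>) (metaplectic g \<eta>)))\<^sup>2)" for x g
  let ?D' = "{x\<in>G. b ** x ** matrix_inv b \<in> D}"
  let ?n = "ennreal ((L2_norm \<eta>)\<^sup>2)"
  have DG: "D \<subseteq> G"
    using D(1) sets.sets_into_space by fastforce
  have D' [measurable]: "?D' \<in> sets M"
    using measurable_sets [OF measurable_conj [of b "matrix_inv b"] D(1)] b(3)
    by (auto simp: vimage_def Int_def conj_commute)
  have [measurable]: "D \<in> sets M"
    by (rule D(1))
  have a_pair [measurable]: "(\<lambda>(x, g). a x g) \<in> borel_measurable (M \<Otimes>\<^sub>M M)"
    unfolding a_def using ennreal_norm_square_measurable [OF coefficient_measurable_pair [OF \<eta> \<eta> b(1)]]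
    by (simp add: case_prod_beta)
  have U: "metaplectic (b ** x) \<eta> \<in> L2" "L2_norm (metaplectic (b ** x) \<eta>) = L2_norm \<eta>" if "x \<in> G" for x
    using that b(1) \<eta> by (simp_all add: metaplectic_triangular_L2 triangular_mult)
  have fst: "(\<integral>\<^sup>+ g. a x g \<partial>M) = ?n" if "x \<in> G" for x
    unfolding a_def using rep [OF U(1) [OF that]] by (simp add: U that)
  have snd: "(\<integral>\<^sup>+ x. a x g \<partial>M) = ?n" if "g \<in> G" for g
  proof -
    have bg: "matrix_inv b ** g \<in> triangular"
      using that b(1) by (simp add: triangular_mult triangular_inv)
    have "a x g = ennreal ((norm (L2_inner (metaplectic (matrix_inv b ** g) \<eta>) (metaplectic x \<eta>)))\<^sup>2)"
      if "x \<in> G" for x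
    proof -
      have "L2_inner (metaplectic (b ** x) \<eta>) (metaplectic g \<eta>) =
          L2_inner (metaplectic b (metaplectic x \<eta>)) (metaplectic (b ** (matrix_inv b ** g)) \<eta>)"
        using that b(1) by (simp add: metaplectic_triangular_mult)
      also have "\<dots> = L2_inner (metaplectic x \<eta>) (metaplectic (matrix_inv b ** g) \<eta>)"
        using that b(1) bg \<eta>
        by (simp add: metaplectic_triangular_mult [of b "matrix_inv b ** g"] L2_inner_metaplectic_triangular
          metaplectic_triangular_L2 del: triangular_cancel)
      finally show ?thesis
        by (simp add: a_def norm_L2_inner_commute)
    qed
    then have "(\<integral>\<^sup>+ x. a x g \<partial>M) =
        (\<integral>\<^sup>+ x. ennreal ((norm (L2_inner (metaplectic (matrix_inv b ** g) \<eta>) (metaplectic x \<eta>)))\<^sup>2) \<partial>M)"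
      by (intro nn_integral_cong) simp
    also have "\<dots> = ?n"
      using rep [of "metaplectic (matrix_inv b ** g) \<eta>"] bg \<eta> by (simp add: metaplectic_triangular_L2)
    finally show ?thesis .
  qed
  have inv_a: "a x (matrix_inv c ** g) = a (matrix_inv b ** c ** b ** x) g"
    if "c \<in> G" "x \<in> G" "g \<in> G" for c x g
  proof -
    have "b ** (matrix_inv b ** c ** b ** x) = c ** (b ** x)"
      using b(1) by (simp flip: matrix_mul_assoc)
    moreover have "L2_inner (metaplectic (b ** x) \<eta>) (metaplectic (matrix_inv c ** g) \<eta>) =
        L2_inner (metaplectic c (metaplectic (b ** x) \<eta>)) (metaplectic c (metaplectic (matrix_inv c ** g) \<eta>))"
      using that b(1) \<eta>
      by (simp add: L2_inner_metaplectic_triangular metaplectic_triangular_L2 triangular_mult inv_closed mult_closed)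
    moreover have "metaplectic c (metaplectic (matrix_inv c ** g) \<eta>) = metaplectic g \<eta>"
      using that by (simp add: inv_closed mult_closed flip: metaplectic_triangular_mult)
    moreover have "metaplectic c (metaplectic (b ** x) \<eta>) = metaplectic (c ** (b ** x)) \<eta>"
      using that b(1) by (simp add: triangular_mult metaplectic_triangular_mult)
    ultimately show ?thesis
      by (simp add: a_def)
  qed
  let ?I = "\<lambda>x. \<integral>\<^sup>+ g. (if g \<in> D then a x g else 0) \<partial>M"
  have [measurable]: "(\<lambda>x. ?I x) \<in> borel_measurable M"
    by measurable
  have "emeasure M ?D' * ?n = (\<integral>\<^sup>+ x. ?n * indicator ?D' x \<partial>M)"
    by (subst nn_integral_cmult_indicator) (simp_all add: mult.commute)
  also have "\<dots> = (\<integral>\<^sup>+ x. (if x \<in> ?D' then \<integral>\<^sup>+ g. a x g \<partial>M else 0) \<partial>M)"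
    by (intro nn_integral_cong) (auto simp: fst)
  also have "\<dots> = (\<integral>\<^sup>+ x. (if x \<in> ?D' then \<integral>\<^sup>+ c. \<integral>\<^sup>+ g. (if c ** g \<in> D then a x g else 0) \<partial>M \<partial>count_space \<Gamma> else 0) \<partial>M)"
  proof (intro nn_integral_cong if_cong refl)
    fix x assume "x \<in> space M"
    have "(\<integral>\<^sup>+ g. a x g \<partial>M) = (\<integral>\<^sup>+ g. \<integral>\<^sup>+ c. (if c ** g \<in> D then a x g else 0) \<partial>count_space \<Gamma> \<partial>M)"
      using D(3) \<Gamma>(1) by (intro nn_integral_cong) (simp add: nn_integral_count_space_one)
    also have "\<dots> = (\<integral>\<^sup>+ c. \<integral>\<^sup>+ g. (if c ** g \<in> D then a x g else 0) \<partial>M \<partial>count_space \<Gamma>)"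
    proof (rule nn_integral_count_space_nn_integral [OF \<Gamma>(1)])
      fix c assume "c \<in> \<Gamma>"
      then have [measurable]: "(**) c \<in> measurable M M"
        using \<Gamma> by (intro measurable_translate) auto
      show "(\<lambda>g. if c ** g \<in> D then a x g else 0) \<in> borel_measurable M"
        using \<open>x \<in> space M\<close> by measurable
    qed
    finally show "(\<integral>\<^sup>+ g. a x g \<partial>M) = (\<integral>\<^sup>+ c. \<integral>\<^sup>+ g. (if c ** g \<in> D then a x g else 0) \<partial>M \<partial>count_space \<Gamma>)" .
  qed
  also have "\<dots> = (\<integral>\<^sup>+ x. (if x \<in> ?D' then \<integral>\<^sup>+ c. ?I (matrix_inv b ** c ** b ** x) \<partial>count_space \<Gamma> else 0) \<partial>M)"
  proof (rule nn_integral_cong, rule if_cong [OF refl _ refl], rule nn_integral_cong)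
    fix x c assume "x \<in> space M" "c \<in> space (count_space \<Gamma>)"
    then have xc: "x \<in> G" "c \<in> G" "matrix_inv c \<in> G"
      using \<Gamma> by (auto simp: inv_closed)
    then have [measurable]: "(**) c \<in> measurable M M"
      by (intro measurable_translate)
    have F: "(\<lambda>g. if c ** g \<in> D then a x g else 0) \<in> borel_measurable M"
      using \<open>x \<in> space M\<close> by measurable
    show "(\<integral>\<^sup>+ g. (if c ** g \<in> D then a x g else 0) \<partial>M) = ?I (matrix_inv b ** c ** b ** x)"
      unfolding nn_integral_translate [OF xc(3) F, symmetric]
      using xc by (intro nn_integral_cong) (auto simp: inv_a)
  qed
  also have "\<dots> = (\<integral>\<^sup>+ x. \<integral>\<^sup>+ c. (if x \<in> ?D' then ?I (matrix_inv b ** c ** b ** x) else 0) \<partial>count_space \<Gamma> \<partial>M)"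
    by (intro nn_integral_cong) auto
  also have "\<dots> = (\<integral>\<^sup>+ c. \<integral>\<^sup>+ x. (if x \<in> ?D' then ?I (matrix_inv b ** c ** b ** x) else 0) \<partial>M \<partial>count_space \<Gamma>)"
  proof (rule nn_integral_count_space_nn_integral [OF \<Gamma>(1)])
    fix c assume "c \<in> \<Gamma>"
    then have [measurable]: "(**) (matrix_inv b ** c ** b) \<in> measurable M M"
      using \<Gamma> b by (intro measurable_translate) auto
    show "(\<lambda>x. if x \<in> ?D' then ?I (matrix_inv b ** c ** b ** x) else 0) \<in> borel_measurable M"
      by (intro measurable_If measurable_compose [OF \<open>(**) _ \<in> _\<close> \<open>(\<lambda>x. ?I x) \<in> _\<close>]) measurable
  qed
  also have "\<dots> = (\<integral>\<^sup>+ c. \<integral>\<^sup>+ x. (if matrix_inv c ** (b ** x ** matrix_inv b) \<in> D then ?I x else 0) \<partial>M \<partial>count_space \<Gamma>)"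
  proof (rule nn_integral_cong)
    fix c assume "c \<in> space (count_space \<Gamma>)"
    then have c: "c \<in> G" "matrix_inv c \<in> G" "matrix_inv b ** c ** b \<in> G" "matrix_inv b ** matrix_inv c ** b \<in> G"
      using \<Gamma> b by (auto simp: inv_closed)
    have [measurable]: "(**) (matrix_inv b ** matrix_inv c ** b) \<in> measurable M M"
      using c by (intro measurable_translate) auto
    let ?F = "\<lambda>x. if matrix_inv b ** matrix_inv c ** b ** x \<in> ?D' then ?I x else 0"
    have F: "?F \<in> borel_measurable M"
      by measurable
    have "matrix_inv b ** matrix_inv c ** b ** (matrix_inv b ** c ** b ** x) = x"
      for x :: "real^(2 + 2)^(2 + 2)"
      using b(1) c by (simp flip: matrix_mul_assoc)
    then have "(\<integral>\<^sup>+ x. (if x \<in> ?D' then ?I (matrix_inv b ** c ** b ** x) else 0) \<partial>M) =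
        (\<integral>\<^sup>+ x. ?F (matrix_inv b ** c ** b ** x) \<partial>M)"
      by simp
    also have "\<dots> = (\<integral>\<^sup>+ x. ?F x \<partial>M)"
      by (rule nn_integral_translate [OF c(3) F])
    also have "\<dots> = (\<integral>\<^sup>+ x. (if matrix_inv c ** (b ** x ** matrix_inv b) \<in> D then ?I x else 0) \<partial>M)"
    proof (intro nn_integral_cong if_cong refl)
      fix x assume "x \<in> space M"
      moreover have "b ** (matrix_inv b ** matrix_inv c ** b ** x) ** matrix_inv b = matrix_inv c ** (b ** x ** matrix_inv b)"
        using b(1) by (simp flip: matrix_mul_assoc)
      ultimately show "matrix_inv b ** matrix_inv c ** b ** x \<in> ?D' \<longleftrightarrow> matrix_inv c ** (b ** x ** matrix_inv b) \<in> D"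
        using c by (simp add: mult_closed)
    qed
    finally show "(\<integral>\<^sup>+ x. (if x \<in> ?D' then ?I (matrix_inv b ** c ** b ** x) else 0) \<partial>M) =
       (\<integral>\<^sup>+ x. (if matrix_inv c ** (b ** x ** matrix_inv b) \<in> D then ?I x else 0) \<partial>M)" .
  qed
  also have "\<dots> = (\<integral>\<^sup>+ x. \<integral>\<^sup>+ c. (if matrix_inv c ** (b ** x ** matrix_inv b) \<in> D then ?I x else 0) \<partial>count_space \<Gamma> \<partial>M)"
  proof (rule nn_integral_count_space_nn_integral [OF \<Gamma>(1), symmetric])
    fix c assume "c \<in> \<Gamma>"
    have [measurable]: "(**) (matrix_inv c) \<in> measurable M M"
      using \<open>c \<in> \<Gamma>\<close> \<Gamma> by (intro measurable_translate) auto
    have [measurable]: "(\<lambda>x. b ** x ** matrix_inv b) \<in> measurable M M"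
      using b by (intro measurable_conj) auto
    show "(\<lambda>x. if matrix_inv c ** (b ** x ** matrix_inv b) \<in> D then ?I x else 0) \<in> borel_measurable M"
      by measurable
  qed
  also have "\<dots> = (\<integral>\<^sup>+ x. ?I x \<partial>M)"
  proof (rule nn_integral_cong, rule nn_integral_count_space_one [OF _ \<Gamma>(1)])
    fix x assume "x \<in> space M"
    then have "b ** x ** matrix_inv b \<in> G"
      using b by simp
    from D(3) [OF this] obtain c where c: "c \<in> \<Gamma>" "c ** (b ** x ** matrix_inv b) \<in> D"
      and uniq: "\<And>c'. c' \<in> \<Gamma> \<Longrightarrow> c' ** (b ** x ** matrix_inv b) \<in> D \<Longrightarrow> c' = c"
      by blast
    have inv: "matrix_inv (matrix_inv c) = c" if "c \<in> \<Gamma>" for c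
      using that \<Gamma>(2) by (simp add: triangular_inv subset_iff)
    show "\<exists>!c. c \<in> \<Gamma> \<and> matrix_inv c ** (b ** x ** matrix_inv b) \<in> D"
    proof (rule ex1I [of _ "matrix_inv c"])
      show "matrix_inv c \<in> \<Gamma> \<and> matrix_inv (matrix_inv c) ** (b ** x ** matrix_inv b) \<in> D"
        using c \<Gamma>(3) by (simp add: inv)
      show "c' = matrix_inv c" if "c' \<in> \<Gamma> \<and> matrix_inv c' ** (b ** x ** matrix_inv b) \<in> D" for c'
        using that uniq [of "matrix_inv c'"] \<Gamma>(3) inv [of c'] by auto
    qed
  qed
  also have "\<dots> = (\<integral>\<^sup>+ g. \<integral>\<^sup>+ x. (if g \<in> D then a x g else 0) \<partial>M \<partial>M)"
    by (rule Fubini') measurable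
  also have "\<dots> = (\<integral>\<^sup>+ g. ?n * indicator D g \<partial>M)"
  proof (rule nn_integral_cong)
    fix g assume "g \<in> space M"
    then show "(\<integral>\<^sup>+ x. (if g \<in> D then a x g else 0) \<partial>M) = ?n * indicator D g"
      by (cases "g \<in> D") (simp_all add: snd)
  qed
  also have "\<dots> = emeasure M D * ?n"
    by (simp add: nn_integral_cmult_indicator) (simp add: mult.commute)
  finally show ?thesis .
qed

lemma L2_inner_eq_0:
  assumes "f \<in> L2" "f' \<in> L2" "L2_norm f' = 0"
  shows "L2_inner f f' = 0"
proof -
  have "(LINT x|lborel. (norm (f' x))\<^sup>2) = 0"
    using assms(3) L2_norm_square [of f'] by simp
  then have "AE x in lborel. (norm (f' x))\<^sup>2 = 0"
    using integral_nonneg_eq_0_iff_AE [OF L2_D(2) [OF assms(2)]] by simp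
  then have "AE x in lborel. f x * cnj (f' x) = 0"
    by eventually_elim simp
  then show ?thesis
    unfolding L2_inner_def by (rule integral_eq_zero_AE)
qed

lemma admissible_nonzero:
  assumes \<eta>: "\<eta> \<in> L2"
    and rep: "\<And>f. f \<in> L2 \<Longrightarrow> ennreal ((L2_norm f)\<^sup>2) =
        (\<integral>\<^sup>+ g. ennreal ((norm (L2_inner f (metaplectic g \<eta>)))\<^sup>2) \<partial>M)"
  shows "L2_norm \<eta> \<noteq> 0"
proof
  assume 0: "L2_norm \<eta> = 0"
  let ?B = "box 0 (\<Sum>Basis) :: (real^2) set"
  let ?f = "\<lambda>x. complex_of_real (indicator ?B x)"
  have B: "measure lborel ?B = 1"
    by (simp add: measure_lborel_box_eq)
  have f: "?f \<in> L2" "(L2_norm ?f)\<^sup>2 = 1"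
    using indicator_L2 [of ?B] B by (auto simp: emeasure_lborel_box_eq)
  have "L2_inner ?f (metaplectic g \<eta>) = 0" if "g \<in> G" for g
    using that \<eta> 0 f by (intro L2_inner_eq_0) (auto simp: metaplectic_triangular_L2)
  then have "(\<integral>\<^sup>+ g. ennreal ((norm (L2_inner ?f (metaplectic g \<eta>)))\<^sup>2) \<partial>M) = (\<integral>\<^sup>+ g. 0 \<partial>M)"
    by (intro nn_integral_cong) simp
  with rep [OF f(1)] f(2) show False
    by simp
qed

lemma fundamental_domain_not_null:
  assumes \<Gamma>: "countable \<Gamma>" "\<Gamma> \<subseteq> G"
    and D: "D \<in> sets M" "\<And>g. g \<in> G \<Longrightarrow> \<exists>a\<in>\<Gamma>. a ** g \<in> D"
  shows "emeasure M D \<noteq> 0"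
proof
  assume 0: "emeasure M D = 0"
  have "g \<in> (\<Union>a\<in>\<Gamma>. (**) (matrix_inv a) ` D)" if "g \<in> G" for g
  proof -
    obtain a where "a \<in> \<Gamma>" "a ** g \<in> D"
      using D(2) \<open>g \<in> G\<close> by blast
    then show ?thesis
      using \<Gamma>(2) by (intro UN_I [of a] image_eqI [of _ _ "a ** g"]) auto
  qed
  moreover have "(\<Union>a\<in>\<Gamma>. (**) (matrix_inv a) ` D) \<in> null_sets M"
    using \<Gamma> D(1) 0
    by (intro null_sets_UN' null_setsI) (auto simp: emeasure_translate translate_sets inv_closed subset_iff)
  ultimately have "emeasure M G = 0"
    by (metis (no_types, lifting) emeasure_eq_0 null_setsD1 null_setsD2 subsetI)
  then show False
    using haar by (simp add: left_haar_measure_def)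
qed

end

text \<open>
  Conjugation by \<open>b\<close> expands the fundamental domain \<open>D\<close>, whereas mass transport says that it
  preserves the Haar measure of \<open>D\<close>.
\<close>

theorem (in triangular_group) not_reproducing_if_expanding_lattice:
  assumes \<Gamma>: "countable \<Gamma>" "\<Gamma> \<subseteq> G" "\<And>a. a \<in> \<Gamma> \<Longrightarrow> matrix_inv a \<in> \<Gamma>"
    and D: "D \<in> sets borel" "compact K" "D \<subseteq> K" "K \<subseteq> G" "\<And>g. g \<in> G \<Longrightarrow> \<exists>!a. a \<in> \<Gamma> \<and> a ** g \<in> D"
    and b: "b \<in> triangular" "\<And>g. g \<in> G \<Longrightarrow> matrix_inv b ** g ** b \<in> G"
      "\<And>g. g \<in> G \<Longrightarrow> b ** g ** matrix_inv b \<in> G"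
    and k: "k \<in> G" "\<And>d. d \<in> D \<Longrightarrow> k ** d \<notin> D" "\<And>d. d \<in> D \<Longrightarrow> b ** d ** matrix_inv b \<in> D"
      "\<And>d. d \<in> D \<Longrightarrow> b ** (k ** d) ** matrix_inv b \<in> D"
  shows "\<not> reproducing G"
proof
  assume "reproducing G"
  then obtain M \<eta> where haar: "left_haar_measure G M" and \<eta>: "\<eta> \<in> L2"
    and rep: "\<And>f. f \<in> L2 \<Longrightarrow> ennreal ((L2_norm f)\<^sup>2) =
        (\<integral>\<^sup>+ g. ennreal ((norm (L2_inner f (metaplectic g \<eta>)))\<^sup>2) \<partial>M)"
    unfolding reproducing_def by blast
  interpret haar_group G M
    by unfold_locales (rule haar)
  have DM: "D \<in> sets M"
    using D(1,3,4) unfolding sets_M sets_restrict_space by (intro image_eqI [of _ _ D]) auto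
  have "K \<in> sets M"
    using borel_compact [OF D(2)] D(4) unfolding sets_M sets_restrict_space by (intro image_eqI [of _ _ K]) auto
  moreover have "emeasure M K < \<infinity>"
    using haar D(2,4) by (simp add: left_haar_measure_def)
  ultimately have fin: "emeasure M D < \<infinity>"
    using emeasure_mono [OF D(3)] le_less_trans by blast
  let ?D' = "{x\<in>G. b ** x ** matrix_inv b \<in> D}"
  have D': "?D' \<in> sets M"
    using measurable_sets [OF measurable_conj [of b "matrix_inv b"] DM] b(3)
    by (auto simp: vimage_def Int_def conj_commute)
  have "emeasure M ?D' * ennreal ((L2_norm \<eta>)\<^sup>2) = emeasure M D * ennreal ((L2_norm \<eta>)\<^sup>2)"
    by (rule emeasure_conj_fundamental_domain [OF \<Gamma> DM fin D(5) b \<eta> rep])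
  moreover have "ennreal ((L2_norm \<eta>)\<^sup>2) \<noteq> 0"
    using admissible_nonzero [OF \<eta> rep] by (simp add: ennreal_eq_0_iff not_le)
  ultimately have eq: "emeasure M ?D' = emeasure M D"
    by (rule ennreal_mult_right_cancel [OF _ _ ennreal_neq_top])
  have "D \<union> (**) k ` D \<subseteq> ?D'"
    using k(1,3,4) D(3,4) mult_closed by auto
  then have "emeasure M (D \<union> (**) k ` D) \<le> emeasure M D"
    unfolding eq [symmetric] by (rule emeasure_mono [OF _ D'])
  moreover have "emeasure M (D \<union> (**) k ` D) = emeasure M D + emeasure M D"
    using k DM translate_sets [OF k(1) DM]
    by (subst plus_emeasure [symmetric]) (auto simp: emeasure_translate)
  ultimately have "emeasure M D + emeasure M D \<le> emeasure M D + 0"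
    by simp
  then have "emeasure M D \<le> 0"
    using fin by (subst (asm) ennreal_add_left_cancel_le) auto
  then have "emeasure M D = 0"
    by simp
  then show False
    using fundamental_domain_not_null [OF \<Gamma>(1,2) DM] D(5) by blast
qed

subsection \<open>Two by two matrices\<close>

lemma mat2_nth [simp]:
  "mat2 a b c d $ 1 $ 1 = a" "mat2 a b c d $ 1 $ 2 = b" "mat2 a b c d $ 2 $ 1 = c" "mat2 a b c d $ 2 $ 2 = d"
  by (simp_all add: mat2_def)

lemma mat2_eq_iff [simp]: "mat2 a b c d = mat2 a' b' c' d' \<longleftrightarrow> a = a' \<and> b = b' \<and> c = c' \<and> d = d'"
  by (simp add: vec_eq_iff forall_2)

lemma mat2_cases: obtains a b c d where "A = mat2 a b c d"
  by (rule that [of "A $ 1 $ 1" "A $ 1 $ 2" "A $ 2 $ 1" "A $ 2 $ 2"]) (simp add: vec_eq_iff forall_2)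

lemma mat2_mult [simp]:
  "mat2 a b c d ** mat2 a' b' c' d' = mat2 (a * a' + b * c') (a * b' + b * d') (c * a' + d * c') (c * b' + d * d')"
  by (simp add: vec_eq_iff forall_2 matrix_matrix_mult_def sum_2)

lemma mat2_mult_vec:
  "(mat2 a b c d *v x) $ 1 = a * x $ 1 + b * x $ 2" "(mat2 a b c d *v x) $ 2 = c * x $ 1 + d * x $ 2"
  by (simp_all add: matrix_vector_mult_def sum_2)

lemma transpose_mat2 [simp]: "transpose (mat2 a b c d) = mat2 a c b d"
  by (simp add: vec_eq_iff forall_2 transpose_def)

lemma mat_1_mat2: "mat 1 = mat2 1 0 0 1"
  by (simp add: vec_eq_iff forall_2 mat_def)

lemma zero_mat2: "0 = mat2 0 0 0 0"
  by (simp add: vec_eq_iff forall_2)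

lemma mat2_add [simp]: "mat2 a b c d + mat2 a' b' c' d' = mat2 (a + a') (b + b') (c + c') (d + d')"
  by (simp add: vec_eq_iff forall_2)

lemma mat2_uminus [simp]: "- mat2 a b c d = mat2 (- a) (- b) (- c) (- d)"
  by (simp add: vec_eq_iff forall_2)

lemma mat2_scaleR [simp]: "r *\<^sub>R mat2 a b c d = mat2 (r * a) (r * b) (r * c) (r * d)"
  by (simp add: vec_eq_iff forall_2)

lemma det_mat2 [simp]: "det (mat2 a b c d) = a * d - b * c"
  by (simp add: det_2)

lemma invertible_mat2 [simp]: "invertible (mat2 a b c d) \<longleftrightarrow> a * d - b * c \<noteq> 0"
  by (simp add: invertible_det_nz)

lemma matrix_inv_mat2:
  assumes "D = a * d - b * c" "D \<noteq> 0"
  shows "matrix_inv (mat2 a b c d) = mat2 (d / D) (- b / D) (- c / D) (a / D)"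
  by (rule matrix_inv_unique) (use assms in \<open>simp add: mat_1_mat2 field_simps\<close>)

subsection \<open>The form of a reproducing vector\<close>

locale reproducing_group = haar_group +
  fixes \<eta> :: "real^2 \<Rightarrow> complex"
  assumes \<eta>: "\<eta> \<in> L2"
    and rep: "f \<in> L2 \<Longrightarrow> ennreal ((L2_norm f)\<^sup>2) =
        (\<integral>\<^sup>+ g. ennreal ((norm (L2_inner f (metaplectic g \<eta>)))\<^sup>2) \<partial>M)"
begin

definition coeff :: "(real^2 \<Rightarrow> complex) \<Rightarrow> real^(2 + 2)^(2 + 2) \<Rightarrow> complex" where
  "coeff f g = L2_inner f (metaplectic g \<eta>)"

definition form :: "(real^(2 + 2)^(2 + 2)) set \<Rightarrow> (real^2 \<Rightarrow> complex) \<Rightarrow> (real^2 \<Rightarrow> complex) \<Rightarrow> complex" where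
  "form Z f f' = (LINT g|M. of_real (indicator Z g) * (coeff f g * cnj (coeff f' g)))"

lemma coeff_measurable [measurable]: "f \<in> L2 \<Longrightarrow> coeff f \<in> borel_measurable M"
  unfolding coeff_def by (rule coefficient_measurable [OF _ \<eta>])

lemma nn_integral_coeff: "f \<in> L2 \<Longrightarrow> (\<integral>\<^sup>+ g. ennreal ((norm (coeff f g))\<^sup>2) \<partial>M) = ennreal ((L2_norm f)\<^sup>2)"
  by (simp add: coeff_def rep)

lemma integrable_coeff_square:
  assumes "f \<in> L2"
  shows "integrable M (\<lambda>g. (norm (coeff f g))\<^sup>2)" "(LINT g|M. (norm (coeff f g))\<^sup>2) = (L2_norm f)\<^sup>2"
proof -
  have [measurable]: "coeff f \<in> borel_measurable M"
    using assms by simp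
  show "integrable M (\<lambda>g. (norm (coeff f g))\<^sup>2)"
    by (rule integrableI_nonneg) (auto simp: nn_integral_coeff assms)
  show "(LINT g|M. (norm (coeff f g))\<^sup>2) = (L2_norm f)\<^sup>2"
    by (rule integral_eq_nn_integral [THEN trans]) (auto simp: nn_integral_coeff assms)
qed

lemma integrable_form:
  assumes "f \<in> L2" "f' \<in> L2" and [measurable]: "Z \<in> sets M"
  shows "integrable M (\<lambda>g. of_real (indicator Z g) * (coeff f g * cnj (coeff f' g)))"
proof (rule Bochner_Integration.integrable_bound)
  have [measurable]: "coeff f \<in> borel_measurable M" "coeff f' \<in> borel_measurable M"
    using assms by simp_all
  show "integrable M (\<lambda>g. (norm (coeff f g))\<^sup>2 + (norm (coeff f' g))\<^sup>2)"
    using assms by (simp add: integrable_coeff_square)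
  show "(\<lambda>g. of_real (indicator Z g) * (coeff f g * cnj (coeff f' g))) \<in> borel_measurable M"
    by measurable
  show "AE g in M. norm (of_real (indicator Z g) * (coeff f g * cnj (coeff f' g)))
      \<le> norm ((norm (coeff f g))\<^sup>2 + (norm (coeff f' g))\<^sup>2)"
  proof (rule AE_I2)
    fix g
    have "2 * (norm (coeff f g) * norm (coeff f' g)) \<le> (norm (coeff f g))\<^sup>2 + (norm (coeff f' g))\<^sup>2"
      using sum_squares_bound [of "norm (coeff f g)" "norm (coeff f' g)"] by simp
    moreover have "0 \<le> norm (coeff f g) * norm (coeff f' g)"
      by simp
    ultimately have "norm (coeff f g) * norm (coeff f' g) \<le> (norm (coeff f g))\<^sup>2 + (norm (coeff f' g))\<^sup>2"
      by linarith
    then show "norm (of_real (indicator Z g) * (coeff f g * cnj (coeff f' g)))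
      \<le> norm ((norm (coeff f g))\<^sup>2 + (norm (coeff f' g))\<^sup>2)"
      by (simp add: norm_mult indicator_def)
  qed
qed

lemma coeff_add: "f \<in> L2 \<Longrightarrow> f' \<in> L2 \<Longrightarrow> g \<in> G \<Longrightarrow> coeff (\<lambda>x. f x + f' x) g = coeff f g + coeff f' g"
  by (simp add: coeff_def L2_inner_add metaplectic_triangular_L2 \<eta>)

lemma coeff_cmult: "coeff (\<lambda>x. c * f x) g = c * coeff f g"
  by (simp add: coeff_def L2_inner_cmult)

lemma form_commute: "form Z f f' = cnj (form Z f' f)"
  unfolding form_def by (subst Bochner_Integration.integral_cnj [symmetric]) (simp add: mult_ac)

lemma form_add:
  assumes "f1 \<in> L2" "f2 \<in> L2" "f' \<in> L2" "Z \<in> sets M"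
  shows "form Z (\<lambda>x. f1 x + f2 x) f' = form Z f1 f' + form Z f2 f'"
proof -
  have "form Z (\<lambda>x. f1 x + f2 x) f' = (LINT g|M. of_real (indicator Z g) * (coeff f1 g * cnj (coeff f' g))
      + of_real (indicator Z g) * (coeff f2 g * cnj (coeff f' g)))"
    unfolding form_def using assms
    by (intro Bochner_Integration.integral_cong) (simp_all add: coeff_add algebra_simps)
  also have "\<dots> = form Z f1 f' + form Z f2 f'"
    unfolding form_def using assms by (intro Bochner_Integration.integral_add integrable_form)
  finally show ?thesis .
qed

lemma form_cmult: "form Z (\<lambda>x. c * f x) f' = c * form Z f f'"
  by (simp add: form_def coeff_cmult mult_ac flip: integral_mult_right_zero)

lemma form_add_right:
  assumes "f1 \<in> L2" "f2 \<in> L2" "f' \<in> L2" "Z \<in> sets M"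
  shows "form Z f' (\<lambda>x. f1 x + f2 x) = form Z f' f1 + form Z f' f2"
  using form_add [OF assms] by (metis complex_cnj_add form_commute)

lemma form_cmult_right: "form Z f' (\<lambda>x. c * f x) = cnj c * form Z f' f"
  by (metis complex_cnj_mult form_commute form_cmult)

lemma form_Cauchy_Schwarz:
  assumes "f \<in> L2" "f' \<in> L2" "Z \<in> sets M"
  shows "norm (form Z f f') \<le> L2_norm f * L2_norm f'"
proof -
  have [measurable]: "coeff f \<in> borel_measurable M" "coeff f' \<in> borel_measurable M"
    using assms by simp_all
  have "ennreal (norm (form Z f f')) \<le> (\<integral>\<^sup>+ g. norm (of_real (indicator Z g) * (coeff f g * cnj (coeff f' g))) \<partial>M)"
    unfolding form_def by (rule integral_norm_bound_ennreal [OF integrable_form [OF assms]])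
  also have "\<dots> \<le> (\<integral>\<^sup>+ g. ennreal (norm (coeff f g)) * ennreal (norm (coeff f' g)) \<partial>M)"
    by (rule nn_integral_mono) (auto simp: norm_mult indicator_def simp flip: ennreal_mult)
  finally have "(ennreal (norm (form Z f f')))\<^sup>2 \<le>
      (\<integral>\<^sup>+ g. ennreal (norm (coeff f g)) * ennreal (norm (coeff f' g)) \<partial>M)\<^sup>2"
    by (rule power_mono) simp
  also have "\<dots> \<le> (\<integral>\<^sup>+ g. (ennreal (norm (coeff f g)))\<^sup>2 \<partial>M) * (\<integral>\<^sup>+ g. (ennreal (norm (coeff f' g)))\<^sup>2 \<partial>M)"
    by (rule Cauchy_Schwarz_nn_integral) measurable
  also have "\<dots> = ennreal ((L2_norm f * L2_norm f')\<^sup>2)"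
    using assms by (simp add: ennreal_power nn_integral_coeff power_mult_distrib ennreal_mult)
  finally have "(norm (form Z f f'))\<^sup>2 \<le> (L2_norm f * L2_norm f')\<^sup>2"
    by (simp add: ennreal_power)
  then show ?thesis
    by (rule power2_le_imp_le) (simp add: L2_norm_nonneg)
qed

lemma form_metaplectic:
  assumes "f \<in> L2" "f' \<in> L2" "a \<in> G" "Z \<in> sets M" "\<And>g. g \<in> G \<Longrightarrow> a ** g \<in> Z \<longleftrightarrow> g \<in> Z'"
  shows "form Z (metaplectic a f) (metaplectic a f') = form Z' f f'"
proof -
  have L2: "metaplectic a f \<in> L2" "metaplectic a f' \<in> L2"
    using assms by (simp_all add: metaplectic_triangular_L2)
  have coeff: "coeff (metaplectic a f) (a ** g) = coeff f g" if "g \<in> G" "f \<in> L2" for f g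
    using that assms \<eta>
    by (simp add: coeff_def metaplectic_triangular_mult L2_inner_metaplectic_triangular metaplectic_triangular_L2)
  have "form Z (metaplectic a f) (metaplectic a f') =
      (LINT g|M. of_real (indicator Z (a ** g)) * (coeff (metaplectic a f) (a ** g) * cnj (coeff (metaplectic a f') (a ** g))))"
    unfolding form_def
    by (rule integral_translate [symmetric, OF assms(3)
        borel_measurable_integrable [OF integrable_form [OF L2 assms(4)]]])
  also have "\<dots> = form Z' f f'"
    unfolding form_def using assms
    by (intro Bochner_Integration.integral_cong) (simp_all add: coeff indicator_def)
  finally show ?thesis .
qed

definition self_adjoint :: "(real^(2 + 2)^(2 + 2)) set \<Rightarrow> (real^2 \<Rightarrow> real) \<Rightarrow> bool" where
  "self_adjoint Z m \<longleftrightarrow> m \<in> borel_measurable borel \<and> bounded (range m) \<and>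
     (\<forall>f\<in>L2. \<forall>f'\<in>L2. form Z (\<lambda>x. of_real (m x) * f x) f' = form Z f (\<lambda>x. of_real (m x) * f' x))"

lemma self_adjoint_L2:
  assumes "self_adjoint Z m" "f \<in> L2"
  shows "(\<lambda>x. of_real (m x) * f x) \<in> L2"
proof -
  obtain C where "\<And>x. norm (m x) \<le> C"
    using assms(1) by (auto simp: self_adjoint_def bounded_iff)
  then show ?thesis
    using assms by (intro L2_bounded_mult [of _ _ C]) (auto simp: self_adjoint_def)
qed

lemma self_adjoint_const: "self_adjoint Z (\<lambda>x. c)"
  by (auto simp: self_adjoint_def form_cmult form_cmult_right)

lemma self_adjoint_add:
  assumes "self_adjoint Z m" "self_adjoint Z m'" "Z \<in> sets M"
  shows "self_adjoint Z (\<lambda>x. m x + m' x)"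
  using assms self_adjoint_L2 [OF assms(1)] self_adjoint_L2 [OF assms(2)]
  unfolding self_adjoint_def
  by (auto simp: distrib_right form_add form_add_right bounded_plus_comp)

lemma self_adjoint_mult:
  assumes "self_adjoint Z m" "self_adjoint Z m'"
  shows "self_adjoint Z (\<lambda>x. m x * m' x)"
proof -
  obtain C C' where C: "\<And>x. \<bar>m x\<bar> \<le> C" "\<And>x. \<bar>m' x\<bar> \<le> C'"
    using assms by (auto simp: self_adjoint_def bounded_iff)
  then have "\<bar>m x * m' x\<bar> \<le> C * C'" for x
    unfolding abs_mult by (intro mult_mono) (auto intro: order_trans [OF abs_ge_zero])
  then have "bounded (range (\<lambda>x. m x * m' x))"
    by (auto simp: bounded_iff)
  moreover have "form Z (\<lambda>x. of_real (m x * m' x) * f x) f' = form Z f (\<lambda>x. of_real (m x * m' x) * f' x)"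
    if "f \<in> L2" "f' \<in> L2" for f f'
  proof -
    have "form Z (\<lambda>x. of_real (m x) * (of_real (m' x) * f x)) f' = form Z (\<lambda>x. of_real (m' x) * f x) (\<lambda>x. of_real (m x) * f' x)"
      using assms(1) self_adjoint_L2 [OF assms(2) that(1)] that(2) by (simp add: self_adjoint_def)
    also have "\<dots> = form Z f (\<lambda>x. of_real (m' x) * (of_real (m x) * f' x))"
      using assms(2) self_adjoint_L2 [OF assms(1) that(2)] that(1) by (simp add: self_adjoint_def)
    finally show ?thesis
      by (simp add: mult_ac)
  qed
  ultimately show ?thesis
    using assms by (auto simp: self_adjoint_def)
qed

lemma self_adjoint_polynomial:
  assumes "self_adjoint Z m" "Z \<in> sets M" "real_polynomial_function p"
  shows "self_adjoint Z (\<lambda>x. p (m x))"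
  using assms(3)
proof induction
  case (linear h)
  then obtain c where "h = (\<lambda>x. x * c)"
    using real_bounded_linear by blast
  then show ?case
    by (simp add: self_adjoint_mult assms self_adjoint_const)
qed (simp_all add: assms self_adjoint_const self_adjoint_add self_adjoint_mult)

lemma form_tendsto:
  assumes Z: "Z \<in> sets M" and f: "f \<in> L2" "f' \<in> L2"
    and m [measurable]: "\<And>k. m k \<in> borel_measurable borel" "m0 \<in> borel_measurable borel"
    and bound: "\<And>k x. \<bar>m k x\<bar> \<le> C" and lim: "\<And>x. (\<lambda>k. m k x) \<longlonglongrightarrow> m0 x"
  shows "(\<lambda>k. form Z (\<lambda>x. of_real (m k x) * f x) f') \<longlonglongrightarrow> form Z (\<lambda>x. of_real (m0 x) * f x) f'"
proof -
  have [measurable]: "f \<in> borel_measurable borel"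
    using f by (simp add: L2_D)
  have bound0: "\<bar>m0 x\<bar> \<le> C" for x
    using tendsto_le [OF _ tendsto_const tendsto_rabs [OF lim [of x]]] bound by simp
  have L2: "(\<lambda>x. of_real (m k x) * f x) \<in> L2" "(\<lambda>x. of_real (m0 x) * f x) \<in> L2" for k
    using f bound bound0 by (auto intro!: L2_bounded_mult [of _ _ C])
  let ?d = "\<lambda>k x. complex_of_real (m k x - m0 x) * f x"
  have d: "?d k \<in> L2" for k
  proof (rule L2_bounded_mult [OF f(1)])
    show "norm (complex_of_real (m k x - m0 x)) \<le> C + C" for x
      using bound [of k x] bound0 [of x] unfolding norm_of_real real_norm_def by linarith
  qed measurable
  have "(\<lambda>k. LINT x|lborel. (norm (?d k x))\<^sup>2) \<longlonglongrightarrow> (LINT x|(lborel :: (real^2) measure). 0)"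
  proof (rule integral_dominated_convergence [where w = "\<lambda>x. (2 * C)\<^sup>2 * (norm (f x))\<^sup>2"])
    show "integrable lborel (\<lambda>x. (2 * C)\<^sup>2 * (norm (f x))\<^sup>2)"
      using f by (simp add: L2_D)
    show "AE x in lborel. (\<lambda>k. (norm (?d k x))\<^sup>2) \<longlonglongrightarrow> 0"
    proof (rule AE_I2)
      fix x
      have "(\<lambda>k. (norm (?d k x))\<^sup>2) \<longlonglongrightarrow> (norm (complex_of_real (m0 x - m0 x) * f x))\<^sup>2"
        by (intro tendsto_intros lim)
      then show "(\<lambda>k. (norm (?d k x))\<^sup>2) \<longlonglongrightarrow> 0"
        by simp
    qed
    show "AE x in lborel. norm ((norm (?d k x))\<^sup>2) \<le> (2 * C)\<^sup>2 * (norm (f x))\<^sup>2" for k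
    proof (rule AE_I2)
      fix x
      have "\<bar>m k x - m0 x\<bar> \<le> 2 * C"
        using bound [of k x] bound0 [of x] by linarith
      then have "\<bar>m k x - m0 x\<bar>\<^sup>2 \<le> (2 * C)\<^sup>2"
        by (intro power_mono) auto
      then show "norm ((norm (?d k x))\<^sup>2) \<le> (2 * C)\<^sup>2 * (norm (f x))\<^sup>2"
        by (simp only: norm_mult norm_of_real power_mult_distrib real_norm_def abs_mult abs_power2 power2_abs)
          (intro mult_right_mono, simp_all)
    qed
  qed simp_all
  then have "(\<lambda>k. L2_norm (?d k)) \<longlonglongrightarrow> sqrt 0"
    unfolding L2_norm_def by (intro tendsto_real_sqrt) simp
  then have "(\<lambda>k. L2_norm (?d k) * L2_norm f') \<longlonglongrightarrow> 0"
    by (intro tendsto_mult_left_zero) simp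
  then have "(\<lambda>k. form Z (?d k) f') \<longlonglongrightarrow> 0"
    by (rule Lim_null_comparison [rotated]) (intro always_eventually allI form_Cauchy_Schwarz [OF d f(2) Z])
  moreover have "form Z (\<lambda>x. of_real (m k x) * f x) f' =
      form Z (?d k) f' + form Z (\<lambda>x. of_real (m0 x) * f x) f'" for k
    unfolding form_add [OF d L2(2) f(2) Z, symmetric] by (simp add: algebra_simps)
  ultimately show ?thesis
    using tendsto_add [of "\<lambda>k. form Z (?d k) f'" 0 sequentially
        "\<lambda>_. form Z (\<lambda>x. of_real (m0 x) * f x) f'"] by simp
qed

text \<open>
  Functions on which a self-adjoint multiplier takes opposite signs are orthogonal for the form:
  polynomials in the multiplier converge to its sign, by Weierstrass.
\<close>

lemma form_eq_0:
  assumes Z: "Z \<in> sets M" and f: "f \<in> L2" "f' \<in> L2" and m: "self_adjoint Z m"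
    and neg: "\<And>x. f x \<noteq> 0 \<Longrightarrow> m x < 0" and pos: "\<And>x. f' x \<noteq> 0 \<Longrightarrow> m x \<ge> 0"
  shows "form Z f f' = 0"
proof -
  obtain C where C: "\<And>x. \<bar>m x\<bar> \<le> C"
    using m by (auto simp: self_adjoint_def bounded_iff)
  have [measurable]: "m \<in> borel_measurable borel"
    using m by (simp add: self_adjoint_def)
  define \<phi> where "\<phi> k t = min 1 (max 0 (- (real k * t)))" for k t
  have "\<exists>p. real_polynomial_function p \<and> (\<forall>t\<in>{-C..C}. \<bar>\<phi> k t - p t\<bar> < 1 / real (Suc k))" for k
    by (rule Stone_Weierstrass_real_polynomial_function [of "{-C..C}" "\<phi> k" "1 / real (Suc k)"])
      (auto simp: \<phi>_def intro!: continuous_intros)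
  then obtain p where p: "\<And>k. real_polynomial_function (p k)"
    "\<And>k t. t \<in> {-C..C} \<Longrightarrow> \<bar>\<phi> k t - p k t\<bar> < 1 / real (Suc k)"
    by metis
  have p': "\<bar>\<phi> k (m x) - p k (m x)\<bar> < 1 / real (Suc k)" for k x
    using p(2) [of "m x" k] C [of x] by (simp add: abs_le_iff)
  have sa: "self_adjoint Z (\<lambda>x. p k (m x))" for k
    by (rule self_adjoint_polynomial [OF m Z p(1)])
  let ?s = "\<lambda>x. if m x < 0 then 1 else 0 :: real"
  have \<phi>_lim: "(\<lambda>k. \<phi> k t) \<longlonglongrightarrow> (if t < 0 then 1 else 0)" for t
  proof (cases "t < 0")
    case True
    obtain N where N: "1 < real N * (- t)"
      using reals_Archimedean3 [of "- t"] True by (metis neg_0_less_iff_less)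
    have "\<phi> k t = 1" if "k \<ge> N" for k
    proof -
      have "real N * (- t) \<le> real k * (- t)"
        using that True by (intro mult_right_mono) auto
      with N show ?thesis
        by (simp add: \<phi>_def min_def max_def)
    qed
    then have "eventually (\<lambda>k. \<phi> k t = 1) sequentially"
      by (auto simp: eventually_sequentially)
    then show ?thesis
      using True by (simp add: tendsto_eventually)
  qed (simp add: \<phi>_def)
  have lim: "(\<lambda>k. p k (m x)) \<longlonglongrightarrow> ?s x" for x
  proof -
    have "(\<lambda>k. \<phi> k (m x) - p k (m x)) \<longlonglongrightarrow> 0"
      by (rule Lim_null_comparison [OF _ LIMSEQ_inverse_real_of_nat])
        (use p' in \<open>auto simp: inverse_eq_divide less_imp_le\<close>)
    from tendsto_diff [OF \<phi>_lim [of "m x"] this] show ?thesis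
      by simp
  qed
  have bound: "\<bar>p k (m x)\<bar> \<le> 2" for k x
  proof -
    have "1 / real (Suc k) \<le> 1"
      by simp
    moreover have "\<bar>\<phi> k (m x)\<bar> \<le> 1"
      by (simp add: \<phi>_def)
    ultimately show ?thesis
      using p' [of k x] by linarith
  qed
  have meas: "(\<lambda>x. p k (m x)) \<in> borel_measurable borel" for k
    using sa by (simp add: self_adjoint_def)
  have s_meas: "?s \<in> borel_measurable borel"
    by measurable
  have s_f: "(\<lambda>x. of_real (?s x) * f x) = f" "(\<lambda>x. of_real (?s x) * f' x) = (\<lambda>x. 0 * f' x)"
    using neg pos by fastforce+
  have "(\<lambda>k. form Z (\<lambda>x. of_real (p k (m x)) * f x) f') \<longlonglongrightarrow> form Z f f'"
    using form_tendsto [OF Z f meas s_meas bound lim] unfolding s_f .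
  moreover have "(\<lambda>k. cnj (form Z (\<lambda>x. of_real (p k (m x)) * f' x) f)) \<longlonglongrightarrow> cnj (form Z (\<lambda>x. 0 * f' x) f)"
    using tendsto_cnj [OF form_tendsto [OF Z f(2) f(1) meas s_meas bound lim]] unfolding s_f .
  moreover have "cnj (form Z (\<lambda>x. of_real (p k (m x)) * f' x) f) = form Z (\<lambda>x. of_real (p k (m x)) * f x) f'" for k
    unfolding form_commute [symmetric] using sa [of k] f by (simp add: self_adjoint_def)
  moreover have "cnj (form Z (\<lambda>x. 0 * f' x) f) = 0"
    by (simp only: form_cmult) simp
  ultimately show ?thesis
    by (simp only: LIMSEQ_unique)
qed

lemma self_adjoint_sin:
  assumes Z: "Z \<in> sets M" "\<And>g. g \<in> G \<Longrightarrow> tri \<sigma> (mat 1) ** g \<in> Z \<longleftrightarrow> g \<in> Z"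
    and \<sigma>: "tri \<sigma> (mat 1) \<in> G" "tri (- \<sigma>) (mat 1) \<in> G"
  shows "self_adjoint Z (\<lambda>x. sin (pi * ((\<sigma> *v x) \<bullet> x)))"
proof -
  have 1: "invertible (mat 1 :: real^2^2)"
    by (simp add: mat_1_mat2)
  let ?e = "\<lambda>x. exp (of_real pi * \<i> * of_real ((\<sigma> *v x) \<bullet> x))"
  let ?U = "metaplectic (tri \<sigma> (mat 1))" and ?V = "metaplectic (tri (- \<sigma>) (mat 1))"
  have inv: "tri \<sigma> (mat 1) ** tri (- \<sigma>) (mat 1) = mat 1" "tri (- \<sigma>) (mat 1) ** tri \<sigma> (mat 1) = mat 1"
    by (simp_all add: tri_mult 1 tri_one)
  have UV: "?U (?V f) = f" "?V (?U f) = f" for f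
    using \<sigma> by (simp_all add: inv flip: metaplectic_triangular_mult)
  have Z': "tri (- \<sigma>) (mat 1) ** g \<in> Z \<longleftrightarrow> g \<in> Z" if "g \<in> G" for g
    using Z(2) [of "tri (- \<sigma>) (mat 1) ** g"] that \<sigma> inv(1) by (simp add: mult_closed matrix_mul_assoc)
  have sin: "of_real (sin (pi * ((\<sigma> *v x) \<bullet> x))) * f x = (1 / (2 * \<i>)) * ?U f x + (- 1 / (2 * \<i>)) * ?V f x" for f x
  proof -
    have "\<i> * complex_of_real (pi * ((\<sigma> *v x) \<bullet> x)) = of_real pi * \<i> * of_real ((\<sigma> *v x) \<bullet> x)"
      by simp
    moreover have "((- \<sigma>) *v x) \<bullet> x = - ((\<sigma> *v x) \<bullet> x)"
      using matrix_vector_mult_diff_rdistrib [of 0 \<sigma> x] by simp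
    ultimately show ?thesis
      unfolding sin_of_real [symmetric] sin_exp_eq
      by (simp add: metaplectic_tri 1 field_simps)
  qed
  have "form Z (\<lambda>x. of_real (sin (pi * ((\<sigma> *v x) \<bullet> x))) * f x) f' =
      form Z f (\<lambda>x. of_real (sin (pi * ((\<sigma> *v x) \<bullet> x))) * f' x)" if f: "f \<in> L2" "f' \<in> L2" for f f'
  proof -
    have L2: "?U f \<in> L2" "?V f \<in> L2" "?U f' \<in> L2" "?V f' \<in> L2"
      using f \<sigma> by (simp_all add: metaplectic_triangular_L2)
    have L2': "(\<lambda>x. c * ?U f x) \<in> L2" "(\<lambda>x. c * ?V f x) \<in> L2" "(\<lambda>x. c * ?U f' x) \<in> L2" "(\<lambda>x. c * ?V f' x) \<in> L2" for c
      using L2 by (simp_all add: L2_cmult)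
    have "form Z (?U f) f' = form Z f (?V f')"
      using form_metaplectic [of f "?V f'" "tri \<sigma> (mat 1)" Z Z] f L2 \<sigma> Z by (simp add: UV)
    moreover have "form Z (?V f) f' = form Z f (?U f')"
      using form_metaplectic [of f "?U f'" "tri (- \<sigma>) (mat 1)" Z Z] f L2 \<sigma> Z Z' by (simp add: UV)
    ultimately show ?thesis
      unfolding sin form_add [OF L2'(1,2) f(2) Z(1)] form_add_right [OF L2'(3,4) f(1) Z(1)]
      by (simp only: form_cmult form_cmult_right) simp
  qed
  moreover have "(\<lambda>x. sin (pi * ((\<sigma> *v x) \<bullet> x))) \<in> borel_measurable borel"
    by (intro borel_measurable_continuous_onI continuous_intros)
  moreover have "bounded (range (\<lambda>x. sin (pi * ((\<sigma> *v x) \<bullet> x))))"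
    by (auto simp: bounded_iff intro!: exI [of _ 1])
  ultimately show ?thesis
    by (auto simp: self_adjoint_def)
qed

end

lemma upper_left_tri_mult:
  assumes "invertible h" "g \<in> triangular"
  shows "upper_left (tri \<sigma> h ** g) = h ** upper_left g"
  using assms by (auto simp: triangular_def tri_mult) (simp add: tri_def)

lemma in_Ints_diff_unique:
  fixes s t :: real
  assumes "s - t \<in> \<int>" "0 \<le> s" "s < 1" "0 \<le> t" "t < 1"
  shows "s = t"
  using Ints_nonzero_abs_less1 [of "s - t"] assms by (auto simp: abs_if)

text \<open>
  For the indicator \<open>f\<close> of a wedge, the dilation of \<open>f\<close> is, up to normalisation, \<open>f\<close> plus its
  shear, and these two are orthogonal for the form. Hence the part of the reproducing integral
  of \<open>f\<close> over the elements with upper left entry below \<open>t\<close> is the same for \<open>t\<close> and \<open>t / 2\<close>; but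
  it tends to \<open>0\<close> at one end and to \<open>L2_norm f ^ 2\<close> at the other.
\<close>

theorem (in triangular_group) not_reproducing_if_dilation:
  assumes \<sigma>: "\<And>u v. tri (mat2 0 v v u) (mat 1) \<in> G"
    and h: "tri 0 (mat2 1 1 0 1) \<in> G" "tri 0 (mat2 2 0 0 1) \<in> G"
    and upper: "\<And>g. g \<in> G \<Longrightarrow> upper_left g $ 1 $ 1 > 0 \<and> upper_left g $ 2 $ 1 = 0"
  shows "\<not> reproducing G"
proof
  assume "reproducing G"
  then obtain M \<eta> where haar: "left_haar_measure G M" and \<eta>: "\<eta> \<in> L2"
    and rep: "\<And>f. f \<in> L2 \<Longrightarrow> ennreal ((L2_norm f)\<^sup>2) =
        (\<integral>\<^sup>+ g. ennreal ((norm (L2_inner f (metaplectic g \<eta>)))\<^sup>2) \<partial>M)"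
    unfolding reproducing_def by blast
  interpret reproducing_group G M \<eta>
    by unfold_locales (fact haar, fact \<eta>, fact rep)
  define c where "c g = upper_left g $ 1 $ 1" for g :: "real^(2+2)^(2+2)"
  define Z where "Z t = {g\<in>G. c g < t}" for t
  let ?I = "mat 1 :: real^2^2" and ?n = "tri 0 (mat2 1 1 0 1)" and ?k = "tri 0 (mat2 2 0 0 1)"
  have c_mult: "c (tri \<sigma> (mat2 p q 0 r) ** g) = p * c g" if "g \<in> G" "p * r \<noteq> 0" for \<sigma> p q r g
  proof -
    obtain a b d e where "upper_left g = mat2 a b d e"
      by (rule mat2_cases)
    then show ?thesis
      using that upper [of g] by (simp add: c_def upper_left_tri_mult)
  qed
  have Z_meas [measurable]: "Z t \<in> sets M" for t
  proof -
    have "c \<in> borel_measurable M"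
      unfolding c_def by (rule continuous_measurable_from_M) (intro continuous_intros)
    then have "{g \<in> space M. c g < t} \<in> sets M"
      by measurable
    then show ?thesis
      by (simp add: Z_def)
  qed
  have Z_inv: "a ** g \<in> Z t \<longleftrightarrow> g \<in> Z t'"
    if "a = tri \<sigma> (mat2 p q 0 r)" "a \<in> G" "g \<in> G" "p > 0" "r \<noteq> 0" "t' = t / p" for a g \<sigma> p q r t t'
    using that by (simp add: Z_def c_mult mult_closed pos_less_divide_eq mult.commute)

  define W :: "(real^2) set" where "W = {x. 1 < x $ 2 \<and> x $ 2 < 2 \<and> 0 \<le> x $ 1 \<and> x $ 1 < x $ 2}"
  define f where "f x = complex_of_real (indicator W x)" for x
  have "W = {x. 1 < x $ 2} \<inter> {x. x $ 2 < 2} \<inter> {x. 0 \<le> x $ 1} \<inter> {x. x $ 1 < x $ 2}"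
    by (auto simp: W_def)
  moreover have "open {x :: real^2. 1 < x $ 2}" "open {x :: real^2. x $ 2 < 2}" "open {x :: real^2. x $ 1 < x $ 2}"
    by (intro open_Collect_less continuous_intros)+
  moreover have "closed {x :: real^2. 0 \<le> x $ 1}"
    by (intro closed_Collect_le continuous_intros)
  ultimately have W_meas: "W \<in> sets borel"
    by (simp add: sets.Int borel_open borel_closed)
  have "W \<subseteq> box (vector [-1, 0]) (vector [3, 3])"
    by (auto simp: W_def mem_box_cart forall_2)
  then have "emeasure lborel W \<le> emeasure lborel (box (vector [-1, 0]) (vector [3, 3]) :: (real^2) set)"
    by (rule emeasure_mono) simp
  then have W_fin: "emeasure lborel W < \<infinity>"
    by (rule le_less_trans) (simp add: emeasure_lborel_box_eq)
  have L2: "f \<in> L2" "(L2_norm f)\<^sup>2 = measure lborel W"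
    using indicator_L2 [OF W_meas W_fin] by (auto simp: f_def [abs_def])
  have "measure lborel (box (vector [0, 1]) (vector [1, 2]) :: (real^2) set) \<le> measure lborel W"
    using W_fin W_meas
    by (intro measure_mono_fmeasurable) (auto simp: W_def mem_box_cart forall_2 fmeasurable_def)
  moreover have "measure lborel (box (vector [0, 1]) (vector [1, 2]) :: (real^2) set) = 1"
    by (simp add: measure_lborel_box_eq Basis_vec_def inner_axis UNIV_2 axis_eq_axis)
  ultimately have pos: "L2_norm f \<noteq> 0"
    using L2(2) by auto

  define f' where "f' = metaplectic ?n f"
  have f': "f' \<in> L2"
    using h L2(1) by (simp add: f'_def metaplectic_triangular_L2)
  have f'_eq: "f' x = of_real (indicator W (mat2 1 (-1) 0 1 *v x))" for x
    by (simp add: f'_def metaplectic_tri f_def matrix_inv_mat2)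
  have dil: "metaplectic ?k f = (\<lambda>x. of_real (2 powr (- 1/2)) * (f x + f' x))"
  proof
    fix x
    have "metaplectic ?k f x = of_real (2 powr (- 1/2)) * of_real (indicator W (mat2 (1/2) 0 0 1 *v x))"
      by (simp add: metaplectic_tri f_def matrix_inv_mat2)
    also have "indicator W (mat2 (1/2) 0 0 1 *v x) = (indicator W x + indicator W (mat2 1 (-1) 0 1 *v x) :: real)"
      by (auto simp: W_def mat2_mult_vec indicator_def)
    finally show "metaplectic ?k f x = of_real (2 powr (- 1/2)) * (f x + f' x)"
      by (simp add: f'_eq) (simp add: f_def)
  qed
  have cross: "form (Z t) f f' = 0" for t
  proof -
    define \<sigma>0 where "\<sigma>0 = mat2 0 (1/16) (1/16) (-1/8)"
    have \<sigma>0: "tri \<sigma>0 ?I \<in> G" "tri (- \<sigma>0) ?I \<in> G"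
      using \<sigma> [of "1/16" "-1/8"] \<sigma> [of "-1/16" "1/8"] by (simp_all add: \<sigma>0_def)
    have sa: "self_adjoint (Z t) (\<lambda>x. sin (pi * ((\<sigma>0 *v x) \<bullet> x)))"
      by (rule self_adjoint_sin [OF Z_meas _ \<sigma>0])
        (rule Z_inv [where p = 1 and q = 0 and r = 1], use \<sigma>0 in \<open>simp_all add: mat_1_mat2\<close>)
    have form: "(\<sigma>0 *v x) \<bullet> x = x $ 2 * (x $ 1 - x $ 2) / 8" for x
      by (simp add: inner_vec_def sum_2 \<sigma>0_def mat2_mult_vec algebra_simps)
    show ?thesis
    proof (rule form_eq_0 [OF Z_meas L2(1) f' sa])
      fix x assume "f x \<noteq> 0"
      then have x: "1 < x $ 2" "x $ 2 < 2" "0 \<le> x $ 1" "x $ 1 < x $ 2"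
        by (auto simp: f_def W_def indicator_def split: if_splits)
      then have "x $ 2 * (x $ 2 - x $ 1) \<le> 2 * 2" "0 < x $ 2 * (x $ 2 - x $ 1)"
        by (intro mult_mono mult_pos_pos; linarith)+
      then have "- 1 < (\<sigma>0 *v x) \<bullet> x" "(\<sigma>0 *v x) \<bullet> x < 0"
        by (simp_all add: form algebra_simps)
      then have "0 < pi * - ((\<sigma>0 *v x) \<bullet> x)" "pi * - ((\<sigma>0 *v x) \<bullet> x) < pi * 1"
        by (intro mult_pos_pos mult_strict_left_mono; simp)+
      then have "0 < sin (pi * - ((\<sigma>0 *v x) \<bullet> x))"
        by (intro sin_gt_zero) auto
      then show "sin (pi * ((\<sigma>0 *v x) \<bullet> x)) < 0"
        by simp
    next
      fix x assume "f' x \<noteq> 0"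
      then have x: "1 < x $ 2" "x $ 2 < 2" "0 \<le> x $ 1 - x $ 2" "x $ 1 - x $ 2 < x $ 2"
        by (auto simp: f'_eq W_def indicator_def mat2_mult_vec split: if_splits)
      then have "x $ 2 * (x $ 1 - x $ 2) \<le> 2 * 2" "0 \<le> x $ 2 * (x $ 1 - x $ 2)"
        by (intro mult_mono mult_nonneg_nonneg; linarith)+
      then have "0 \<le> (\<sigma>0 *v x) \<bullet> x" "(\<sigma>0 *v x) \<bullet> x \<le> 1"
        by (simp_all add: form)
      then show "0 \<le> sin (pi * ((\<sigma>0 *v x) \<bullet> x))"
        by (intro sin_ge_zero) (auto simp: mult_left_le)
    qed
  qed

  define \<beta> where "\<beta> t = form (Z t) f f" for t
  have half: "\<beta> t = \<beta> (t / 2)" for t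
  proof -
    have "form (Z t) (metaplectic ?k f) (metaplectic ?k f) = \<beta> (t / 2)"
      unfolding \<beta>_def by (rule form_metaplectic [OF L2(1) L2(1) h(2) Z_meas])
        (rule Z_inv [where p = 2 and q = 0 and r = 1], use h in simp_all)
    moreover have f_f': "(\<lambda>x. f x + f' x) \<in> L2"
      using L2(1) f' by (rule L2_add)
    moreover have "form (Z t) f' f' = \<beta> t"
      unfolding \<beta>_def f'_def by (rule form_metaplectic [OF L2(1) L2(1) h(1) Z_meas])
        (rule Z_inv [where p = 1 and q = 1 and r = 1], use h in simp_all)
    moreover have "form (Z t) f' f = 0"
      using cross [of t] form_commute [of "Z t" f' f] by simp
    moreover have "complex_of_real (2 powr (- 1/2)) * complex_of_real (2 powr (- 1/2)) = 1 / 2"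
      by (simp add: powr_minus_divide flip: of_real_mult powr_add)
    ultimately show ?thesis
      using cross [of t] unfolding dil \<beta>_def
      by (simp add: form_cmult form_cmult_right form_add form_add_right L2(1) f' mult.assoc [symmetric])
  qed
  have down: "\<beta> (1 / 2 ^ k) = \<beta> 1" for k :: nat
    using half [of "1 / 2 ^ k" for k] by (induction k) (simp_all add: mult.commute)
  have up: "\<beta> (2 ^ k) = \<beta> 1" for k :: nat
    using half [of "2 ^ Suc k" for k] by (induction k) simp_all
  have dom: "(\<lambda>k. \<beta> (T k)) \<longlonglongrightarrow> (LINT g|M. of_real (l g) * (coeff f g * cnj (coeff f g)))"
    if "\<And>g. g \<in> G \<Longrightarrow> (\<lambda>k. indicator (Z (T k)) g) \<longlonglongrightarrow> (l g :: real)" 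
      "l \<in> borel_measurable M" for T l
    unfolding \<beta>_def form_def
  proof (rule integral_dominated_convergence [where w = "\<lambda>g. (norm (coeff f g))\<^sup>2"])
    have [measurable]: "l \<in> borel_measurable M" "coeff f \<in> borel_measurable M"
      using that L2(1) by auto
    show "(\<lambda>g. of_real (l g) * (coeff f g * cnj (coeff f g))) \<in> borel_measurable M"
      "(\<lambda>g. of_real (indicator (Z (T k)) g) * (coeff f g * cnj (coeff f g))) \<in> borel_measurable M" for k
      by measurable
    show "integrable M (\<lambda>g. (norm (coeff f g))\<^sup>2)"
      using L2(1) by (rule integrable_coeff_square)
    show "AE g in M. (\<lambda>k. of_real (indicator (Z (T k)) g) * (coeff f g * cnj (coeff f g)))
        \<longlonglongrightarrow> of_real (l g) * (coeff f g * cnj (coeff f g))"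
      using that by (intro AE_I2 tendsto_intros) simp
    show "AE g in M. norm (of_real (indicator (Z (T k)) g) * (coeff f g * cnj (coeff f g))) \<le> (norm (coeff f g))\<^sup>2" for k
      by (intro AE_I2) (simp add: norm_mult indicator_def power2_eq_square)
  qed
  have "(\<lambda>k. \<beta> (1 / 2 ^ k)) \<longlonglongrightarrow> (LINT g|M. of_real 0 * (coeff f g * cnj (coeff f g)))"
  proof (rule dom)
    fix g assume "g \<in> G"
    then have "0 < c g"
      using upper by (simp add: c_def)
    then obtain N where N: "(1 / 2) ^ N < c g"
      using real_arch_pow_inv [of "c g" "1 / 2"] by auto
    have "indicator (Z (1 / 2 ^ k)) g = (0 :: real)" if "k \<ge> N" for k
    proof -
      have "(1 / 2 :: real) ^ k \<le> (1 / 2) ^ N"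
        using that by (intro power_decreasing) auto
      with N show ?thesis
        by (simp add: Z_def power_one_over)
    qed
    then show "(\<lambda>k. indicator (Z (1 / 2 ^ k)) g) \<longlonglongrightarrow> (0 :: real)"
      by (intro tendsto_eventually) (auto simp: eventually_sequentially)
  qed simp
  moreover have "(\<lambda>k. \<beta> (2 ^ k)) \<longlonglongrightarrow> (LINT g|M. of_real 1 * (coeff f g * cnj (coeff f g)))"
  proof (rule dom)
    fix g assume "g \<in> G"
    obtain N where N: "c g < 2 ^ N"
      using real_arch_pow [of 2 "c g"] by auto
    have "indicator (Z (2 ^ k)) g = (1 :: real)" if "k \<ge> N" for k
    proof -
      have "(2 :: real) ^ N \<le> 2 ^ k"
        using that by (intro power_increasing) auto
      with N have "c g < 2 ^ k"
        by linarith
      with \<open>g \<in> G\<close> show ?thesis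
        by (simp add: Z_def)
    qed
    then show "(\<lambda>k. indicator (Z (2 ^ k)) g) \<longlonglongrightarrow> (1 :: real)"
      by (intro tendsto_eventually) (auto simp: eventually_sequentially)
  qed simp
  ultimately have "\<beta> 1 = 0" "\<beta> 1 = (LINT g|M. coeff f g * cnj (coeff f g))"
    by (simp_all add: down up LIMSEQ_const_iff)
  then have "(LINT g|M. complex_of_real ((norm (coeff f g))\<^sup>2)) = 0"
    by (simp only: complex_norm_square)
  then have "(LINT g|M. (norm (coeff f g))\<^sup>2) = 0"
    by (simp only: integral_complex_of_real of_real_eq_0_iff)
  then show False
    using pos integrable_coeff_square(2) [OF L2(1)] by simp
qed

subsection \<open>Semidirect products with a lattice\<close>

definition integer_points :: "'e::euclidean_space set" where
  "integer_points = {z. \<forall>i\<in>Basis. z \<bullet> i \<in> \<int>}"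

definition half_open_cube :: "'e::euclidean_space set" where
  "half_open_cube = {z. \<forall>i\<in>Basis. 0 \<le> z \<bullet> i \<and> z \<bullet> i < 1}"

lemma countable_integer_points: "countable (integer_points :: 'e::euclidean_space set)"
proof (rule countable_image_inj_on)
  let ?f = "\<lambda>z :: 'e. \<lambda>i\<in>Basis. z \<bullet> i"
  have "?f ` integer_points \<subseteq> Pi\<^sub>E Basis (\<lambda>_. \<int>)"
    by (auto simp: integer_points_def)
  moreover have "countable (Pi\<^sub>E Basis (\<lambda>_. \<int>) :: ('e \<Rightarrow> real) set)"
    by (intro countable_PiE) (auto simp: Ints_def)
  ultimately show "countable (?f ` integer_points)"
    by (rule countable_subset)
  show "inj_on ?f integer_points"
    by (rule inj_onI, rule euclidean_eqI) (metis restrict_apply')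
qed

lemma integer_points_minus: "z \<in> integer_points \<Longrightarrow> - z \<in> integer_points"
  by (simp add: integer_points_def)

lemma integer_translate_to_cube: "\<exists>l\<in>integer_points. l + z \<in> half_open_cube"
proof
  let ?l = "\<Sum>i\<in>Basis. of_int (- \<lfloor>z \<bullet> i\<rfloor>) *\<^sub>R i"
  have l: "?l \<bullet> i = of_int (- \<lfloor>z \<bullet> i\<rfloor>)" if "i \<in> Basis" for i
    using that by (rule inner_sum_left_Basis)
  have "0 \<le> of_int (- \<lfloor>z \<bullet> i\<rfloor>) + z \<bullet> i \<and> of_int (- \<lfloor>z \<bullet> i\<rfloor>) + z \<bullet> i < 1" for i
    by linarith
  with l show "?l + z \<in> half_open_cube"
    by (simp only: half_open_cube_def inner_add_left mem_Collect_eq) simp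
  from l show "?l \<in> integer_points"
    by (simp only: integer_points_def mem_Collect_eq) simp
qed

lemma integer_translate_to_cube_unique:
  assumes "l \<in> integer_points" "l' \<in> integer_points" "l + z \<in> half_open_cube" "l' + z \<in> half_open_cube"
  shows "l = l'"
proof (rule euclidean_eqI)
  fix i :: 'a assume i: "i \<in> Basis"
  then have "(l \<bullet> i + z \<bullet> i) - (l' \<bullet> i + z \<bullet> i) \<in> \<int>"
    using assms by (simp add: integer_points_def)
  then have "l \<bullet> i + z \<bullet> i = l' \<bullet> i + z \<bullet> i"
    using assms i by (intro in_Ints_diff_unique) (auto simp: half_open_cube_def inner_add_left)
  then show "l \<bullet> i = l' \<bullet> i"
    by simp
qed

lemma half_open_cube_Union: 
  "(half_open_cube :: 'e::euclidean_space set) = (\<Union>n. cbox 0 ((1 - 1 / real (Suc n)) *\<^sub>R One))"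
proof (intro equalityI subsetI)
  fix z :: 'e assume z: "z \<in> half_open_cube"
  define e where "e = Min ((\<lambda>i. 1 - z \<bullet> i) ` Basis)"
  have "e > 0"
    using z by (auto simp: e_def half_open_cube_def)
  then obtain n where n: "inverse (real (Suc n)) < e"
    using reals_Archimedean by blast
  have "z \<bullet> i \<le> 1 - 1 / real (Suc n)" if "i \<in> Basis" for i
  proof -
    have "e \<le> 1 - z \<bullet> i"
      unfolding e_def using that by (intro Min_le) auto
    with n show ?thesis
      by (simp add: inverse_eq_divide)
  qed
  then show "z \<in> (\<Union>n. cbox 0 ((1 - 1 / real (Suc n)) *\<^sub>R One))"
    using z by (intro UN_I [of n]) (auto simp: mem_box half_open_cube_def)
next
  fix z :: 'e assume "z \<in> (\<Union>n. cbox 0 ((1 - 1 / real (Suc n)) *\<^sub>R One))"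
  then obtain n where n: "\<forall>i\<in>Basis. 0 \<le> z \<bullet> i \<and> z \<bullet> i \<le> 1 - 1 / real (Suc n)"
    by (auto simp: mem_box)
  have "1 - 1 / real (Suc n) < 1"
    by simp
  with n show "z \<in> half_open_cube"
    unfolding half_open_cube_def by (auto intro: le_less_trans)
qed

lemma half_open_cube_Pair: "(z, t) \<in> half_open_cube \<longleftrightarrow> z \<in> half_open_cube \<and> 0 \<le> t \<and> t < 1" for t :: real
  by (auto simp: half_open_cube_def Basis_prod_def)

lemma half_open_cube_halve:
  assumes "z \<in> half_open_cube" "i \<in> Basis"
  shows "z /\<^sub>R 2 \<in> half_open_cube" "(i + z) /\<^sub>R 2 \<in> half_open_cube"
proof -
  have "0 \<le> z \<bullet> j / 2" "z \<bullet> j / 2 < 1" "0 \<le> (i \<bullet> j + z \<bullet> j) / 2" "(i \<bullet> j + z \<bullet> j) / 2 < 1" if "j \<in> Basis" for j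
    using assms that by (auto simp: half_open_cube_def inner_Basis)
  then show "z /\<^sub>R 2 \<in> half_open_cube" "(i + z) /\<^sub>R 2 \<in> half_open_cube"
    by (auto simp: half_open_cube_def inner_add_left field_simps)
qed

lemma half_open_cube_subset: "half_open_cube \<subseteq> cbox 0 One"
  by (auto simp: half_open_cube_def mem_box less_imp_le)

text \<open>
  A group \<open>E \<rtimes> \<real>\<close>, possibly with \<open>\<real>\<close> replaced by the circle, in which integer times act on
  \<open>E\<close> by integer matrices has a lattice; conjugation by \<open>b\<close> rescales \<open>E\<close>.
\<close>

theorem (in triangular_group) not_reproducing_chart:
  fixes c :: "'e::euclidean_space \<Rightarrow> real \<Rightarrow> real^(2 + 2)^(2 + 2)"
  assumes range: "G = {c z t | z t. True}" and one: "c 0 0 = mat 1"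
    and mult: "\<And>z t z' t'. c z t ** c z' t' = c (z + \<alpha> t z') (t + t')"
    and inj: "\<And>z t z' t'. c z t = c z' t' \<Longrightarrow> z = z' \<and> t - t' \<in> \<int>"
    and cont: "continuous_on UNIV (\<lambda>(z, t). c z t)"
    and integral: "\<And>z. z \<in> integer_points \<Longrightarrow> \<alpha> 1 z \<in> integer_points"
      "\<And>z. z \<in> integer_points \<Longrightarrow> \<alpha> (- 1) z \<in> integer_points"
    and b: "b \<in> triangular" "\<And>z t. b ** c z t ** matrix_inv b = c (z /\<^sub>R 2) t"
  shows "\<not> reproducing G"
proof -
  have cG [simp]: "c z t \<in> G" for z t
    using range by blast
  have \<alpha>0 [simp]: "\<alpha> 0 z = z" for z
    using mult [of 0 0 z 0] inj [of "\<alpha> 0 z" 0 z 0] by (simp add: one)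
  have \<alpha>_0 [simp]: "\<alpha> t 0 = 0" for t
    using mult [of 0 t 0 0] inj [of "\<alpha> t 0" t 0 t] by (simp add: one)
  have \<alpha>_\<alpha>: "\<alpha> s (\<alpha> t z) = \<alpha> (s + t) z" for s t z
    using matrix_mul_assoc [of "c 0 s" "c 0 t" "c z 0"] inj [of "\<alpha> s (\<alpha> t z)" "s + t" "\<alpha> (s + t) z" "s + t"]
    by (simp add: mult)
  have \<alpha>_minus: "\<alpha> t (- z) = - \<alpha> t z" for t z
    using matrix_mul_assoc [of "c 0 t" "c z 0" "c (- z) 0"] inj [of 0 t "\<alpha> t z + \<alpha> t (- z)" t]
    by (simp add: mult eq_neg_iff_add_eq_0 add.commute)
  have inv_c: "matrix_inv (c z t) = c (- \<alpha> (- t) z) (- t)" for z t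
    by (rule matrix_inv_unique) (simp add: mult \<alpha>_minus \<alpha>_\<alpha> one)
  have nat: "\<alpha> (real n) z \<in> integer_points \<and> \<alpha> (- real n) z \<in> integer_points" if "z \<in> integer_points" for n z
  proof (induction n)
    case (Suc n)
    have "\<alpha> (real (Suc n)) z = \<alpha> 1 (\<alpha> (real n) z)" "\<alpha> (- real (Suc n)) z = \<alpha> (- 1) (\<alpha> (- real n) z)"
      by (simp_all add: \<alpha>_\<alpha> add.commute)
    with Suc integral show ?case
      by simp
  qed (use that in simp)
  have int: "\<alpha> (of_int n) z \<in> integer_points" if "z \<in> integer_points" for n z
    using nat [OF that, of "nat \<bar>n\<bar>"] by (cases "n \<ge> 0") (auto simp: abs_if)
  define \<Gamma> where "\<Gamma> = (\<lambda>(l, n). c l (of_int n)) ` (integer_points \<times> (UNIV :: int set))"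
  define D where "D = (\<lambda>(z, t). c z t) ` half_open_cube"
  let ?K = "(\<lambda>(z, t). c z t) ` cbox 0 One"
  have D_iff: "g \<in> D \<longleftrightarrow> (\<exists>z t. g = c z t \<and> z \<in> half_open_cube \<and> 0 \<le> t \<and> t < 1)" for g
    unfolding D_def by (auto simp: half_open_cube_Pair image_iff Bex_def)
  have comp: "compact ((\<lambda>(z, t). c z t) ` cbox 0 p)" for p
    by (intro compact_continuous_image continuous_on_subset [OF cont] compact_cbox) auto
  obtain i :: 'e where i: "i \<in> Basis"
    using nonempty_Basis by blast
  show ?thesis
  proof (rule not_reproducing_if_expanding_lattice [of \<Gamma> D ?K b "c i 0"])
    show "countable \<Gamma>"
      unfolding \<Gamma>_def by (intro countable_image countable_SIGMA countable_integer_points) auto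
    show "\<Gamma> \<subseteq> G"
      by (auto simp: \<Gamma>_def)
    show "matrix_inv a \<in> \<Gamma>" if "a \<in> \<Gamma>" for a
    proof -
      obtain l n where l: "l \<in> integer_points" and a: "a = c l (of_int n)"
        using \<open>a \<in> \<Gamma>\<close> by (auto simp: \<Gamma>_def)
      have "matrix_inv a = c (- \<alpha> (of_int (- n)) l) (of_int (- n))"
        by (simp add: a inv_c)
      then show ?thesis
        unfolding \<Gamma>_def using int [OF l, of "- n"] integer_points_minus 
        by (intro image_eqI [of _ _ "(- \<alpha> (of_int (- n)) l, - n)"]) auto
    qed
    have "D = (\<Union>n. (\<lambda>(z, t). c z t) ` cbox 0 ((1 - 1 / real (Suc n)) *\<^sub>R One))"
      unfolding D_def half_open_cube_Union by (rule image_UN)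
    then show "D \<in> sets borel"
      using borel_compact [OF comp] by simp
    show "compact ?K"
      by (rule comp)
    show "D \<subseteq> ?K"
      unfolding D_def by (intro image_mono half_open_cube_subset)
    show "?K \<subseteq> G"
      by auto
    show "b \<in> triangular"
      by (rule b)
    show "b ** g ** matrix_inv b \<in> G" if "g \<in> G" for g
      using that range b(2) by auto
    show "matrix_inv b ** g ** b \<in> G" if "g \<in> G" for g
    proof -
      obtain z t where "g = c z t"
        using \<open>g \<in> G\<close> range by auto
      then have "g = b ** c (2 *\<^sub>R z) t ** matrix_inv b"
        by (simp add: b(2))
      then have "matrix_inv b ** g ** b = c (2 *\<^sub>R z) t"
        using b(1) by (simp flip: matrix_mul_assoc) (simp add: triangular_inv)
      then show ?thesis
        by simp
    qed
    show "c i 0 \<in> G"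
      by simp
    show "b ** d ** matrix_inv b \<in> D" if "d \<in> D" for d
      using that half_open_cube_halve(1) [OF _ i] by (auto simp: D_iff b(2)) blast
    show "b ** (c i 0 ** d) ** matrix_inv b \<in> D" if "d \<in> D" for d
      using that half_open_cube_halve(2) [OF _ i] by (auto simp: D_iff b(2) mult) blast
    show "c i 0 ** d \<notin> D" if "d \<in> D" for d
    proof
      obtain z t where d: "d = c z t" and z: "z \<in> half_open_cube"
        using \<open>d \<in> D\<close> by (auto simp: D_iff)
      assume "c i 0 ** d \<in> D"
      then have "i + z \<in> half_open_cube"
        using inj by (auto simp: d D_iff mult)
      moreover have "0 \<in> integer_points" "i \<in> integer_points"
        using i by (auto simp: integer_points_def inner_Basis)
      ultimately have "i = 0"
        using integer_translate_to_cube_unique [of i 0 z] z by simp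
      with i show False
        by simp
    qed
    show "\<exists>!a. a \<in> \<Gamma> \<and> a ** g \<in> D" if "g \<in> G" for g
    proof -
      obtain z t where g: "g = c z t"
        using \<open>g \<in> G\<close> range by auto
      let ?n = "- \<lfloor>t\<rfloor>"
      obtain l where l: "l \<in> integer_points" "l + \<alpha> (of_int ?n) z \<in> half_open_cube"
        using integer_translate_to_cube by blast
      have "0 \<le> of_int ?n + t" "of_int ?n + t < 1"
        by simp_all linarith
      then have ex: "c l (of_int ?n) ** g \<in> D"
        unfolding D_iff using l(2)
        by (intro exI [of _ "l + \<alpha> (of_int ?n) z"] exI [of _ "of_int ?n + t"]) (simp add: g mult)
      have ex': "c l (of_int ?n) \<in> \<Gamma>"
        unfolding \<Gamma>_def using l(1) by (intro image_eqI [of _ _ "(l, ?n)"]) auto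
      have "a = a'" if a_in: "a \<in> \<Gamma>" "a ** g \<in> D" "a' \<in> \<Gamma>" "a' ** g \<in> D" for a a'
      proof -
        obtain l n l' n' where l: "l \<in> integer_points" "l' \<in> integer_points"
          and a: "a = c l (of_int n)" "a' = c l' (of_int n')"
          using a_in by (auto simp: \<Gamma>_def)
        obtain w s w' s' where w: "w \<in> half_open_cube" "w' \<in> half_open_cube"
          and s: "0 \<le> s" "s < 1" "0 \<le> s'" "s' < 1"
          and eq: "c (l + \<alpha> (of_int n) z) (of_int n + t) = c w s" "c (l' + \<alpha> (of_int n') z) (of_int n' + t) = c w' s'"
          using a_in by (auto simp: D_iff a g mult)
        have w_eq: "w = l + \<alpha> (of_int n) z" "w' = l' + \<alpha> (of_int n') z"
          and Z: "of_int n + t - s \<in> \<int>" "of_int n' + t - s' \<in> \<int>"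
          using inj [OF eq(1)] inj [OF eq(2)] by auto
        have "s - s' = (of_int n' + t - s') - (of_int n + t - s) + of_int (n - n')"
          by simp
        also have "\<dots> \<in> \<int>"
          by (rule Ints_add [OF Ints_diff [OF Z(2) Z(1)] Ints_of_int])
        finally have "s = s'"
          using s by (rule in_Ints_diff_unique)
        have \<alpha>_eq: "\<alpha> r x = \<alpha> s x" if "c v r = c v s" for v r s x
          using that mult [of v r x 0] mult [of v s x 0] inj [of "v + \<alpha> r x" r "v + \<alpha> s x" s] by simp
        have "\<alpha> (of_int n + t) x = \<alpha> (of_int n' + t) x" for x
          using eq \<alpha>_eq [of w "of_int n + t" s x] \<alpha>_eq [of w' "of_int n' + t" s' x]
          by (simp add: w_eq \<open>s = s'\<close>)
        from this [of "\<alpha> (- t) z"] have "\<alpha> (of_int n) z = \<alpha> (of_int n') z"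
          by (simp add: \<alpha>_\<alpha>)
        then have "l = l'"
          using w l w_eq by (intro integer_translate_to_cube_unique [of l l' "\<alpha> (of_int n) z"]) auto
        with \<open>\<alpha> (of_int n) z = \<alpha> (of_int n') z\<close> have "w = w'"
          by (simp add: w_eq)
        with eq \<open>s = s'\<close> have "a ** g = a' ** g"
          by (simp add: a g mult)
        then have "a ** g ** matrix_inv g = a' ** g ** matrix_inv g"
          by simp
        then show ?thesis
          using \<open>g \<in> G\<close> by simp
      qed
      with ex ex' show ?thesis
        by blast
    qed
  qed
qed

lemma triangular_group_semidirect:
  assumes H: "subgroup H GL" and S: "subspace S"
    and inv: "\<And>h \<sigma>. h \<in> H \<Longrightarrow> \<sigma> \<in> S \<Longrightarrow> transpose h ** \<sigma> ** h \<in> S"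
  shows "triangular_group (semidirect S H)"
proof
  note HD = subgroup_GL_D [OF H]
  show "semidirect S H \<subseteq> triangular"
    using HD by (auto simp: semidirect_tri intro!: tri_in_triangular)
  show "mat 1 \<in> semidirect S H"
    using HD(3) subspace_0 [OF S] by (auto simp: semidirect_tri simp flip: tri_one)
next
  fix a b assume "a \<in> semidirect S H" "b \<in> semidirect S H"
  then obtain \<sigma> h \<sigma>' h' where *: "a = tri \<sigma> h" "b = tri \<sigma>' h'" "\<sigma> \<in> S" "\<sigma>' \<in> S" "h \<in> H" "h' \<in> H"
    by (auto simp: semidirect_tri)
  moreover have "transpose (matrix_inv h) ** \<sigma>' ** matrix_inv h \<in> S"
    using *(4,5) by (intro inv subgroup_GL_D(2) [OF H])
  ultimately have "\<sigma> + transpose (matrix_inv h) ** \<sigma>' ** matrix_inv h \<in> S" "h ** h' \<in> H"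
    "a ** b = tri (\<sigma> + transpose (matrix_inv h) ** \<sigma>' ** matrix_inv h) (h ** h')"
    using subspace_add [OF S] subgroup_GL_D [OF H] by (auto simp: tri_mult)
  then show "a ** b \<in> semidirect S H"
    unfolding semidirect_tri by blast
next
  fix a assume "a \<in> semidirect S H"
  then obtain \<sigma> h where *: "a = tri \<sigma> h" "\<sigma> \<in> S" "h \<in> H"
    by (auto simp: semidirect_tri)
  then have "- (transpose h ** \<sigma> ** h) \<in> S" "matrix_inv h \<in> H"
    "matrix_inv a = tri (- (transpose h ** \<sigma> ** h)) (matrix_inv h)"
    using subspace_neg [OF S] subgroup_GL_D [OF H] inv by (auto simp: matrix_inv_tri)
  then show "matrix_inv a \<in> semidirect S H"
    unfolding semidirect_tri by blast
qed

lemma class_E2I: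
  assumes "subgroup H GL" "closed C" "H = {h. invertible h} \<inter> C" "connected H" "H \<noteq> {mat 1}"
    and "subspace S" "\<And>\<sigma>. \<sigma> \<in> S \<Longrightarrow> transpose \<sigma> = \<sigma>" "S \<noteq> {0}"
    and "\<And>h \<sigma>. h \<in> H \<Longrightarrow> \<sigma> \<in> S \<Longrightarrow> transpose h ** \<sigma> ** h \<in> S"
  shows "semidirect S H \<in> class_E2"
proof -
  have H: "lie_subgroup H GL"
    using assms(1-3) by (rule lie_subgroup_GL)
  moreover have S: "S \<subseteq> {\<sigma>. transpose \<sigma> = \<sigma>}"
    using assms(7) by blast
  moreover have "lie_subgroup (semidirect S H) Sp"
    using H assms(6) S assms(9) by (rule lie_subgroup_semidirect)
  ultimately show ?thesis
    unfolding class_E2_def using assms by blast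
qed

lemma continuous_on_block [continuous_intros]:
  fixes A :: "'a::topological_space \<Rightarrow> real^'n::finite^'n"
  assumes "continuous_on X A" "continuous_on X B" "continuous_on X C" "continuous_on X D"
  shows "continuous_on X (\<lambda>x. block (A x) (B x) (C x) (D x))"
  unfolding block_def
proof (intro continuous_on_vec_lambda)
  fix i j :: "'n + 'n"
  show "continuous_on X (\<lambda>x. case (i, j) of (Inl k, Inl l) \<Rightarrow> A x $ k $ l | (Inl k, Inr l) \<Rightarrow> B x $ k $ l
      | (Inr k, Inl l) \<Rightarrow> C x $ k $ l | (Inr k, Inr l) \<Rightarrow> D x $ k $ l)"
    by (cases i; cases j) (auto intro!: continuous_intros assms)
qed

lemma continuous_on_mat2 [continuous_intros]:
  assumes "continuous_on X a" "continuous_on X b" "continuous_on X c" "continuous_on X d"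
  shows "continuous_on X (\<lambda>x. mat2 (a x) (b x) (c x) (d x))"
proof -
  have "mat2 p q r s = (\<chi> i j. if i = 1 then if j = 1 then p else q else if j = 1 then r else s)" for p q r s
    by (simp add: vec_eq_iff forall_2)
  moreover have "continuous_on X (\<lambda>x. if i = 1 then if j = 1 then a x else b x else if j = 1 then c x else d x)"
    for i j :: 2
    by (cases "i = 1"; cases "j = 1") (simp_all add: assms)
  ultimately show ?thesis
    by (simp add: continuous_on_vec_lambda)
qed

lemma one_parameter_E2_not_reproducing:
  fixes h :: "real \<Rightarrow> real^2^2" and L :: "'e::euclidean_space \<Rightarrow> real^2^2"
  assumes H: "H = range h" "closed C" "H = {A. invertible A} \<inter> C"
    and h: "\<And>s t. h (s + t) = h s ** h t" "continuous_on UNIV h" "h r \<noteq> mat 1"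
      "\<And>s t. h s = h t \<Longrightarrow> s - t \<in> \<int>"
    and L: "S = range L" "linear L" "inj L" "\<And>z. transpose (L z) = L z"
    and act: "\<And>t z. transpose (h t) ** L (\<alpha> t z) ** h t = L z"
    and integral: "\<And>z. z \<in> integer_points \<Longrightarrow> \<alpha> 1 z \<in> integer_points"
      "\<And>z. z \<in> integer_points \<Longrightarrow> \<alpha> (- 1) z \<in> integer_points"
  shows "semidirect S H \<in> class_E2 \<and> \<not> reproducing (semidirect S H)"
proof
  have inv [simp]: "invertible (h t)" for t
    using H by blast
  have "h 0 = matrix_inv (h 0) ** (h 0 ** h 0)"
    by (simp add: matrix_mul_assoc matrix_inv_left)
  also have "\<dots> = mat 1"
    by (simp add: matrix_inv_left flip: h(1))
  finally have h0: "h 0 = mat 1" .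
  have h_inv: "matrix_inv (h t) = h (- t)" for t
    by (rule matrix_inv_unique) (simp add: h0 flip: h(1))
  have act': "transpose (h (- t)) ** L z ** h (- t) = L (\<alpha> t z)" for t z
  proof -
    have "transpose (h (- t)) ** L z ** h (- t) =
        transpose (h t ** h (- t)) ** L (\<alpha> t z) ** (h t ** h (- t))"
      by (simp only: act [of t z, symmetric] matrix_transpose_mul matrix_mul_assoc)
    then show ?thesis
      by (simp add: h0 flip: h(1))
  qed
  have S_inv: "transpose g ** \<sigma> ** g \<in> S" if "g \<in> H" "\<sigma> \<in> S" for g \<sigma>
    using that act' [of "- t" for t] by (auto simp: H(1) L(1))
  have sub: "subgroup H GL"
    by (rule subgroup_GL) (auto simp: H(1) h_inv h0 [symmetric] h(1) [symmetric])
  have S: "subspace S"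
    unfolding L(1) using L(2) by (rule linear_subspace_image [OF _ subspace_UNIV])
  interpret triangular_group "semidirect S H"
    using sub S S_inv by (rule triangular_group_semidirect)
  obtain i :: 'e where "i \<in> Basis"
    using nonempty_Basis by blast
  then have "L i \<noteq> L 0"
    using L(3) by (auto simp: inj_eq)
  then have "S \<noteq> {0}"
    unfolding L(1) by (metis rangeI singletonD)
  moreover have "connected H"
    unfolding H(1) by (rule connected_continuous_image [OF h(2) connected_UNIV])
  moreover have "H \<noteq> {mat 1}"
    using h(3) H(1) by blast
  ultimately show "semidirect S H \<in> class_E2"
    using sub H(2,3) S L(4) S_inv by (intro class_E2I [of H C S]) (auto simp: L(1))
  let ?c = "\<lambda>z t. tri (L z) (h t)"
  let ?b = "tri 0 (mat2 (sqrt 2) 0 0 (sqrt 2)) :: real^(2+2)^(2+2)"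
  show "\<not> reproducing (semidirect S H)"
  proof (rule not_reproducing_chart [where c = ?c and \<alpha> = \<alpha> and b = ?b, OF _ _ _ _ _ integral])
    show "semidirect S H = {?c z t | z t. True}"
      by (auto simp: semidirect_tri H(1) L(1))
    show "?c 0 0 = mat 1"
      by (simp add: h0 tri_one linear_0 [OF L(2)])
    show "?c z t ** ?c z' t' = ?c (z + \<alpha> t z') (t + t')" for z t z' t'
      by (simp add: tri_mult h_inv act' linear_add [OF L(2)] h(1))
    show "z = z' \<and> t - t' \<in> \<int>" if "?c z t = ?c z' t'" for z t z' t'
      using that h(4) L(3) by (auto simp: tri_eq_iff inj_eq)
    have "continuous_on UNIV L"
      using L(2) by (rule linear_continuous_on [OF linear_conv_bounded_linear [THEN iffD1]])
    then have "continuous_on UNIV (\<lambda>p. L (fst p))" "continuous_on UNIV (\<lambda>p. h (snd p))"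
        "continuous_on UNIV (\<lambda>p. h (- snd p))"
      using h(2) by (auto intro!: continuous_intros intro: continuous_on_compose2)
    then show "continuous_on UNIV (\<lambda>(z, t). ?c z t)"
      unfolding tri_def h_inv case_prod_beta by (intro continuous_intros)
    show b: "?b \<in> triangular"
      by (rule tri_in_triangular) simp
    show "?b ** ?c z t ** matrix_inv ?b = ?c (z /\<^sub>R 2) t" for z t
    proof -
      obtain p q r s where "h t = mat2 p q r s"
        by (rule mat2_cases)
      moreover obtain p' q' r' s' where "L z = mat2 p' q' r' s'"
        by (rule mat2_cases)
      moreover have "matrix_inv ?b = tri 0 (mat2 (sqrt 2 / 2) 0 0 (sqrt 2 / 2))"
        by (simp add: matrix_inv_tri matrix_inv_mat2 flip: zero_mat2)
      moreover have "?b ** ?c z t ** matrix_inv ?b = matrix_inv (matrix_inv ?b) ** ?c z t ** matrix_inv ?b"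
        using b by (simp add: triangular_inv)
      ultimately show ?thesis
        using inv [of t] by (simp add: tri_conj matrix_inv_mat2 [OF refl] linear_cmul [OF L(2)] field_simps)
    qed
  qed
qed

lemma integer_points_real [simp]: "(z :: real) \<in> integer_points \<longleftrightarrow> z \<in> \<int>"
  by (simp add: integer_points_def)

lemma integer_points_real2 [simp]: "(z :: real \<times> real) \<in> integer_points \<longleftrightarrow> fst z \<in> \<int> \<and> snd z \<in> \<int>"
  by (auto simp: integer_points_def Basis_prod_def inner_prod_def)

subsection \<open>The ten groups of the statement\<close>

lemma set_mat2_eqI:
  assumes "\<And>a b c d. mat2 a b c d \<in> H \<longleftrightarrow> mat2 a b c d \<in> K"
  shows "H = K"
  using assms by (metis mat2_cases subsetI subset_antisym)

lemma Collect_pairs_eq_range: "{F u v | u v. True} = range (\<lambda>z. F (fst z) (snd z))"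
proof (intro equalityI subsetI)
  fix x assume "x \<in> {F u v | u v. True}"
  then obtain u v where "x = F u v"
    by blast
  then show "x \<in> range (\<lambda>z. F (fst z) (snd z))"
    by (intro range_eqI [of _ _ "(u, v)"]) simp
qed blast

lemma rot_add: "rot (s + t) = rot s ** rot t"
  by (simp add: rot_def cos_add sin_add)

lemma hyp_add: "hyp (s + t) = hyp s ** hyp t"
  by (simp add: hyp_def cosh_add sinh_add)

definition rot_closed :: "(real^2^2) set" where
  "rot_closed = {A. A $ 1 $ 1 = A $ 2 $ 2 \<and> A $ 2 $ 1 = - (A $ 1 $ 2) \<and> (A $ 1 $ 1)\<^sup>2 + (A $ 1 $ 2)\<^sup>2 = 1}"

lemma rot_set:
  "closed rot_closed" "{rot t | t. True} = {A. invertible A} \<inter> rot_closed"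
  "{rot t | t. True} = range (\<lambda>t. rot (2 * pi * t))"
proof -
  show "closed rot_closed"
    unfolding rot_closed_def by (intro closed_Collect_conj closed_Collect_eq continuous_intros)
  show "{rot t | t. True} = {A. invertible A} \<inter> rot_closed"
  proof (rule set_mat2_eqI)
    fix a b c d :: real
    have "(\<exists>t. a = cos t \<and> b = sin t) \<longleftrightarrow> a\<^sup>2 + b\<^sup>2 = 1"
      using sincos_total_2pi [of a b] by (metis sin_cos_squared_add2)
    moreover have "mat2 a b c d \<in> {rot t | t. True} \<longleftrightarrow> (\<exists>t. a = cos t \<and> b = sin t) \<and> c = - b \<and> d = a"
      by (auto simp: rot_def)
    moreover have "mat2 a b c d \<in> {A. invertible A} \<inter> rot_closed \<longleftrightarrow> a\<^sup>2 + b\<^sup>2 = 1 \<and> c = - b \<and> d = a"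
      by (auto simp: rot_closed_def power2_eq_square)
    ultimately show "mat2 a b c d \<in> {rot t | t. True} \<longleftrightarrow> mat2 a b c d \<in> {A. invertible A} \<inter> rot_closed"
      by simp
  qed
  show "{rot t | t. True} = range (\<lambda>t. rot (2 * pi * t))"
  proof (intro equalityI subsetI)
    fix A assume "A \<in> {rot t | t. True}"
    then obtain t where "A = rot t" by blast
    then show "A \<in> range (\<lambda>t. rot (2 * pi * t))"
      by (intro range_eqI [of _ _ "t / (2 * pi)"]) simp
  qed auto
qed

lemma rot_period:
  assumes "rot (2 * pi * s) = rot (2 * pi * t)"
  shows "s - t \<in> \<int>"
proof -
  obtain n :: int where "2 * pi * s = 2 * pi * t + 2 * pi * n"
    using assms sin_cos_eq_iff [of "2 * pi * s" "2 * pi * t"] by (auto simp: rot_def)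
  then have "2 * pi * (s - t) = 2 * pi * n"
    by (simp add: algebra_simps)
  then have "s - t = of_int n"
    by simp
  then show ?thesis
    by simp
qed

lemma continuous_on_rot: "continuous_on UNIV (\<lambda>t. rot (2 * pi * t))"
  unfolding rot_def by (intro continuous_intros)

lemma rot_nontrivial: "rot (2 * pi * (1 / 2)) \<noteq> mat 1"
  by (simp add: rot_def mat_1_mat2)

lemma rot_conj:
  fixes C S u v :: real
  assumes "C * C + S * S = 1"
  shows "mat2 C (- S) S C ** mat2 ((C * C - S * S) * u + 2 * S * C * v) ((C * C - S * S) * v - 2 * S * C * u)
      ((C * C - S * S) * v - 2 * S * C * u) (- ((C * C - S * S) * u + 2 * S * C * v)) ** mat2 C S (- S) C =
    mat2 u v v (- u)"
proof -
  have "(C * C + S * S) * (C * C + S * S) * x = x" for x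
    by (simp add: assms)
  from this [of u] this [of v] show ?thesis
    by (simp add: algebra_simps)
qed

definition hyp_closed :: "(real^2^2) set" where
  "hyp_closed = {A. A $ 1 $ 1 = A $ 2 $ 2 \<and> A $ 2 $ 1 = A $ 1 $ 2 \<and> (A $ 1 $ 1)\<^sup>2 = (A $ 1 $ 2)\<^sup>2 + 1 \<and> 0 \<le> A $ 1 $ 1}"

lemma hyp_set:
  "closed hyp_closed" "{hyp t | t. True} = {A. invertible A} \<inter> hyp_closed"
proof -
  show "closed hyp_closed"
    unfolding hyp_closed_def by (intro closed_Collect_conj closed_Collect_eq closed_Collect_le continuous_intros)
  show "{hyp t | t. True} = {A. invertible A} \<inter> hyp_closed"
  proof (rule set_mat2_eqI)
    fix a b c d :: real
    have "a = cosh (arsinh b)" if "a\<^sup>2 = b\<^sup>2 + 1" "0 \<le> a"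
      using that cosh_square_eq [of "arsinh b"] by (intro power2_eq_imp_eq [of a]) (simp_all add: cosh_real_nonneg)
    then have "(\<exists>t. a = cosh t \<and> b = sinh t) \<longleftrightarrow> a\<^sup>2 = b\<^sup>2 + 1 \<and> 0 \<le> a"
      using cosh_square_eq cosh_real_nonneg by (metis sinh_arsinh_real)
    moreover have "a * a - b * b \<noteq> 0" if "a\<^sup>2 = b\<^sup>2 + 1"
      using that by (simp add: power2_eq_square)
    ultimately show "mat2 a b c d \<in> {hyp t | t. True} \<longleftrightarrow> mat2 a b c d \<in> {A. invertible A} \<inter> hyp_closed"
      by (auto simp: hyp_def hyp_closed_def)
  qed
qed

lemma hyp_range: "k \<noteq> 0 \<Longrightarrow> {hyp t | t. True} = range (\<lambda>t. hyp (k * t))"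
proof (intro equalityI subsetI)
  fix A assume "k \<noteq> 0" "A \<in> {hyp t | t. True}"
  then obtain t where "A = hyp t" by blast
  with \<open>k \<noteq> 0\<close> show "A \<in> range (\<lambda>t. hyp (k * t))"
    by (intro range_eqI [of _ _ "t / k"]) simp
qed auto

lemma hyp_inj: "hyp s = hyp t \<Longrightarrow> s = t"
  by (auto simp: hyp_def)

lemma continuous_on_hyp: "continuous_on UNIV (\<lambda>t. hyp (k * t))"
  unfolding hyp_def by (intro continuous_intros)

lemma hyp_0: "hyp 0 = mat 1"
  by (simp add: hyp_def mat_1_mat2)

definition sol_time :: real where "sol_time = arsinh (sqrt 3)"

lemma sol_time: "sinh sol_time = sqrt 3" "cosh sol_time = 2" "sol_time \<noteq> 0"
proof -
  show "sinh sol_time = sqrt 3"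
    by (simp add: sol_time_def)
  then have "(cosh sol_time)\<^sup>2 = 2\<^sup>2"
    by (simp add: cosh_square_eq)
  then show "cosh sol_time = 2"
    by (rule power2_eq_imp_eq) (simp_all add: cosh_real_nonneg)
  then show "sol_time \<noteq> 0"
    by auto
qed

text \<open>
  The time is normalised so that the hyperbolic flow is given at time one by the integer
  matrix with rows \<open>(2, -3)\<close> and \<open>(-1, 2)\<close>.
\<close>

definition sol_action :: "real \<Rightarrow> real \<times> real \<Rightarrow> real \<times> real" where
  "sol_action t z =
     (cosh (sol_time * t) * fst z - sqrt 3 * sinh (sol_time * t) * snd z,
      cosh (sol_time * t) * snd z - sinh (sol_time * t) * fst z / sqrt 3)"

lemma sol_action_integral:
  assumes "z \<in> integer_points"
  shows "sol_action 1 z \<in> integer_points" "sol_action (- 1) z \<in> integer_points"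
  using assms by (auto simp: sol_action_def sol_time intro!: Ints_add Ints_diff Ints_mult)

lemma exp_range: "(\<exists>t. a = exp t) \<longleftrightarrow> 0 < a" for a :: real
  by (metis exp_gt_zero exp_ln)

lemma matrix_inv_shear_dilation:
  fixes y s :: real
  shows "matrix_inv (mat2 (exp s) 0 (y * exp s) (exp (3 * s))) =
    mat2 (exp (- s)) 0 (- y * exp (- (3 * s))) (exp (- (3 * s)))"
  by (rule matrix_inv_unique) (simp add: mat_1_mat2 mult.assoc flip: exp_add)

lemma shear_dilation_mult:
  fixes x y s x' y' t :: real
  shows "tri (mat2 x 0 0 0) (mat2 (exp s) 0 (y * exp s) (exp (3 * s))) **
      tri (mat2 x' 0 0 0) (mat2 (exp t) 0 (y' * exp t) (exp (3 * t))) =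
    tri (mat2 (x + exp (- (2 * s)) * x') 0 0 0)
      (mat2 (exp (s + t)) 0 ((y + exp (2 * s) * y') * exp (s + t)) (exp (3 * (s + t))))"
proof -
  have e: "exp (2 * r) = exp r * exp r" "exp (3 * r) = exp r * exp r * exp r"
    "exp (r * 2) = exp r * exp r" "exp (r * 3) = exp r * exp r * exp r" for r :: real
    by (simp_all flip: exp_add)
  have "exp (- (2 * s)) = exp (- s) * exp (- s)"
    by (simp flip: exp_add)
  then show ?thesis
    by (simp add: tri_mult matrix_inv_shear_dilation) (simp add: e exp_add algebra_simps)
qed

lemma Sigma3_perp_E2:
  assumes sub: "subgroup H GL" and C: "closed C" "H = {A. invertible A} \<inter> C" and conn: "connected H"
    and H: "H \<subseteq> {mat2 p q 0 r | p q r. p > 0 \<and> r \<noteq> 0}" "mat2 1 1 0 1 \<in> H" "mat2 2 0 0 1 \<in> H"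
  shows "semidirect Sigma3_perp H \<in> class_E2 \<and> \<not> reproducing (semidirect Sigma3_perp H)"
proof
  have S: "subspace Sigma3_perp"
    by (auto simp: subspace_def Sigma3_perp_def zero_mat2)
  have inv: "transpose h ** \<sigma> ** h \<in> Sigma3_perp" if "h \<in> H" "\<sigma> \<in> Sigma3_perp" for h \<sigma>
  proof -
    obtain p q r where "h = mat2 p q 0 r"
      using \<open>h \<in> H\<close> H(1) by blast
    then show ?thesis
      using \<open>\<sigma> \<in> Sigma3_perp\<close> by (auto simp: Sigma3_perp_def)
  qed
  show "semidirect Sigma3_perp H \<in> class_E2"
  proof (rule class_E2I [OF sub C conn _ S _ _ inv])
    show "H \<noteq> {mat 1}"
      using H(2) by (auto simp: mat_1_mat2)
    have "mat2 0 1 1 0 \<in> Sigma3_perp"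
      by (auto simp: Sigma3_perp_def)
    moreover have "mat2 0 1 1 0 \<noteq> 0"
      by (simp add: zero_mat2)
    ultimately show "Sigma3_perp \<noteq> {0}"
      by blast
  qed (auto simp: Sigma3_perp_def)
  interpret triangular_group "semidirect Sigma3_perp H"
    using sub S inv by (rule triangular_group_semidirect)
  show "\<not> reproducing (semidirect Sigma3_perp H)"
  proof (rule not_reproducing_if_dilation)
    have mem: "tri \<sigma> h \<in> semidirect Sigma3_perp H" if "\<sigma> \<in> Sigma3_perp" "h \<in> H" for \<sigma> h
      using that by (auto simp: semidirect_tri)
    show "tri (mat2 0 v v u) (mat 1) \<in> semidirect Sigma3_perp H" for u v
      using subgroup_GL_D(3) [OF sub] by (intro mem) (auto simp: Sigma3_perp_def)
    show "tri 0 (mat2 1 1 0 1) \<in> semidirect Sigma3_perp H" "tri 0 (mat2 2 0 0 1) \<in> semidirect Sigma3_perp H"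
      using H subspace_0 [OF S] by (intro mem; simp)+
    show "upper_left g $ 1 $ 1 > 0 \<and> upper_left g $ 2 $ 1 = 0" if "g \<in> semidirect Sigma3_perp H" for g
    proof -
      obtain \<sigma> h where g: "g = tri \<sigma> h" and "h \<in> H"
        using \<open>g \<in> _\<close> by (auto simp: semidirect_tri)
      then obtain p q r where "h = mat2 p q 0 r" "p > 0"
        using H(1) by blast
      then show ?thesis
        by (simp add: g tri_def)
    qed
  qed
qed

theorem proposition14:
  fixes G :: "(real^(2 + 2)^(2 + 2)) set"
  assumes "G \<in> {
     semidirect Sigma1 {rot t | t. True},
     semidirect Sigma2 {hyp t | t. True},
     semidirect Sigma3 {mat2 1 0 t 1 | t. True},
     semidirect Sigma3 {mat2 1 0 0 (exp t) | t. True},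
     semidirect Sigma3 {mat2 (exp t) 0 s (exp (3 * t)) | s t. True},
     semidirect Sigma1_perp {rot t | t. True},
     semidirect Sigma2_perp {hyp t | t. True},
     semidirect Sigma3_perp {mat2 1 t 0 1 | t. True},
     semidirect Sigma3_perp {mat2 t s 0 1 | s t. t > 0},
     semidirect Sigma3_perp {mat2 c b 0 a | a b c. a > 0 \<and> c > 0}}"
  shows "G \<in> class_E2 \<and> \<not> reproducing G"
proof -
  have Sigma1_rot:
    "semidirect Sigma1 {rot t | t. True} \<in> class_E2 \<and> \<not> reproducing (semidirect Sigma1 {rot t | t. True})"
  proof (rule one_parameter_E2_not_reproducing [where h = "\<lambda>t. rot (2 * pi * t)" and L = "\<lambda>u :: real. mat2 u 0 0 u"
        and \<alpha> = "\<lambda>t z. z" and r = "1 / 2", OF rot_set(3,1,2)])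
    fix t z :: real
    have "(cos t)\<^sup>2 * z + (sin t)\<^sup>2 * z = z" for t
      by (simp flip: distrib_right)
    then show "transpose (rot (2 * pi * t)) ** mat2 z 0 0 z ** rot (2 * pi * t) = mat2 z 0 0 z"
      by (simp add: rot_def power2_eq_square algebra_simps)
    show "linear (\<lambda>u :: real. mat2 u 0 0 u)"
      by (rule linearI) simp_all
    show "rot (2 * pi * (1 / 2)) \<noteq> mat 1"
      by (rule rot_nontrivial)
  qed (auto simp: Sigma1_def distrib_left rot_add inj_def intro: continuous_on_rot rot_period)
  have Sigma2_hyp:
    "semidirect Sigma2 {hyp t | t. True} \<in> class_E2 \<and> \<not> reproducing (semidirect Sigma2 {hyp t | t. True})"
  proof (rule one_parameter_E2_not_reproducing [where h = "\<lambda>t. hyp (1 * t)" and L = "\<lambda>u :: real. mat2 u 0 0 (- u)"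
        and \<alpha> = "\<lambda>t z. z" and r = 1, OF hyp_range hyp_set])
    fix t z :: real
    have "(cosh t)\<^sup>2 * z = (sinh t)\<^sup>2 * z + z" for t
      by (simp add: cosh_square_eq distrib_right)
    then show "transpose (hyp (1 * t)) ** mat2 z 0 0 (- z) ** hyp (1 * t) = mat2 z 0 0 (- z)"
      by (simp add: hyp_def power2_eq_square algebra_simps)
    show "hyp (1 * 1) \<noteq> mat 1"
      using hyp_inj [of 1 0] hyp_0 by auto
    show "linear (\<lambda>u :: real. mat2 u 0 0 (- u))"
      by (rule linearI) simp_all
  qed (auto simp: Sigma2_def hyp_add inj_def dest: hyp_inj intro!: continuous_on_hyp [of 1, simplified])
  have Sigma3_shear:
    "semidirect Sigma3 {mat2 1 0 t 1 | t. True} \<in> class_E2 \<and> \<not> reproducing (semidirect Sigma3 {mat2 1 0 t 1 | t. True})"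
  proof (rule one_parameter_E2_not_reproducing [where h = "\<lambda>t. mat2 1 0 t 1" and L = "\<lambda>u :: real. mat2 u 0 0 0"
        and \<alpha> = "\<lambda>t z. z" and r = 1 and C = "{A. A $ 1 $ 1 = 1 \<and> A $ 1 $ 2 = 0 \<and> A $ 2 $ 2 = 1}"])
    show "{mat2 1 0 t 1 | t. True} = {A. invertible A} \<inter> {A. A $ 1 $ 1 = 1 \<and> A $ 1 $ 2 = 0 \<and> A $ 2 $ 2 = 1}"
      by (rule set_mat2_eqI) auto
    show "closed {A :: real^2^2. A $ 1 $ 1 = 1 \<and> A $ 1 $ 2 = 0 \<and> A $ 2 $ 2 = 1}"
      by (intro closed_Collect_conj closed_Collect_eq continuous_intros)
    show "linear (\<lambda>u :: real. mat2 u 0 0 0)"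
      by (rule linearI) simp_all
    show "continuous_on UNIV (\<lambda>t. mat2 1 0 t 1)"
      by (intro continuous_intros)
  qed (auto simp: Sigma3_def inj_def mat_1_mat2)
  have Sigma3_dilation:
    "semidirect Sigma3 {mat2 1 0 0 (exp t) | t. True} \<in> class_E2 \<and>
      \<not> reproducing (semidirect Sigma3 {mat2 1 0 0 (exp t) | t. True})"
  proof (rule one_parameter_E2_not_reproducing [where h = "\<lambda>t. mat2 1 0 0 (exp t)" and L = "\<lambda>u :: real. mat2 u 0 0 0"
        and \<alpha> = "\<lambda>t z. z" and r = 1 and C = "{A. A $ 1 $ 1 = 1 \<and> A $ 1 $ 2 = 0 \<and> A $ 2 $ 1 = 0 \<and> 0 \<le> A $ 2 $ 2}"])
    show "{mat2 1 0 0 (exp t) | t. True} =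
        {A. invertible A} \<inter> {A. A $ 1 $ 1 = 1 \<and> A $ 1 $ 2 = 0 \<and> A $ 2 $ 1 = 0 \<and> 0 \<le> A $ 2 $ 2}"
      by (rule set_mat2_eqI) (auto simp: exp_range)
    show "closed {A :: real^2^2. A $ 1 $ 1 = 1 \<and> A $ 1 $ 2 = 0 \<and> A $ 2 $ 1 = 0 \<and> 0 \<le> A $ 2 $ 2}"
      by (intro closed_Collect_conj closed_Collect_eq closed_Collect_le continuous_intros)
    show "linear (\<lambda>u :: real. mat2 u 0 0 0)"
      by (rule linearI) simp_all
    show "continuous_on UNIV (\<lambda>t. mat2 1 0 0 (exp t))"
      by (intro continuous_intros)
  qed (auto simp: Sigma3_def inj_def mat_1_mat2 exp_add)
  have Sigma3_exceptional:
    "semidirect Sigma3 {mat2 (exp t) 0 s (exp (3 * t)) | s t. True} \<in> class_E2 \<and>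
      \<not> reproducing (semidirect Sigma3 {mat2 (exp t) 0 s (exp (3 * t)) | s t. True})"
  proof
    let ?H = "{mat2 (exp t) 0 s (exp (3 * t)) | s t. True}"
    let ?C = "{A :: real^2^2. A $ 1 $ 2 = 0 \<and> A $ 2 $ 2 = (A $ 1 $ 1) ^ 3 \<and> 0 \<le> A $ 1 $ 1}"
    have H_eq: "?H = {A. invertible A} \<inter> ?C"
    proof (rule set_mat2_eqI)
      fix a b c d :: real
      have "(\<exists>t. a = exp t \<and> d = exp (3 * t)) \<longleftrightarrow> 0 < a \<and> d = a ^ 3"
        using exp_of_nat_mult [of 3] exp_range [of a] by auto
      then show "mat2 a b c d \<in> ?H \<longleftrightarrow> mat2 a b c d \<in> {A. invertible A} \<inter> ?C"
        by auto
    qed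
    have C: "closed ?C"
      by (intro closed_Collect_conj closed_Collect_eq closed_Collect_le continuous_intros)
    have sub: "subgroup ?H GL"
    proof (rule subgroup_GL)
      show "mat 1 \<in> ?H"
        by (auto simp: mat_1_mat2 intro!: exI [of _ 0])
      show "g ** h \<in> ?H" if "g \<in> ?H" "h \<in> ?H" for g h
      proof -
        obtain s t s' t' where "g = mat2 (exp t) 0 s (exp (3 * t))" "h = mat2 (exp t') 0 s' (exp (3 * t'))"
          using \<open>g \<in> ?H\<close> \<open>h \<in> ?H\<close> by blast
        then have "g ** h = mat2 (exp (t + t')) 0 (s * exp t' + exp (3 * t) * s') (exp (3 * (t + t')))"
          by (simp add: distrib_left exp_add)
        then show ?thesis
          by blast
      qed
      show "matrix_inv h \<in> ?H" if "h \<in> ?H" for h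
      proof -
        obtain s t where h: "h = mat2 (exp t) 0 s (exp (3 * t))"
          using \<open>h \<in> ?H\<close> by blast
        have "matrix_inv h = mat2 (exp (- t)) 0 (- s * exp (- t) * exp (- (3 * t))) (exp (3 * - t))"
          by (rule matrix_inv_unique) (simp add: h mat_1_mat2 mult.assoc flip: exp_add)
        then show ?thesis
          by blast
      qed
    qed (auto simp: H_eq)
    have S: "subspace Sigma3"
      by (auto simp: subspace_def Sigma3_def zero_mat2)
    have inv: "transpose h ** \<sigma> ** h \<in> Sigma3" if "h \<in> ?H" "\<sigma> \<in> Sigma3" for h \<sigma>
      using that by (auto simp: Sigma3_def)
    show "semidirect Sigma3 ?H \<in> class_E2"
    proof (rule class_E2I [OF sub C H_eq _ _ S _ _ inv])
      have "?H = range (\<lambda>p :: real \<times> real. mat2 (exp (snd p)) 0 (fst p) (exp (3 * snd p)))"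
        by (rule Collect_pairs_eq_range)
      also have "connected \<dots>"
        by (intro connected_continuous_image continuous_intros connected_UNIV)
      finally show "connected ?H" .
      have "mat2 (exp 1) 0 0 (exp (3 * 1)) \<in> ?H"
        by blast
      moreover have "mat2 (exp 1) 0 0 (exp (3 * 1)) \<noteq> mat 1"
        by (simp add: mat_1_mat2)
      ultimately show "?H \<noteq> {mat 1}"
        by blast
      have "mat2 1 0 0 0 \<in> Sigma3"
        by (auto simp: Sigma3_def)
      moreover have "mat2 1 0 0 0 \<noteq> 0"
        by (simp add: zero_mat2)
      ultimately show "Sigma3 \<noteq> {0}"
        by blast
    qed (auto simp: Sigma3_def)
    interpret triangular_group "semidirect Sigma3 ?H"
      using sub S inv by (rule triangular_group_semidirect)
    let ?T = "sol_time / 2"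
    let ?x = "\<lambda>z :: real \<times> real. fst z + snd z * sqrt 3" and ?y = "\<lambda>z :: real \<times> real. fst z - snd z * sqrt 3"
    let ?h = "\<lambda>y t. mat2 (exp (?T * t)) 0 (y * exp (?T * t)) (exp (3 * (?T * t)))"
    let ?c = "\<lambda>z t. tri (mat2 (?x z) 0 0 0) (?h (?y z) t)"
    let ?b = "tri 0 (mat2 (sqrt 2) 0 0 (sqrt 2 / 2)) :: real^(2+2)^(2+2)"
    have e: "exp (- (2 * (?T * t))) = cosh (sol_time * t) - sinh (sol_time * t)"
      "exp (2 * (?T * t)) = cosh (sol_time * t) + sinh (sol_time * t)" for t
      by (simp_all add: cosh_minus_sinh cosh_plus_sinh)
    have x: "?x (z + sol_action t z') = ?x z + exp (- (2 * (?T * t))) * ?x z'"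
      and y: "?y (z + sol_action t z') = ?y z + exp (2 * (?T * t)) * ?y z'" for z z' t
    proof -
      have "a / sqrt 3 * sqrt 3 = a" for a :: real
        by simp
      then have "?x (sol_action t z') = (cosh (sol_time * t) - sinh (sol_time * t)) * ?x z'"
        "?y (sol_action t z') = (cosh (sol_time * t) + sinh (sol_time * t)) * ?y z'"
        by (simp_all add: sol_action_def algebra_simps)
      then show "?x (z + sol_action t z') = ?x z + exp (- (2 * (?T * t))) * ?x z'"
        "?y (z + sol_action t z') = ?y z + exp (2 * (?T * t)) * ?y z'"
        unfolding e by (simp_all add: algebra_simps)
    qed
    show "\<not> reproducing (semidirect Sigma3 ?H)"
    proof (rule not_reproducing_chart [where c = ?c and \<alpha> = sol_action and b = ?b, OF _ _ _ _ _ sol_action_integral])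
      show "semidirect Sigma3 ?H = {?c z t | z t. True}"
      proof (intro equalityI subsetI)
        fix g assume "g \<in> semidirect Sigma3 ?H"
        then obtain u s t where g: "g = tri (mat2 u 0 0 0) (mat2 (exp t) 0 s (exp (3 * t)))"
          by (auto simp: semidirect_tri Sigma3_def)
        define v where "v = s / exp t"
        have "g = ?c ((u + v) / 2, (u - v) / (2 * sqrt 3)) (t / ?T)"
          using sol_time(3) by (simp add: g v_def field_simps)
        then show "g \<in> {?c z t | z t. True}"
          by blast
      next
        fix g assume "g \<in> {?c z t | z t. True}"
        then obtain z t where "g = ?c z t"
          by blast
        moreover have "mat2 (?x z) 0 0 0 \<in> Sigma3" "?h (?y z) t \<in> ?H"
          unfolding Sigma3_def by blast+
        ultimately show "g \<in> semidirect Sigma3 ?H"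
          unfolding semidirect_tri by blast
      qed
      show "?c 0 0 = mat 1"
        by (simp flip: mat_1_mat2 zero_mat2) (simp add: tri_one)
      show "?c z t ** ?c z' t' = ?c (z + sol_action t z') (t + t')" for z t z' t'
        unfolding x y distrib_left [of ?T t t'] by (rule shear_dilation_mult)
      show "z = z' \<and> t - t' \<in> \<int>" if "?c z t = ?c z' t'" for z t z' t'
      proof -
        have "?x z = ?x z'" "?y z = ?y z'" "t = t'"
          using that sol_time(3) by (auto simp: tri_eq_iff)
        then have "fst z = fst z'" "snd z * sqrt 3 = snd z' * sqrt 3" "t = t'"
          by linarith+
        then show ?thesis
          by (simp add: prod_eq_iff)
      qed
      show "continuous_on UNIV (\<lambda>(z, t). ?c z t)"
        unfolding tri_def matrix_inv_shear_dilation case_prod_beta by (intro continuous_intros)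
      show b: "?b \<in> triangular"
        by (rule tri_in_triangular) simp
      show "?b ** ?c z t ** matrix_inv ?b = ?c (z /\<^sub>R 2) t" for z t
      proof -
        have sqrt2: "sqrt 2 * (sqrt 2 * a) = 2 * a" for a :: real
          by (simp flip: mult.assoc)
        have inv: "matrix_inv ?b = tri 0 (mat2 (sqrt 2 / 2) 0 0 (sqrt 2))"
          by (simp add: matrix_inv_tri matrix_inv_mat2 [OF refl] flip: zero_mat2)
        have "?b ** ?c z t ** matrix_inv ?b = matrix_inv (matrix_inv ?b) ** ?c z t ** matrix_inv ?b"
          using b by (simp add: triangular_inv)
        also have "\<dots> = ?c (z /\<^sub>R 2) t"
          unfolding inv
          by (subst tri_conj, simp, simp, rule arg_cong2 [where f = tri])
            (simp_all add: matrix_inv_mat2 [OF refl] field_simps sqrt2)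
        finally show ?thesis .
      qed
    qed
  qed
  have Sigma1_perp_rot:
    "semidirect Sigma1_perp {rot t | t. True} \<in> class_E2 \<and> \<not> reproducing (semidirect Sigma1_perp {rot t | t. True})"
  proof (rule one_parameter_E2_not_reproducing [where h = "\<lambda>t. rot (2 * pi * t)"
        and L = "\<lambda>z :: real \<times> real. mat2 (fst z) (snd z) (snd z) (- fst z)"
        and \<alpha> = "\<lambda>t z. (cos (4 * pi * t) * fst z + sin (4 * pi * t) * snd z, cos (4 * pi * t) * snd z - sin (4 * pi * t) * fst z)"
        and r = "1 / 2", OF rot_set(3,1,2)])
    fix t :: real and z :: "real \<times> real"
    let ?c = "cos (4 * pi * t)" and ?s = "sin (4 * pi * t)"
    let ?C = "cos (2 * pi * t)" and ?S = "sin (2 * pi * t)"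
    have cs: "?c = ?C * ?C - ?S * ?S" "?s = 2 * ?S * ?C"
    proof -
      have "4 * pi * t = 2 * pi * t + 2 * pi * t"
        by simp
      then show "?c = ?C * ?C - ?S * ?S" "?s = 2 * ?S * ?C"
        by (simp_all only: cos_add sin_add) simp
    qed
    have "?C * ?C + ?S * ?S = 1"
      using sin_cos_squared_add2 [of "2 * pi * t"] by (simp add: power2_eq_square)
    from rot_conj [OF this, of "fst z" "snd z"]
    show "transpose (rot (2 * pi * t)) **
        mat2 (fst (?c * fst z + ?s * snd z, ?c * snd z - ?s * fst z))
          (snd (?c * fst z + ?s * snd z, ?c * snd z - ?s * fst z))
          (snd (?c * fst z + ?s * snd z, ?c * snd z - ?s * fst z))
          (- fst (?c * fst z + ?s * snd z, ?c * snd z - ?s * fst z)) ** rot (2 * pi * t) =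
        mat2 (fst z) (snd z) (snd z) (- fst z)"
      by (simp only: rot_def cs fst_conv snd_conv transpose_mat2)
  next
    show "Sigma1_perp = range (\<lambda>z :: real \<times> real. mat2 (fst z) (snd z) (snd z) (- fst z))"
      unfolding Sigma1_perp_def by (rule Collect_pairs_eq_range)
    show "linear (\<lambda>z :: real \<times> real. mat2 (fst z) (snd z) (snd z) (- fst z))"
      by (rule linearI) simp_all
    show "rot (2 * pi * (1 / 2)) \<noteq> mat 1"
      by (rule rot_nontrivial)
  qed (auto simp: distrib_left rot_add inj_def prod_eq_iff intro: continuous_on_rot rot_period)
  have Sigma2_perp_hyp:
    "semidirect Sigma2_perp {hyp t | t. True} \<in> class_E2 \<and> \<not> reproducing (semidirect Sigma2_perp {hyp t | t. True})"
  proof (rule one_parameter_E2_not_reproducing [where h = "\<lambda>t. hyp (sol_time / 2 * t)"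
        and L = "\<lambda>z :: real \<times> real. mat2 (fst z) (sqrt 3 * snd z) (sqrt 3 * snd z) (fst z)"
        and \<alpha> = sol_action and r = 1, OF hyp_range hyp_set])
    fix t :: real and z :: "real \<times> real"
    let ?c = "cosh (sol_time * t)" and ?s = "sinh (sol_time * t)"
    let ?C = "cosh (sol_time / 2 * t)" and ?S = "sinh (sol_time / 2 * t)"
    have cs: "?c = ?C * ?C + ?S * ?S" "?s = 2 * ?S * ?C"
      using cosh_add [of "sol_time / 2 * t" "sol_time / 2 * t"] sinh_add [of "sol_time / 2 * t" "sol_time / 2 * t"]
      by simp_all
    have 1: "?C * ?C - ?S * ?S = 1"
      using hyperbolic_pythagoras [of "sol_time / 2 * t"] by (simp add: power2_eq_square)
    have id: "(?C * ?C - ?S * ?S) * (?C * ?C - ?S * ?S) * x = x" for x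
      by (simp only: 1)
    have L: "fst (sol_action t z) = ?c * fst z - ?s * (sqrt 3 * snd z)"
      "sqrt 3 * snd (sol_action t z) = ?c * (sqrt 3 * snd z) - ?s * fst z"
      by (simp_all add: sol_action_def algebra_simps)
    show "transpose (hyp (sol_time / 2 * t)) **
        mat2 (fst (sol_action t z)) (sqrt 3 * snd (sol_action t z)) (sqrt 3 * snd (sol_action t z)) (fst (sol_action t z)) **
        hyp (sol_time / 2 * t) = mat2 (fst z) (sqrt 3 * snd z) (sqrt 3 * snd z) (fst z)"
      using id [of "fst z"] id [of "sqrt 3 * snd z"]
      unfolding L cs hyp_def by (simp add: algebra_simps)
  next
    show "Sigma2_perp = range (\<lambda>z :: real \<times> real. mat2 (fst z) (sqrt 3 * snd z) (sqrt 3 * snd z) (fst z))"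
    proof (intro equalityI subsetI)
      fix A assume "A \<in> Sigma2_perp"
      then obtain u v where "A = mat2 u v v u"
        by (auto simp: Sigma2_perp_def)
      then show "A \<in> range (\<lambda>z :: real \<times> real. mat2 (fst z) (sqrt 3 * snd z) (sqrt 3 * snd z) (fst z))"
        by (intro range_eqI [of _ _ "(u, v / sqrt 3)"]) simp
    qed (auto simp: Sigma2_perp_def)
    show "continuous_on UNIV (\<lambda>t. hyp (sol_time / 2 * t))"
      by (rule continuous_on_hyp)
    show "hyp (sol_time / 2 * 1) \<noteq> mat 1"
      using hyp_inj [of "sol_time / 2" 0] hyp_0 sol_time by auto
    show "linear (\<lambda>z :: real \<times> real. mat2 (fst z) (sqrt 3 * snd z) (sqrt 3 * snd z) (fst z))"
      by (rule linearI) (simp_all add: algebra_simps)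
  qed (auto simp: distrib_left hyp_add [symmetric] add_divide_distrib inj_def prod_eq_iff sol_time dest!: hyp_inj
      intro: continuous_on_hyp sol_action_integral simp del: integer_points_real2)
  have Sigma3_perp_shear:
    "semidirect Sigma3_perp {mat2 1 t 0 1 | t. True} \<in> class_E2 \<and>
      \<not> reproducing (semidirect Sigma3_perp {mat2 1 t 0 1 | t. True})"
  proof (rule one_parameter_E2_not_reproducing [where h = "\<lambda>t. mat2 1 t 0 1"
        and L = "\<lambda>z :: real \<times> real. mat2 0 (snd z) (snd z) (fst z)"
        and \<alpha> = "\<lambda>t z. (fst z - 2 * t * snd z, snd z)" and r = 1
        and C = "{A. A $ 1 $ 1 = 1 \<and> A $ 2 $ 1 = 0 \<and> A $ 2 $ 2 = 1}"])
    show "{mat2 1 t 0 1 | t. True} = {A. invertible A} \<inter> {A. A $ 1 $ 1 = 1 \<and> A $ 2 $ 1 = 0 \<and> A $ 2 $ 2 = 1}"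
      by (rule set_mat2_eqI) auto
    show "closed {A :: real^2^2. A $ 1 $ 1 = 1 \<and> A $ 2 $ 1 = 0 \<and> A $ 2 $ 2 = 1}"
      by (intro closed_Collect_conj closed_Collect_eq continuous_intros)
    show "linear (\<lambda>z :: real \<times> real. mat2 0 (snd z) (snd z) (fst z))"
      by (rule linearI) simp_all
    show "continuous_on UNIV (\<lambda>t. mat2 1 t 0 1)"
      by (intro continuous_intros)
    show "Sigma3_perp = range (\<lambda>z :: real \<times> real. mat2 0 (snd z) (snd z) (fst z))"
      unfolding Sigma3_perp_def by (rule Collect_pairs_eq_range)
  qed (auto simp: inj_def mat_1_mat2 prod_eq_iff)
  have Sigma3_perp_affine:
    "semidirect Sigma3_perp {mat2 t s 0 1 | s t. t > 0} \<in> class_E2 \<and>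
      \<not> reproducing (semidirect Sigma3_perp {mat2 t s 0 1 | s t. t > 0})"
  proof (rule Sigma3_perp_E2)
    let ?H = "{mat2 t s 0 1 | s t. t > 0}"
    let ?C = "{A :: real^2^2. A $ 2 $ 1 = 0 \<and> A $ 2 $ 2 = 1 \<and> 0 \<le> A $ 1 $ 1}"
    show H_eq: "?H = {A. invertible A} \<inter> ?C"
      by (rule set_mat2_eqI) auto
    show "closed ?C"
      by (intro closed_Collect_conj closed_Collect_eq closed_Collect_le continuous_intros)
    show "subgroup ?H GL"
    proof (rule subgroup_GL)
      show "matrix_inv h \<in> ?H" if "h \<in> ?H" for h
        using that by (auto simp: matrix_inv_mat2 [OF refl])
    qed (auto simp: mat_1_mat2)
    have "?H = (\<lambda>p :: real \<times> real. mat2 (snd p) (fst p) 0 1) ` (UNIV \<times> {0<..})"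
      by (auto simp: image_iff)
    also have "connected \<dots>"
      by (intro connected_continuous_image continuous_intros convex_connected convex_Times convex_UNIV convex_real_interval)
    finally show "connected ?H" .
  qed auto
  have Sigma3_perp_triangular:
    "semidirect Sigma3_perp {mat2 c b 0 a | a b c. a > 0 \<and> c > 0} \<in> class_E2 \<and>
      \<not> reproducing (semidirect Sigma3_perp {mat2 c b 0 a | a b c. a > 0 \<and> c > 0})"
  proof (rule Sigma3_perp_E2)
    let ?H = "{mat2 c b 0 a | a b c. a > 0 \<and> c > 0}"
    let ?C = "{A :: real^2^2. A $ 2 $ 1 = 0 \<and> 0 \<le> A $ 1 $ 1 \<and> 0 \<le> A $ 2 $ 2}"
    show H_eq: "?H = {A. invertible A} \<inter> ?C"
      by (rule set_mat2_eqI) auto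
    show "closed ?C"
      by (intro closed_Collect_conj closed_Collect_eq closed_Collect_le continuous_intros)
    show "subgroup ?H GL"
    proof (rule subgroup_GL)
      show "matrix_inv h \<in> ?H" if "h \<in> ?H" for h
        using that by (auto simp: matrix_inv_mat2 [OF refl])
    qed (auto simp: mat_1_mat2)
    have "?H = (\<lambda>p :: real \<times> real \<times> real. mat2 (fst p) (fst (snd p)) 0 (snd (snd p))) ` ({0<..} \<times> UNIV \<times> {0<..})"
      by (auto simp: image_iff)
    also have "connected \<dots>"
      by (intro connected_continuous_image continuous_intros convex_connected convex_Times convex_UNIV convex_real_interval)
    finally show "connected ?H" .
  qed auto
  show ?thesis
    using assms
    by (elim insertE emptyE; hypsubst)
      (rule Sigma1_rot Sigma2_hyp Sigma3_shear Sigma3_dilation Sigma3_exceptional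
        Sigma1_perp_rot Sigma2_perp_hyp Sigma3_perp_shear Sigma3_perp_affine Sigma3_perp_triangular)+
qed

end
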